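(* Under the standing setting: (a) If $f_0=\infty$ and $f_\infty\in(0,\infty)$, then there exist $\lambda^*\in(0,\infty)$ and $m^*\in(0,\infty]$ such that for every $\lambda\in(0,\lambda^* )$ problem (P$_\lambda$) has a positive solution $u(\lambda)$ with $\|u(\lambda)\|_\infty\in(0,m^* )$, these solutions can be chosen so that $\lim_{\lambda\to0^+}\|u(\lambda)\|_\infty=0$, and, if $m^*\in(0,\infty)$, problem (P$_{\lambda^*}$) has a positive solution. (b) If $f_0\in(0,\infty)$ and $f_\infty=\infty$, then there exist $\lambda^*\in(0,\infty)$ and $m^*\in[0,\infty)$ such that for every $\lambda\in(0,\lambda^* )$ problem (P$_\lambda$) has a positive solution $u(\lambda)$ with $\|u(\lambda)\|_\infty\in(m^*,\infty)$, these solutions can be chosen so that $\lim_{\lambda\to0^+}\|u(\lambda)\|_\infty=\infty$, and, if $m^*\in(0,\infty)$, problem (P$_{\lambda^*}$) has a positive solution.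
   Context: Standing setting. $\varphi:\mathbb{R}\to\mathbb{R}$ is an odd, increasing homeomorphism satisfying condition (A): there exist increasing homeomorphisms $\psi_1,\psi_2:[0,\infty)\to[0,\infty)$ such that $\varphi(x)\psi_1(y)\le \varphi(xy)\le \varphi(x)\psi_2(y)$ for all $x,y\ge 0$. Let $c,d\in C([0,1],(0,\infty))$, and $\|\cdot\|_\infty$ the maximum norm on $C[0,1]$. Let $f\in C([0,\infty),[0,\infty))$ with $f(s)>0$ for $s>0$, and write $f_0=\lim_{s\to0^+}f(s)/\varphi(s)$, $f_\infty=\lim_{s\to\infty}f(s)/\varphi(s)$ (assumed to exist in $[0,\infty]$ whenever referred to). Let $h\in C((0,1),[0,\infty))$, $h\not\equiv 0$, with $\int_0^{1/2}\psi_1^{-1}\big(\int_s^{1/2}h(\tau)d\tau\big)ds+\int_{1/2}^1\psi_1^{-1}\big(\int_{1/2}^s h(\tau)d\tau\big)ds<\infty$. Notation attached to $h$: $\alpha_h=\sup\{x\in(0,1): h=0 \text{ on }(0,x)\}$ ($0$ if empty); $\beta_h=\inf\{x\in(0,1): h=0\text{ on }(x,1)\}$ ($1$ if empty); $\bar\alpha_h=\sup\{x\in(\alpha_h,1]: h>0 \text{ on }(\alpha_h,x)\}$; $\bar\beta_h=\inf\{x\in[0,\beta_h): h>0\text{ on }(x,\beta_h)\}$; $\gamma_h^1=(3\alpha_h+\bar\alpha_h)/4$, $\gamma_h^2=(\bar\beta_h+3\beta_h)/4$. It is assumed that $0\le\alpha_h<\gamma_h^1<\gamma_h^2<\beta_h\le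 1$. For $\lambda\ge0$, problem (P$_\lambda$) is: $(d(t)\varphi(c(t)u'(t)))'+\lambda h(t)f(u(t))=0$ for $t\in(0,1)$, $u(0)=u(1)=0$. A solution is $u\in C[0,1]\cap C^1(0,1)$ such that $t\mapsto d(t)\varphi(c(t)u'(t))$ is continuously differentiable on $(0,1)$ and the equation and boundary conditions hold; it is positive if $u(t)>0$ for all $t\in(0,1)$. *)

theory Defs
  imports "HOL-Analysis.Analysis"
begin

definition odd_incr_homeo :: "(real \<Rightarrow> real) \<Rightarrow> bool" where
  "odd_incr_homeo \<phi> \<longleftrightarrow> strict_mono \<phi> \<and> (\<exists>g. homeomorphism UNIV UNIV \<phi> g)
     \<and> (\<forall>x. \<phi> (- x) = - \<phi> x)"

definition incr_homeo_nonneg :: "(real \<Rightarrow> real) \<Rightarrow> bool" where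
  "incr_homeo_nonneg \<psi> \<longleftrightarrow> strict_mono_on {0..} \<psi> \<and> (\<exists>g. homeomorphism {0..} {0..} \<psi> g)"

definition cond_A :: "(real \<Rightarrow> real) \<Rightarrow> (real \<Rightarrow> real) \<Rightarrow> (real \<Rightarrow> real) \<Rightarrow> bool" where
  "cond_A \<phi> \<psi>1 \<psi>2 \<longleftrightarrow> incr_homeo_nonneg \<psi>1 \<and> incr_homeo_nonneg \<psi>2 \<and>
     (\<forall>x\<ge>0. \<forall>y\<ge>0. \<phi> x * \<psi>1 y \<le> \<phi> (x * y) \<and> \<phi> (x * y) \<le> \<phi> x * \<psi>2 y)"

definition inv_nonneg :: "(real \<Rightarrow> real) \<Rightarrow> real \<Rightarrow> real" where
  "inv_nonneg \<psi> = inv_into {0..} \<psi>"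

definition h_integrability :: "(real \<Rightarrow> real) \<Rightarrow> (real \<Rightarrow> real) \<Rightarrow> bool" where
  "h_integrability \<psi>1 h \<longleftrightarrow>
     (\<integral>\<^sup>+ s. indicator {0<..1/2} s * ennreal (inv_nonneg \<psi>1 (integral {s..1/2} h)) \<partial>lborel)
   + (\<integral>\<^sup>+ s. indicator {1/2..<1} s * ennreal (inv_nonneg \<psi>1 (integral {1/2..s} h)) \<partial>lborel)
   < \<infinity>"

definition alpha_h :: "(real \<Rightarrow> real) \<Rightarrow> real" where
  "alpha_h h = (let S = {x \<in> {0<..<1}. \<forall>t\<in>{0<..<x}. h t = 0} in if S = {} then 0 else Sup S)"

definition beta_h :: "(real \<Rightarrow> real) \<Rightarrow> real" where
  "beta_h h = (let S = {x \<in> {0<..<1}. \<forall>t\<in>{x<..<1}. h t = 0} in if S = {} then 1 else Inf S)"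

definition alphabar_h :: "(real \<Rightarrow> real) \<Rightarrow> real" where
  "alphabar_h h = Sup {x \<in> {alpha_h h<..1}. \<forall>t\<in>{alpha_h h<..<x}. h t > 0}"

definition betabar_h :: "(real \<Rightarrow> real) \<Rightarrow> real" where
  "betabar_h h = Inf {x \<in> {0..<beta_h h}. \<forall>t\<in>{x<..<beta_h h}. h t > 0}"

definition gamma1_h :: "(real \<Rightarrow> real) \<Rightarrow> real" where
  "gamma1_h h = (3 * alpha_h h + alphabar_h h) / 4"

definition gamma2_h :: "(real \<Rightarrow> real) \<Rightarrow> real" where
  "gamma2_h h = (betabar_h h + 3 * beta_h h) / 4"

definition sup_norm :: "(real \<Rightarrow> real) \<Rightarrow> real" where
  "sup_norm u = (SUP t\<in>{0..1}. \<bar>u t\<bar>)"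

definition is_solution ::
  "(real \<Rightarrow> real) \<Rightarrow> (real \<Rightarrow> real) \<Rightarrow> (real \<Rightarrow> real) \<Rightarrow> (real \<Rightarrow> real) \<Rightarrow> (real \<Rightarrow> real)
    \<Rightarrow> real \<Rightarrow> (real \<Rightarrow> real) \<Rightarrow> bool" where
  "is_solution \<phi> c d h f lam u \<longleftrightarrow>
     continuous_on {0..1} u \<and> u 0 = 0 \<and> u 1 = 0 \<and>
     (\<exists>u' w'. continuous_on {0<..<1} u' \<and> continuous_on {0<..<1} w' \<and>
        (\<forall>t\<in>{0<..<1}. (u has_real_derivative u' t) (at t) \<and>
           ((\<lambda>s. d s * \<phi> (c s * u' s)) has_real_derivative w' t) (at t) \<and>
           w' t + lam * h t * f (u t) = 0))"

definition is_pos_solution ::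
  "(real \<Rightarrow> real) \<Rightarrow> (real \<Rightarrow> real) \<Rightarrow> (real \<Rightarrow> real) \<Rightarrow> (real \<Rightarrow> real) \<Rightarrow> (real \<Rightarrow> real)
    \<Rightarrow> real \<Rightarrow> (real \<Rightarrow> real) \<Rightarrow> bool" where
  "is_pos_solution \<phi> c d h f lam u \<longleftrightarrow>
     is_solution \<phi> c d h f lam u \<and> (\<forall>t\<in>{0<..<1}. u t > 0)"

end

theory Submission
  imports Defs "HOL-Complex_Analysis.Great_Picard"
begin

text \<open>
  Write the equation as a system for \<open>u\<close> and the flux \<open>w = d \<phi>(c u')\<close>. On a compact
  interval \<open>[a, b]\<close> inside \<open>(0, 1)\<close> a positive solution is found by shooting with the initial
  flux \<open>w a\<close>: the growth of \<open>f / \<phi>\<close> at \<open>0\<close> and at \<open>\<infinity>\<close> forces \<open>u b\<close> to have opposite signs for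
  small and for large initial flux. Since \<open>f\<close> and \<open>\<phi>\<^sup>-\<^sup>1\<close> are merely continuous, the intermediate
  value theorem is applied to delayed equations, whose solutions are unique.

  Since \<open>w\<close> decreases, \<open>u\<close> lies above a multiple of its maximum away from the endpoints. Together with
  condition (A) this bounds the maximum from above and from below, uniformly in \<open>[a, b]\<close>, and gives
  a modulus of continuity governed by the integrability condition on \<open>h\<close>, so that \<open>[a, b]\<close> can be
  exhausted to \<open>(0, 1)\<close>. In case (a) \<open>f\<close> is frozen beyond \<open>r\<close>, and for small \<open>\<lambda>\<close> the solution stays
  below \<open>r\<close>; in case (b), for small \<open>\<lambda>\<close> no solution has norm below \<open>r\<close>. The theorem permits
  \<open>m\<^sup>* = \<infinity>\<close> in (a) and \<open>m\<^sup>* = 0\<close> in (b), and these values are used.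
\<close>

section \<open>Shooting without uniqueness\<close>

text \<open>Condition (A) stands in for homogeneity. Its lower half, inverted, reads
  \<open>g (x * y) \<le> g x * k y\<close> with \<open>g\<close> inverse to \<phi> and
  \<open>k\<close> inverse to \<psi>1, and turns flux bounds into integrable velocity bounds. Its
  upper half yields one constant \<kappa> such that a solution with maximum M must take some value
  \<xi> between \<theta> M and M with \<open>F \<xi> \<le> \<kappa> * \<phi> \<xi>\<close>. A
  quotient f / \<phi> tending to infinity therefore excludes small maxima in case (a) and large ones
  in case (b).

  The obstacle is that h itself may fail to be integrable on (0, 1), so fluxes may blow up at the
  endpoints; the uniform flux bounds are anchored at t = 1/2. In case (b) this has a second effect:
  f is comparable to \<phi> at 0, so the flux lost along a small solution is bounded only by a
  multiple of the initial flux, with a factor that can grow as [a, b] exhausts (0, 1). Small initial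
  flux need not overshoot for f itself; hence a damping of the nonlinearity near 0, which disappears
  in the limit.\<close>

definition ivp_solution ::
  "(real \<Rightarrow> 'e \<Rightarrow> 'e) \<Rightarrow> real \<Rightarrow> real \<Rightarrow> 'e \<Rightarrow> (real \<Rightarrow> 'e::euclidean_space) \<Rightarrow> bool" where
  "ivp_solution X a b x0 x \<longleftrightarrow> continuous_on {a..b} x \<and>
     (\<forall>t\<in>{a..b}. x t = x0 + integral {a..t} (\<lambda>s. X s (x s)))"

text \<open>Picard iterates for the equation whose field at time s sees the state at time s -
  \<epsilon>; \<open>max a\<close> freezes the history before a at the initial value.\<close>

primrec delay_iter ::
  "(real \<Rightarrow> 'e \<Rightarrow> 'e) \<Rightarrow> real \<Rightarrow> real \<Rightarrow> nat \<Rightarrow> 'e \<Rightarrow> real \<Rightarrow> 'e::euclidean_space" where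
  "delay_iter X a \<epsilon> 0 x0 t = x0"
| "delay_iter X a \<epsilon> (Suc k) x0 t
     = x0 + integral {a..t} (\<lambda>s. X s (delay_iter X a \<epsilon> k x0 (max a (s - \<epsilon>))))"

locale bounded_field =
  fixes X :: "real \<Rightarrow> 'e \<Rightarrow> 'e::euclidean_space" and a b B :: real
  assumes ab: "a \<le> b"
    and cont: "continuous_on ({a..b} \<times> UNIV) (\<lambda>(t, x). X t x)"
    and bound: "\<And>t x. t \<in> {a..b} \<Longrightarrow> norm (X t x) \<le> B"
begin

lemma B_nonneg: "0 \<le> B"
  using bound[of a 0] ab norm_ge_zero[of "X a 0"] by (auto simp del: norm_ge_zero)

lemma continuous_on_field:
  assumes "continuous_on S z" "S \<subseteq> {a..b}"
  shows "continuous_on S (\<lambda>s. X s (z s))"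
proof -
  have "continuous_on S ((\<lambda>(t, x). X t x) \<circ> (\<lambda>s. (s, z s)))"
    using assms by (intro continuous_on_compose continuous_on_subset[OF cont] continuous_intros) auto
  then show ?thesis by (simp add: o_def)
qed

lemma lipschitz_integral:
  assumes z: "continuous_on {a..b} z" and st: "s \<in> {a..b}" "t \<in> {a..b}"
  shows "norm (integral {a..t} (\<lambda>r. X r (z r)) - integral {a..s} (\<lambda>r. X r (z r))) \<le> B * \<bar>t - s\<bar>"
proof -
  have *: "norm (integral {a..t} (\<lambda>r. X r (z r)) - integral {a..s} (\<lambda>r. X r (z r))) \<le> B * (t - s)"
    if "s \<le> t" "s \<in> {a..b}" "t \<in> {a..b}" for s t
  proof -
    have c: "continuous_on {a..t} (\<lambda>r. X r (z r))"
      using that by (intro continuous_on_field continuous_on_subset[OF z]) auto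
    have "integral {a..t} (\<lambda>r. X r (z r)) - integral {a..s} (\<lambda>r. X r (z r))
        = integral {s..t} (\<lambda>r. X r (z r))"
      using Henstock_Kurzweil_Integration.integral_combine[OF _ _ integrable_continuous_real[OF c], of s] that by (simp add: algebra_simps)
    also have "norm \<dots> \<le> B * (t - s)"
      by (rule integral_bound) (use that bound in \<open>auto intro: continuous_on_subset[OF c]\<close>)
    finally show ?thesis .
  qed
  show ?thesis
  proof (cases "s \<le> t")
    case True then show ?thesis using * st by auto
  next
    case False
    then show ?thesis using *[of t s] st by (auto simp: norm_minus_commute)
  qed
qed

text \<open>One induction yields both claims, since continuity of the delayed iterate makes the next
  integrand integrable. The Lipschitz constant depends on neither the iterate, the delay nor the
  initial value, whence equicontinuity later.\<close>

lemma delay_iter_lipschitz: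
  assumes "0 \<le> \<epsilon>" "s \<in> {a..b}" "t \<in> {a..b}"
  shows "norm (delay_iter X a \<epsilon> k x0 t - delay_iter X a \<epsilon> k x0 s) \<le> B * \<bar>t - s\<bar>"
    and "continuous_on {a..b} (\<lambda>r. delay_iter X a \<epsilon> k x0 (max a (r - \<epsilon>)))"
proof -
  have "(\<forall>s\<in>{a..b}. \<forall>t\<in>{a..b}.
      norm (delay_iter X a \<epsilon> k x0 t - delay_iter X a \<epsilon> k x0 s) \<le> B * \<bar>t - s\<bar>) \<and>
      continuous_on {a..b} (\<lambda>r. delay_iter X a \<epsilon> k x0 (max a (r - \<epsilon>)))"
  proof (induction k)
    case 0
    then show ?case using B_nonneg by auto
  next
    case (Suc k)
    have L: "norm (delay_iter X a \<epsilon> (Suc k) x0 t - delay_iter X a \<epsilon> (Suc k) x0 s) \<le> B * \<bar>t - s\<bar>"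
      if "s \<in> {a..b}" "t \<in> {a..b}" for s t
      using lipschitz_integral[OF conjunct2[OF Suc] that] by simp
    have "B-lipschitz_on {a..b} (delay_iter X a \<epsilon> (Suc k) x0)"
      using L B_nonneg by (intro lipschitz_onI) (auto simp: dist_norm)
    then have "continuous_on {a..b} (delay_iter X a \<epsilon> (Suc k) x0)"
      by (rule lipschitz_on_continuous_on)
    then have "continuous_on {a..b} (\<lambda>r. delay_iter X a \<epsilon> (Suc k) x0 (max a (r - \<epsilon>)))"
      by (rule continuous_on_compose2) (use assms(1) ab in \<open>auto intro!: continuous_intros\<close>)
    with L show ?case by blast
  qed
  with assms show "norm (delay_iter X a \<epsilon> k x0 t - delay_iter X a \<epsilon> k x0 s) \<le> B * \<bar>t - s\<bar>"
    "continuous_on {a..b} (\<lambda>r. delay_iter X a \<epsilon> k x0 (max a (r - \<epsilon>)))"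
    by blast+
qed

text \<open>Method of steps: up to time a + (k + 1) \<epsilon> an iterate consults its predecessor
  only up to a + k \<epsilon>, where the iteration is already stationary.\<close>

lemma delay_iter_stabilises:
  assumes "0 \<le> \<epsilon>" "a \<le> t" "t \<le> a + real k * \<epsilon>"
  shows "delay_iter X a \<epsilon> (Suc k) x0 t = delay_iter X a \<epsilon> k x0 t"
  using assms
proof (induction k arbitrary: t)
  case 0
  then show ?case by auto
next
  case (Suc k)
  have "integral {a..t} (\<lambda>s. X s (delay_iter X a \<epsilon> (Suc k) x0 (max a (s - \<epsilon>))))
      = integral {a..t} (\<lambda>s. X s (delay_iter X a \<epsilon> k x0 (max a (s - \<epsilon>))))"
  proof (rule integral_cong)
    fix s assume "s \<in> {a..t}"
    then have "delay_iter X a \<epsilon> (Suc k) x0 (max a (s - \<epsilon>)) = delay_iter X a \<epsilon> k x0 (max a (s - \<epsilon>))"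
      using Suc.prems by (intro Suc.IH) (auto simp: algebra_simps)
    then show "X s (delay_iter X a \<epsilon> (Suc k) x0 (max a (s - \<epsilon>)))
        = X s (delay_iter X a \<epsilon> k x0 (max a (s - \<epsilon>)))" by simp
  qed
  then show ?case by simp
qed

lemma integral_tendsto:
  assumes z: "\<And>n. continuous_on {a..b} (z n)"
    and lim: "\<And>s. s \<in> {a..b} \<Longrightarrow> (\<lambda>n. z n s) \<longlonglongrightarrow> y s" and t: "t \<in> {a..b}"
  shows "(\<lambda>n. integral {a..t} (\<lambda>s. X s (z n s))) \<longlonglongrightarrow> integral {a..t} (\<lambda>s. X s (y s))"
proof (rule dominated_convergence(2)[where h = "\<lambda>_. B"])
  show "(\<lambda>s. X s (z n s)) integrable_on {a..t}" for n
    using t by (intro integrable_continuous_real continuous_on_field continuous_on_subset[OF z]) auto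
  show "(\<lambda>_. B) integrable_on {a..t}" by auto
  show "norm (X s (z n s)) \<le> B" if "s \<in> {a..t}" for n s using that t bound by auto
  show "(\<lambda>n. X s (z n s)) \<longlonglongrightarrow> X s (y s)" if "s \<in> {a..t}" for s
  proof -
    have "continuous_on UNIV (\<lambda>x. X s x)"
    proof -
      have "continuous_on UNIV (\<lambda>x. (\<lambda>(t, x). X t x) (s, x))"
        using that t by (intro continuous_on_compose2[OF cont]) (auto intro!: continuous_intros)
      then show ?thesis by simp
    qed
    then have "isCont (X s) (y s)" by (simp add: continuous_on_eq_continuous_at)
    then show ?thesis by (rule isCont_tendsto_compose) (use lim that t in auto)
  qed
qed

text \<open>Continuous dependence on the initial value for a fixed delay, obtained iterate by
  iterate; the intermediate value theorem will rest on it.\<close>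

lemma delay_iter_tendsto:
  assumes "0 \<le> \<epsilon>" "x0 \<longlonglongrightarrow> l" "t \<in> {a..b}"
  shows "(\<lambda>n. delay_iter X a \<epsilon> k (x0 n) t) \<longlonglongrightarrow> delay_iter X a \<epsilon> k l t"
  using assms(3)
proof (induction k arbitrary: t)
  case 0
  then show ?case using assms by simp
next
  case (Suc k)
  have "(\<lambda>n. integral {a..t} (\<lambda>s. X s (delay_iter X a \<epsilon> k (x0 n) (max a (s - \<epsilon>)))))
      \<longlonglongrightarrow> integral {a..t} (\<lambda>s. X s (delay_iter X a \<epsilon> k l (max a (s - \<epsilon>))))"
    using assms Suc.prems
    by (intro integral_tendsto delay_iter_lipschitz(2)[of \<epsilon> a a] Suc.IH) auto
  then show ?case using assms by (auto intro!: tendsto_intros)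
qed

section \<open>Solutions of the delayed equations and their limits\<close>

definition delay_step :: "nat \<Rightarrow> real" where "delay_step n = (b - a) / real (Suc n)"

text \<open>The iterate of index \<open>Suc n\<close> already solves the delayed equation on all of \<open>[a, b]\<close>.\<close>
definition delay_sol :: "nat \<Rightarrow> 'e \<Rightarrow> real \<Rightarrow> 'e" where
  "delay_sol n x0 = delay_iter X a (delay_step n) (Suc n) x0"

lemma delay_step: "0 \<le> delay_step n" "delay_step \<longlonglongrightarrow> 0"
proof -
  show "0 \<le> delay_step n" using ab by (simp add: delay_step_def)
  have "(\<lambda>n. (b - a) * inverse (real (Suc n))) \<longlonglongrightarrow> (b - a) * 0"
    by (intro tendsto_intros LIMSEQ_inverse_real_of_nat)
  then show "delay_step \<longlonglongrightarrow> 0" by (simp add: delay_step_def[abs_def] divide_inverse)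
qed

lemma continuous_on_delay_sol:
  "continuous_on {a..b} (\<lambda>r. delay_sol n x0 (max a (r - delay_step n)))"
  unfolding delay_sol_def by (rule delay_iter_lipschitz(2)[of _ a a]) (use delay_step ab in auto)

lemma delay_sol_eq:
  assumes "t \<in> {a..b}"
  shows "delay_sol n x0 t
    = x0 + integral {a..t} (\<lambda>s. X s (delay_sol n x0 (max a (s - delay_step n))))"
proof -
  have "t \<le> a + real (Suc n) * delay_step n"
    using assms by (simp add: delay_step_def del: of_nat_Suc)
  then have "delay_iter X a (delay_step n) (Suc (Suc n)) x0 t = delay_sol n x0 t"
    unfolding delay_sol_def using assms delay_step by (intro delay_iter_stabilises) auto
  then show ?thesis by (simp add: delay_sol_def)
qed

text \<open>Arzela-Ascoli with the uniform Lipschitz bound; the limit solves the undelayed equation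
  because reading the state late costs at most \<open>B * delay_step n\<close>. Initial values and
  delays may both vary, since the shooting argument extracts subsequences of both.\<close>

lemma delay_sol_compactness:
  fixes x0 :: "nat \<Rightarrow> 'e" and s :: "nat \<Rightarrow> nat"
  assumes x0: "x0 \<longlonglongrightarrow> l" and s: "strict_mono s"
  obtains x r where "ivp_solution X a b l x" "strict_mono (r :: nat \<Rightarrow> nat)"
    "\<And>t. t \<in> {a..b} \<Longrightarrow> (\<lambda>n. delay_sol (s (r n)) (x0 (r n)) t) \<longlonglongrightarrow> x t"
proof -
  let ?Y = "\<lambda>n. delay_sol (s n) (x0 n)"
  have lip: "norm (?Y n t - ?Y n t') \<le> B * \<bar>t - t'\<bar>" if "t \<in> {a..b}" "t' \<in> {a..b}" for n t t'
    unfolding delay_sol_def by (rule delay_iter_lipschitz(1)) (use that delay_step in auto)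
  have Ya: "?Y n a = x0 n" for n using delay_sol_eq[of a "s n"] ab by simp
  obtain M where M: "\<And>n. norm (x0 n) \<le> M"
    using convergent_imp_bounded[OF x0] by (auto simp: bounded_iff)
  have Yb: "norm (?Y n t) \<le> M + B * (b - a)" if "t \<in> {a..b}" for n t
  proof -
    have "norm (?Y n t) \<le> norm (?Y n a) + norm (?Y n t - ?Y n a)"
      by (metis add.commute diff_add_cancel norm_triangle_ineq)
    also have "\<dots> \<le> M + B * \<bar>t - a\<bar>"
      using that ab M[of n] by (intro add_mono lip) (auto simp: Ya)
    also have "\<dots> \<le> M + B * (b - a)"
      using that B_nonneg by (intro add_left_mono mult_left_mono) auto
    finally show ?thesis .
  qed
  obtain x r where x: "continuous_on {a..b} x" and r: "strict_mono (r :: nat \<Rightarrow> nat)"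
    and lim: "\<And>e. 0 < e \<Longrightarrow> \<exists>N. \<forall>n t. n \<ge> N \<and> t \<in> {a..b} \<longrightarrow> norm (?Y (r n) t - x t) < e"
  proof (rule Arzela_Ascoli[of "{a..b}" ?Y "M + B * (b - a)"])
    fix t e :: real assume t: "t \<in> {a..b}" and e: "0 < e"
    show "\<exists>d>0. \<forall>n y. y \<in> {a..b} \<and> norm (t - y) < d \<longrightarrow> norm (?Y n t - ?Y n y) < e"
    proof (intro exI conjI allI impI)
      show "0 < e / (B + 1)" using e B_nonneg by simp
      fix n y assume y: "y \<in> {a..b} \<and> norm (t - y) < e / (B + 1)"
      have "norm (?Y n t - ?Y n y) \<le> B * \<bar>t - y\<bar>" using lip t y by blast
      also have "\<dots> \<le> (B + 1) * \<bar>t - y\<bar>" by (simp add: mult_right_mono)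
      also have "\<dots> < e" using y B_nonneg by (simp add: pos_less_divide_eq mult.commute)
      finally show "norm (?Y n t - ?Y n y) < e" .
    qed
  qed (use Yb in auto)
  have ptw: "(\<lambda>n. ?Y (r n) t) \<longlonglongrightarrow> x t" if "t \<in> {a..b}" for t
    using lim that unfolding LIMSEQ_def dist_norm by meson
  have sr: "filterlim (\<lambda>n. s (r n)) at_top sequentially"
    using filterlim_subseq[OF strict_mono_o[OF s r]] by (simp add: o_def)
  have eps: "(\<lambda>n. delay_step (s (r n))) \<longlonglongrightarrow> 0"
    by (rule filterlim_compose[OF delay_step(2) sr])
  have del: "(\<lambda>n. ?Y (r n) (max a (t - delay_step (s (r n))))) \<longlonglongrightarrow> x t" if "t \<in> {a..b}" for t
  proof -
    have "(\<lambda>n. ?Y (r n) (max a (t - delay_step (s (r n)))) - ?Y (r n) t) \<longlonglongrightarrow> 0"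
    proof (rule Lim_null_comparison)
      show "\<forall>\<^sub>F n in sequentially. norm (?Y (r n) (max a (t - delay_step (s (r n)))) - ?Y (r n) t)
          \<le> B * delay_step (s (r n))"
      proof (rule always_eventually, rule allI)
        fix n
        have "norm (?Y (r n) (max a (t - delay_step (s (r n)))) - ?Y (r n) t)
            \<le> B * \<bar>max a (t - delay_step (s (r n))) - t\<bar>"
          using that delay_step(1)[of "s (r n)"] by (intro lip) auto
        also have "\<dots> \<le> B * delay_step (s (r n))"
          using that delay_step(1)[of "s (r n)"] B_nonneg by (intro mult_left_mono) auto
        finally show "norm (?Y (r n) (max a (t - delay_step (s (r n)))) - ?Y (r n) t)
          \<le> B * delay_step (s (r n))" .
      qed
      show "(\<lambda>n. B * delay_step (s (r n))) \<longlonglongrightarrow> 0" using tendsto_mult_right_zero[OF eps] by simp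
    qed
    from tendsto_add[OF this ptw[OF that]] show ?thesis by simp
  qed
  have "ivp_solution X a b l x"
    unfolding ivp_solution_def
  proof (intro conjI ballI x)
    fix t assume t: "t \<in> {a..b}"
    have "(\<lambda>n. integral {a..t} (\<lambda>u. X u (?Y (r n) (max a (u - delay_step (s (r n)))))))
        \<longlonglongrightarrow> integral {a..t} (\<lambda>u. X u (x u))"
      by (intro integral_tendsto continuous_on_delay_sol del t)
    then have "(\<lambda>n. x0 (r n) + integral {a..t} (\<lambda>u. X u (?Y (r n) (max a (u - delay_step (s (r n)))))))
        \<longlonglongrightarrow> l + integral {a..t} (\<lambda>u. X u (x u))"
      by (intro tendsto_add LIMSEQ_subseq_LIMSEQ[OF x0 r, unfolded o_def])
    then have "(\<lambda>n. ?Y (r n) t) \<longlonglongrightarrow> l + integral {a..t} (\<lambda>u. X u (x u))"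
      by (simp add: delay_sol_eq[OF t, symmetric])
    with ptw[OF t] show "x t = l + integral {a..t} (\<lambda>u. X u (x u))"
      by (rule LIMSEQ_unique)
  qed
  then show ?thesis using r ptw that by blast
qed

text \<open>Solutions need not be unique, so no continuous solution map is available. The delayed
  equations have one; the intermediate value theorem is applied there.\<close>
theorem shooting:
  fixes \<gamma> :: "real \<Rightarrow> 'e" and \<pi> :: "'e \<Rightarrow> real"
  assumes \<gamma>: "continuous_on {p..q} \<gamma>" and pq: "p \<le> q" and \<pi>: "continuous_on UNIV \<pi>"
    and neg: "\<And>x. ivp_solution X a b (\<gamma> p) x \<Longrightarrow> \<pi> (x b) < 0"
    and pos: "\<And>x. ivp_solution X a b (\<gamma> q) x \<Longrightarrow> 0 < \<pi> (x b)"
  obtains \<tau> x where "\<tau> \<in> {p..q}" "ivp_solution X a b (\<gamma> \<tau>) x" "\<pi> (x b) = 0"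
proof -
  have lim: "\<exists>x (r::nat\<Rightarrow>nat). ivp_solution X a b l x \<and> strict_mono r \<and>
      (\<lambda>n. \<pi> (delay_sol (s (r n)) (x0 (r n)) b)) \<longlonglongrightarrow> \<pi> (x b)"
    if x0: "x0 \<longlonglongrightarrow> l" and s: "strict_mono s" for x0 l and s :: "nat \<Rightarrow> nat"
  proof -
    from delay_sol_compactness[OF x0 s] obtain x and r :: "nat \<Rightarrow> nat" where x: "ivp_solution X a b l x" "strict_mono r"
      "\<And>t. t \<in> {a..b} \<Longrightarrow> (\<lambda>n. delay_sol (s (r n)) (x0 (r n)) t) \<longlonglongrightarrow> x t" by metis
    have "isCont \<pi> (x b)" using \<pi> by (simp add: continuous_on_eq_continuous_at)
    then have "(\<lambda>n. \<pi> (delay_sol (s (r n)) (x0 (r n)) b)) \<longlonglongrightarrow> \<pi> (x b)"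
      by (rule isCont_tendsto_compose) (use x ab in auto)
    with x show ?thesis by blast
  qed
  \<comment> \<open>R is a closed negation of a strict sign condition. If it held for infinitely
    many delays, a subsequence would converge to a true solution whose end value satisfies
    R.\<close>
  have ev: "\<forall>\<^sub>F n in sequentially. \<not> R (\<pi> (delay_sol n x0 b))"
    if R: "closed {y. R y}" "\<And>x. ivp_solution X a b x0 x \<Longrightarrow> \<not> R (\<pi> (x b))" for R x0
  proof (rule ccontr)
    assume "\<not> ?thesis"
    then have inf: "infinite {n. R (\<pi> (delay_sol n x0 b))}"
      unfolding not_eventually not_not cofinite_eq_sequentially[symmetric] frequently_cofinite .
    obtain s where s: "strict_mono (s :: nat \<Rightarrow> nat)" "\<And>n. R (\<pi> (delay_sol (s n) x0 b))"
      using infinite_enumerate[OF inf] by auto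
    obtain x and r :: "nat \<Rightarrow> nat" where x: "ivp_solution X a b x0 x" "strict_mono r"
      "(\<lambda>n. \<pi> (delay_sol (s (r n)) x0 b)) \<longlonglongrightarrow> \<pi> (x b)"
      using lim[OF tendsto_const[of x0] s(1)] by blast
    have "\<pi> (x b) \<in> {y. R y}"
      by (rule closed_sequentially[OF R(1) _ x(3)]) (use s in auto)
    with R(2)[OF x(1)] show False by simp
  qed
  have "\<forall>\<^sub>F n in sequentially. \<pi> (delay_sol n (\<gamma> p) b) < 0 \<and> 0 < \<pi> (delay_sol n (\<gamma> q) b)"
  proof (intro eventually_conj)
    have "closed {y :: real. 0 \<le> y}" "closed {y :: real. y \<le> 0}"
      by (auto intro!: closed_Collect_le continuous_intros)
    with ev[of "\<lambda>y. 0 \<le> y" "\<gamma> p"] ev[of "\<lambda>y. y \<le> 0" "\<gamma> q"] neg pos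
    show "\<forall>\<^sub>F n in sequentially. \<pi> (delay_sol n (\<gamma> p) b) < 0"
      "\<forall>\<^sub>F n in sequentially. 0 < \<pi> (delay_sol n (\<gamma> q) b)"
      by (simp_all only: not_le)
  qed
  then obtain N where N: "\<And>n. n \<ge> N \<Longrightarrow> \<pi> (delay_sol n (\<gamma> p) b) < 0 \<and> 0 < \<pi> (delay_sol n (\<gamma> q) b)"
    by (auto simp: eventually_sequentially)
  have "\<exists>\<tau>\<in>{p..q}. \<pi> (delay_sol (n + N) (\<gamma> \<tau>) b) = 0" for n
  proof -
    have "continuous_on {p..q} (\<lambda>\<tau>. \<pi> (delay_sol (n + N) (\<gamma> \<tau>) b))"
      unfolding continuous_on_sequentially
    proof (intro allI impI ballI, goal_cases)
      case (1 \<tau> l)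
      then have "(\<lambda>k. \<gamma> (\<tau> k)) \<longlonglongrightarrow> \<gamma> l"
        using \<gamma> by (auto simp: continuous_on_sequentially o_def)
      then have "(\<lambda>k. delay_sol (n + N) (\<gamma> (\<tau> k)) b) \<longlonglongrightarrow> delay_sol (n + N) (\<gamma> l) b"
        unfolding delay_sol_def using delay_step ab by (intro delay_iter_tendsto) auto
      then show ?case unfolding o_def
        using \<pi> by (auto simp: continuous_on_eq_continuous_at intro: isCont_tendsto_compose[of _ \<pi>])
    qed
    with IVT'[of "\<lambda>\<tau>. \<pi> (delay_sol (n + N) (\<gamma> \<tau>) b)" p 0 q] N[of "n + N"] pq
    show ?thesis by fastforce
  qed
  then obtain \<tau> where \<tau>: "\<And>n. \<tau> n \<in> {p..q}" "\<And>n. \<pi> (delay_sol (n + N) (\<gamma> (\<tau> n)) b) = 0"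
    by metis
  \<comment> \<open>The zeros of the delayed problems occur at parameters depending on n; a
    convergent subsequence of these, and then of the solutions, yields an exact zero.\<close>
  obtain l and \<rho> :: "nat \<Rightarrow> nat" where l: "l \<in> {p..q}" "strict_mono \<rho>" "(\<tau> \<circ> \<rho>) \<longlonglongrightarrow> l"
    using compact_Icc[of p q] \<tau>(1) unfolding compact_def by meson
  have "(\<lambda>n. \<gamma> (\<tau> (\<rho> n))) \<longlonglongrightarrow> \<gamma> l"
    using \<gamma> l \<tau>(1) by (auto simp: continuous_on_sequentially o_def)
  from lim[OF this, of "\<lambda>n. \<rho> n + N"] l(2)
  obtain x and r :: "nat \<Rightarrow> nat" where x: "ivp_solution X a b (\<gamma> l) x"
    "(\<lambda>n. \<pi> (delay_sol (\<rho> (r n) + N) (\<gamma> (\<tau> (\<rho> (r n)))) b)) \<longlonglongrightarrow> \<pi> (x b)"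
    by (auto simp: strict_mono_def)
  from x(2) have "\<pi> (x b) = 0" by (simp add: \<tau>(2) LIMSEQ_const_iff)
  with l(1) x(1) that show ?thesis by blast
qed

end

section \<open>A priori estimates\<close>

lemma mvt_within_Icc:
  fixes f f' :: "real \<Rightarrow> real"
  assumes f: "\<And>x. x \<in> {a..b} \<Longrightarrow> (f has_real_derivative f' x) (at x within {a..b})"
    and st: "a \<le> s" "s \<le> t" "t \<le> b"
  obtains \<xi> where "\<xi> \<in> {s..t}" "f t - f s = f' \<xi> * (t - s)"
proof -
  have "\<exists>x\<in>{s..t}. f t - f s = (\<lambda>h. f' x * h) (t - s)"
  proof (rule mvt_very_simple[OF st(2)])
    fix x assume "s \<le> x" "x \<le> t"
    then have "(f has_real_derivative f' x) (at x within {s..t})"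
      using st by (intro DERIV_subset[OF f]) auto
    then show "(f has_derivative (\<lambda>h. f' x * h)) (at x within {s..t})"
      by (simp add: has_field_derivative_def)
  qed
  then show ?thesis using that by auto
qed

lemma mono_within_Icc:
  fixes f f' :: "real \<Rightarrow> real"
  assumes f: "\<And>x. x \<in> {a..b} \<Longrightarrow> (f has_real_derivative f' x) (at x within {a..b})"
    and f': "\<And>x. x \<in> {a..b} \<Longrightarrow> 0 \<le> f' x"
    and st: "a \<le> s" "s \<le> t" "t \<le> b"
  shows "f s \<le> f t"
proof -
  obtain \<xi> where "\<xi> \<in> {s..t}" "f t - f s = f' \<xi> * (t - s)"
    using mvt_within_Icc[of a b f f' s t] f st by blast
  moreover from this have "0 \<le> f' \<xi> * (t - s)" using st f' by (intro mult_nonneg_nonneg) auto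
  ultimately show ?thesis by linarith
qed

text \<open>Only this two-sided control of the velocity \<open>v = u'\<close> by the flux \<open>w\<close> is used in the a priori
  estimates; it is invariant under the reflection \<open>t \<mapsto> -t\<close>.\<close>
definition comparable :: "(real \<Rightarrow> real) \<Rightarrow> real \<Rightarrow> real \<Rightarrow> real \<Rightarrow> bool" where
  "comparable A Q v w \<longleftrightarrow>
     (0 \<le> w \<longrightarrow> A w \<le> v \<and> v \<le> Q * A w) \<and> (w \<le> 0 \<longrightarrow> A (- w) \<le> - v \<and> - v \<le> Q * A (- w))"

locale comparison =
  fixes A :: "real \<Rightarrow> real" and Q :: real
  assumes A_mono: "\<And>x y. 0 \<le> x \<Longrightarrow> x \<le> y \<Longrightarrow> A x \<le> A y"
    and A_zero: "A 0 = 0"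
    and A_pos: "\<And>x. 0 < x \<Longrightarrow> 0 < A x"
    and Q_ge_1: "1 \<le> Q"
begin

definition traj where
  "traj h F a b u v w \<longleftrightarrow> (\<forall>x\<in>{a..b}.
      (u has_real_derivative v x) (at x within {a..b}) \<and>
      (w has_real_derivative - (h x * F (u x))) (at x within {a..b}) \<and>
      comparable A Q (v x) (w x) \<and> 0 \<le> h x \<and> 0 \<le> F (u x))"
  for h F u v w :: "real \<Rightarrow> real"

lemma trajD:
  assumes "traj h F a b u v w" "x \<in> {a..b}"
  shows "(u has_real_derivative v x) (at x within {a..b})"
    "(w has_real_derivative - (h x * F (u x))) (at x within {a..b})"
    "0 \<le> h x" "0 \<le> F (u x)"
    "0 \<le> w x \<Longrightarrow> A (w x) \<le> v x" "0 \<le> w x \<Longrightarrow> v x \<le> Q * A (w x)"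
    "w x \<le> 0 \<Longrightarrow> A (- w x) \<le> - v x" "w x \<le> 0 \<Longrightarrow> - v x \<le> Q * A (- w x)"
  using assms by (auto simp: traj_def comparable_def)

lemma A_nonneg: "0 \<le> x \<Longrightarrow> 0 \<le> A x"
  using A_mono[of 0 x] A_zero by simp

lemma has_real_derivative_reflect:
  assumes "(f has_real_derivative D) (at (- x) within {a..b})"
  shows "((\<lambda>t. f (- t)) has_real_derivative - D) (at x within {- b..- a})"
proof -
  have "(f has_real_derivative D) (at (- x) within uminus ` {- b..- a})"
    using assms by simp
  moreover have "(uminus has_real_derivative - 1) (at x within {- b..- a})"
    by (auto intro!: derivative_eq_intros)
  ultimately show ?thesis using DERIV_image_chain[of f D uminus x "{- b..- a}" "- 1"]
    by (simp add: o_def)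
qed

text \<open>Lets each estimate be proved only to the left of the maximum: under time reversal
  velocity and flux both change sign, so the flux still decreases.\<close>

lemma traj_reflect:
  assumes "traj h F a b u v w"
  shows "traj (\<lambda>t. h (- t)) F (- b) (- a) (\<lambda>t. u (- t)) (\<lambda>t. - v (- t)) (\<lambda>t. - w (- t))"
  unfolding traj_def
proof (intro ballI conjI)
  fix x assume "x \<in> {- b..- a}"
  then have x: "- x \<in> {a..b}" by auto
  note T = trajD[OF assms x]
  show "((\<lambda>t. u (- t)) has_real_derivative - v (- x)) (at x within {- b..- a})"
    by (rule has_real_derivative_reflect[OF T(1)])
  show "((\<lambda>t. - w (- t)) has_real_derivative - (h (- x) * F (u (- x)))) (at x within {- b..- a})"
    using DERIV_minus[OF has_real_derivative_reflect[OF T(2)]] by simp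
  show "comparable A Q (- v (- x)) (- w (- x))"
    using T(5-8) by (auto simp: comparable_def)
  show "0 \<le> h (- x)" "0 \<le> F (u (- x))" using T by auto
qed

lemma flux_antimono:
  assumes "traj h F a b u v w" "a \<le> s" "s \<le> t" "t \<le> b"
  shows "w t \<le> w s"
proof -
  have "- w s \<le> - w t"
  proof (rule mono_within_Icc[where a = a and b = b and f = "\<lambda>x. - w x" and f' = "\<lambda>x. h x * F (u x)"])
    fix x assume x: "x \<in> {a..b}"
    show "((\<lambda>x. - w x) has_real_derivative h x * F (u x)) (at x within {a..b})"
      using DERIV_minus[OF trajD(2)[OF assms(1) x]] by simp
    show "0 \<le> h x * F (u x)" using trajD(3,4)[OF assms(1) x] by simp
  qed (use assms in auto)
  then show ?thesis by simp
qed

lemma flux_bound: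
  assumes T: "traj h F a b u v w" and st: "a \<le> s" "s \<le> t" "t \<le> b"
    and K: "\<And>x. x \<in> {a..b} \<Longrightarrow> F (u x) \<le> K"
    and H: "\<And>x. x \<in> {a..b} \<Longrightarrow> (H has_real_derivative h x) (at x within {a..b})"
  shows "w s \<le> w t + K * (H t - H s)"
proof -
  have "w s + K * H s \<le> w t + K * H t"
  proof (rule mono_within_Icc[where a = a and b = b and f = "\<lambda>x. w x + K * H x"
        and f' = "\<lambda>x. h x * (K - F (u x))"])
    fix x assume x: "x \<in> {a..b}"
    show "((\<lambda>x. w x + K * H x) has_real_derivative h x * (K - F (u x))) (at x within {a..b})"
      by (rule derivative_eq_intros trajD(2)[OF T x] H[OF x] refl)+ (simp add: algebra_simps)
    show "0 \<le> h x * (K - F (u x))" using trajD(3)[OF T x] K[OF x] by simp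
  qed (use st in auto)
  then show ?thesis by (simp add: algebra_simps)
qed

lemma velocity_abs_bound:
  assumes "traj h F a b u v w" "x \<in> {a..b}"
  shows "\<bar>v x\<bar> \<le> Q * A \<bar>w x\<bar>"
  using trajD(5-8)[OF assms] A_nonneg[of "w x"] A_nonneg[of "- w x"]
  by (cases "0 \<le> w x") auto

text \<open>Stand-in for concavity, the velocity being monotone only up to the factor Q. If the flux
  at t is negative, u does not increase from t to \<sigma>. Otherwise \<open>A (w t)\<close> bounds
  the velocity from below before t, and Q times it bounds the velocity from above after t; comparing
  the two increments gives Q + 1.\<close>

lemma lower_half:
  assumes T: "traj h F a b u v w" and st: "a \<le> t" "t \<le> \<sigma>" "\<sigma> \<le> b" "b - a \<le> 1"
    and ua: "0 \<le> u a" and us: "0 \<le> u \<sigma>"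
  shows "u \<sigma> * (t - a) / (Q + 1) \<le> u t"
proof (cases "0 \<le> w t")
  case False
  obtain \<xi> where \<xi>: "\<xi> \<in> {t..\<sigma>}" "u \<sigma> - u t = v \<xi> * (\<sigma> - t)"
    using mvt_within_Icc[of a b u v t \<sigma>] trajD(1)[OF T] st by blast
  have "w \<xi> \<le> w t" using flux_antimono[OF T] \<xi> st by auto
  then have "v \<xi> \<le> 0" using trajD(7)[OF T, of \<xi>] A_nonneg[of "- w \<xi>"] False \<xi> st by auto
  then have "v \<xi> * (\<sigma> - t) \<le> 0" using st by (simp add: mult_nonpos_nonneg)
  then have "u \<sigma> \<le> u t" using \<xi> by simp
  moreover have "u \<sigma> * (t - a) / (Q + 1) \<le> u \<sigma>"
  proof -
    have "u \<sigma> * (t - a) \<le> u \<sigma> * (Q + 1)" using us st Q_ge_1 by (intro mult_left_mono) auto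
    then show ?thesis using Q_ge_1 by (simp add: pos_divide_le_eq)
  qed
  ultimately show ?thesis by simp
next
  case True
  obtain \<xi> where \<xi>: "\<xi> \<in> {a..t}" "u t - u a = v \<xi> * (t - a)"
    using mvt_within_Icc[of a b u v a t] trajD(1)[OF T] st order.refl[of a] by (metis order.trans)
  obtain \<zeta> where \<zeta>: "\<zeta> \<in> {t..\<sigma>}" "u \<sigma> - u t = v \<zeta> * (\<sigma> - t)"
    using mvt_within_Icc[of a b u v t \<sigma>] trajD(1)[OF T] st by blast
  have "w t \<le> w \<xi>" using flux_antimono[OF T] \<xi> st by auto
  then have 1: "A (w t) \<le> v \<xi>"
    using trajD(5)[OF T, of \<xi>] A_mono[of "w t" "w \<xi>"] True \<xi> st by auto
  have 2: "v \<zeta> \<le> Q * A (w t)"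
  proof (cases "0 \<le> w \<zeta>")
    case True
    moreover have "w \<zeta> \<le> w t" using flux_antimono[OF T] \<zeta> st by auto
    ultimately have "Q * A (w \<zeta>) \<le> Q * A (w t)"
      using A_mono Q_ge_1 by (intro mult_left_mono) auto
    then show ?thesis using trajD(6)[OF T, of \<zeta>] True \<zeta> st by auto
  next
    case False
    then have "v \<zeta> \<le> 0" using trajD(7)[OF T, of \<zeta>] A_nonneg[of "- w \<zeta>"] \<zeta> st by auto
    also have "0 \<le> Q * A (w t)" using A_nonneg[of "w t"] True Q_ge_1 by simp
    finally show ?thesis .
  qed
  have At: "0 \<le> A (w t)" using A_nonneg True by simp
  have a1: "A (w t) * (t - a) \<le> u t" using 1 \<xi> ua st mult_right_mono[OF 1, of "t - a"] by auto
  have "u \<sigma> - u t \<le> Q * A (w t) * (\<sigma> - t)" using \<zeta> st mult_right_mono[OF 2, of "\<sigma> - t"] by auto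
  also have "\<dots> \<le> Q * A (w t) * 1" using st At Q_ge_1 by (intro mult_left_mono) auto
  finally have a2: "u \<sigma> - u t \<le> Q * A (w t)" by simp
  have "u \<sigma> * (t - a) \<le> (u t + Q * A (w t)) * (t - a)"
    using a2 st by (intro mult_right_mono) auto
  also have "\<dots> = u t * (t - a) + Q * (A (w t) * (t - a))" by (simp add: algebra_simps)
  also have "\<dots> \<le> u t * 1 + Q * u t"
  proof (intro add_mono mult_left_mono a1)
    have "0 \<le> A (w t) * (t - a)" using At st by simp
    then show "0 \<le> u t" using a1 by linarith
  qed (use st Q_ge_1 in auto)
  finally show ?thesis using Q_ge_1 by (simp add: pos_divide_le_eq algebra_simps)
qed

lemma lower_bound:
  assumes T: "traj h F a b u v w" and st: "t \<in> {a..b}" "\<sigma> \<in> {a..b}" "b - a \<le> 1"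
    and u: "0 \<le> u a" "0 \<le> u b" "0 \<le> u \<sigma>"
  shows "u \<sigma> * min (t - a) (b - t) / (Q + 1) \<le> u t"
proof -
  have "u \<sigma> * (t - a) / (Q + 1) \<le> u t \<or> u \<sigma> * (b - t) / (Q + 1) \<le> u t"
    using lower_half[OF T, of t \<sigma>] lower_half[OF traj_reflect[OF T], of "- t" "- \<sigma>"] st u
    by (cases "t \<le> \<sigma>") auto
  moreover have "u \<sigma> * min (t - a) (b - t) / (Q + 1) \<le> u \<sigma> * (t - a) / (Q + 1)"
    "u \<sigma> * min (t - a) (b - t) / (Q + 1) \<le> u \<sigma> * (b - t) / (Q + 1)"
    using u Q_ge_1 by (auto intro!: divide_right_mono mult_left_mono)
  ultimately show ?thesis by linarith
qed

section \<open>Bounds for the maximum from below and from above\<close>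

lemma flux_nonneg_before_max:
  assumes T: "traj h F a b u v w" and st: "a \<le> s" "s < \<sigma>" "\<sigma> \<le> b" and le: "u s \<le> u \<sigma>"
  shows "0 \<le> w s"
proof (rule ccontr)
  assume neg: "\<not> 0 \<le> w s"
  obtain \<xi> where \<xi>: "\<xi> \<in> {s..\<sigma>}" "u \<sigma> - u s = v \<xi> * (\<sigma> - s)"
    using mvt_within_Icc[of a b u v s \<sigma>] trajD(1)[OF T] st by (metis less_imp_le)
  have "w \<xi> \<le> w s" using flux_antimono[OF T] \<xi> st by auto
  then have "v \<xi> < 0" using trajD(7)[OF T, of \<xi>] A_pos[of "- w \<xi>"] neg \<xi> st by auto
  then have "v \<xi> * (\<sigma> - s) < 0" using st by (simp add: mult_neg_pos)
  then show False using \<xi> le by simp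
qed

lemma flux_zero_at_max:
  assumes T: "traj h F a b u v w" and \<sigma>: "a < \<sigma>" "\<sigma> < b"
    and max: "\<And>s. s \<in> {a..b} \<Longrightarrow> u s \<le> u \<sigma>"
  shows "w \<sigma> = 0"
proof -
  have "(u has_real_derivative v \<sigma>) (at \<sigma>)"
    using trajD(1)[OF T, of \<sigma>] \<sigma> by (simp add: at_within_Icc_at)
  then have "v \<sigma> = 0"
  proof (rule DERIV_local_max)
    show "0 < min (\<sigma> - a) (b - \<sigma>)" using \<sigma> by simp
    show "\<forall>y. \<bar>\<sigma> - y\<bar> < min (\<sigma> - a) (b - \<sigma>) \<longrightarrow> u y \<le> u \<sigma>"
      by (intro allI impI max) auto
  qed
  then show ?thesis
    using trajD(5)[OF T, of \<sigma>] trajD(7)[OF T, of \<sigma>] A_pos[of "w \<sigma>"] A_pos[of "- w \<sigma>"] \<sigma>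
    by (cases "w \<sigma>" "0::real" rule: linorder_cases) auto
qed

text \<open>The decrease of the flux over the right half forces it to be at least \<eta> m (y - x) /
  2 throughout the left half, so u rises there at a definite rate.\<close>

lemma increment_half:
  assumes T: "traj h F a b u v w" and xy: "a \<le> x" "x \<le> y" "y \<le> b"
    and \<eta>: "0 \<le> \<eta>" "\<And>s. s \<in> {x..y} \<Longrightarrow> \<eta> \<le> h s"
    and m: "0 \<le> m" "\<And>s. s \<in> {x..y} \<Longrightarrow> m \<le> F (u s)" and w: "0 \<le> w y"
  shows "(y - x) / 2 * A (\<eta> * m * ((y - x) / 2)) \<le> u ((x + y) / 2) - u x"
proof -
  define z where "z = (x + y) / 2"
  have z: "x \<le> z" "z \<le> y" "y - z = (y - x) / 2" "z - x = (y - x) / 2" using xy by (auto simp: z_def field_simps)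
  obtain \<xi> where \<xi>: "\<xi> \<in> {x..z}" "u z - u x = v \<xi> * (z - x)"
    using mvt_within_Icc[of a b u v x z] trajD(1)[OF T] xy(1) z(1) order_trans[OF z(2) xy(3)] by blast
  obtain \<zeta> where \<zeta>: "\<zeta> \<in> {z..y}" "w y - w z = - (h \<zeta> * F (u \<zeta>)) * (y - z)"
    using mvt_within_Icc[of a b w "\<lambda>x. - (h x * F (u x))" z y] trajD(2)[OF T] order_trans[OF xy(1) z(1)] z(2) xy(3)
    by blast
  have "\<eta> * m * (y - z) \<le> h \<zeta> * F (u \<zeta>) * (y - z)"
    using \<eta> m \<zeta> z trajD(3)[OF T, of \<zeta>] xy by (intro mult_right_mono mult_mono) auto
  then have "\<eta> * m * (y - z) \<le> w z" using \<zeta> w by simp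
  moreover have "w z \<le> w \<xi>" using flux_antimono[OF T] \<xi> z xy by auto
  moreover have "0 \<le> \<eta> * m * (y - z)" using \<eta> m z by simp
  ultimately have "A (\<eta> * m * (y - z)) \<le> v \<xi>"
    using A_mono[of "\<eta> * m * (y - z)" "w \<xi>"] trajD(5)[OF T, of \<xi>] \<xi>(1) z(1,2) xy by force
  then have "A (\<eta> * m * (y - z)) * (z - x) \<le> v \<xi> * (z - x)"
    by (rule mult_right_mono) (use z(1) in simp)
  then show ?thesis using \<xi> z unfolding z_def[symmetric] by (simp add: mult.commute)
qed

text \<open>Wherever the maximum lies, one outer third of [x1, x2] is on one side of it, and
  \<open>increment_half\<close> applies there, after reflection if it is the right third. Half a
  third accounts for the 6.\<close>

lemma max_lower_estimate:
  assumes T: "traj h F a b u v w" and ab: "b - a \<le> 1"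
    and u: "u a = 0" "0 \<le> u b" and \<sigma>: "\<sigma> \<in> {a..b}" "\<And>s. s \<in> {a..b} \<Longrightarrow> u s \<le> u \<sigma>"
    and F: "continuous_on UNIV F"
    and x: "a \<le> a0" "a0 < x1" "x1 < x2" "x2 < b0" "b0 \<le> b"
    and \<eta>: "0 \<le> \<eta>" "\<And>s. s \<in> {x1..x2} \<Longrightarrow> \<eta> \<le> h s"
  obtains \<xi> where "u \<sigma> * (min (x1 - a0) (b0 - x2) / (Q + 1)) \<le> \<xi>" "\<xi> \<le> u \<sigma>"
    "(x2 - x1) / 6 * A (\<eta> * F \<xi> * ((x2 - x1) / 6)) \<le> u \<sigma>"
proof -
  have us: "0 \<le> u \<sigma>" using \<sigma>(2)[of a] \<sigma>(1) u by simp
  have u0: "0 \<le> u t" if "t \<in> {a..b}" for t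
  proof -
    have "0 \<le> u \<sigma> * min (t - a) (b - t) / (Q + 1)" using us that Q_ge_1 by simp
    then show ?thesis using lower_bound[OF T that \<sigma>(1) ab] u us by simp
  qed
  have "continuous_on {a..b} u"
    using trajD(1)[OF T] by (meson DERIV_continuous continuous_on_eq_continuous_within)
  then have "continuous_on {x1..x2} u" by (rule continuous_on_subset) (use x in auto)
  then have "continuous_on {x1..x2} (\<lambda>s. F (u s))" by (intro continuous_on_compose2[OF F]) auto
  \<comment> \<open>F is not assumed monotone, so \<xi> will be the value of u at a point of
    [x1, x2] where F along u is smallest.\<close>
  then obtain y where y: "y \<in> {x1..x2}" "\<And>s. s \<in> {x1..x2} \<Longrightarrow> F (u y) \<le> F (u s)"
    using continuous_attains_inf[of "{x1..x2}" "\<lambda>s. F (u s)"] x by auto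
  have low: "u \<sigma> * (min (x1 - a0) (b0 - x2) / (Q + 1)) \<le> u y"
  proof -
    have "u \<sigma> * min (x1 - a0) (b0 - x2) / (Q + 1) \<le> u \<sigma> * min (y - a) (b - y) / (Q + 1)"
      using us Q_ge_1 x y by (intro divide_right_mono mult_left_mono) auto
    also have "\<dots> \<le> u y" using lower_bound[OF T _ \<sigma>(1) ab, of y] u us x y by auto
    finally show ?thesis by simp
  qed
  have Fy: "0 \<le> F (u y)" using trajD(4)[OF T, of y] x y by auto
  let ?l = "(x2 - x1) / 3"
  have l: "0 < ?l" "x1 + ?l < x2" using x by (auto simp: field_simps)
  have "?l / 2 * A (\<eta> * F (u y) * (?l / 2)) \<le> u \<sigma>"
  proof (cases "x1 + ?l < \<sigma>")
    case True
    have "(x1 + ?l - x1) / 2 * A (\<eta> * F (u y) * ((x1 + ?l - x1) / 2)) \<le> u ((x1 + (x1 + ?l)) / 2) - u x1"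
    proof (rule increment_half[OF T])
      show "0 \<le> w (x1 + ?l)"
        by (rule flux_nonneg_before_max[OF T, of _ \<sigma>]) (use x True \<sigma> in \<open>auto simp: field_simps\<close>)
    qed (use l x \<eta> y Fy in auto)
    moreover have "u ((x1 + (x1 + ?l)) / 2) \<le> u \<sigma>" using x by (intro \<sigma>(2)) (auto simp: field_simps)
    moreover have "0 \<le> u x1" using x by (intro u0) auto
    ultimately show ?thesis by simp
  next
    case False
    note R = traj_reflect[OF T]
    have "(- x2 + ?l - (- x2)) / 2 * A (\<eta> * F (u y) * ((- x2 + ?l - (- x2)) / 2))
        \<le> u (- ((- x2 + (- x2 + ?l)) / 2)) - u (- (- x2))"
    proof (rule increment_half[OF R])
      show "0 \<le> - w (- (- x2 + ?l))"
        by (rule flux_nonneg_before_max[OF R, of _ "- \<sigma>"])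
          (use x False \<sigma> in \<open>auto simp: field_simps\<close>)
    qed (use l x \<eta> y Fy in auto)
    moreover have "u (- ((- x2 + (- x2 + ?l)) / 2)) \<le> u \<sigma>" using x by (intro \<sigma>(2)) (auto simp: field_simps)
    moreover have "0 \<le> u x2" using x by (intro u0) auto
    ultimately show ?thesis by simp
  qed
  then show ?thesis using low \<sigma>(2)[of y] x y by (intro that[of "u y"]) auto
qed

text \<open>Since the flux is nonpositive at \<sigma>, it is at most K (H \<sigma> - H x) at an
  earlier x. E is a primitive of any majorant D of the resulting velocity bound, and Q E - u is then
  nondecreasing.\<close>

lemma upper_half:
  assumes T: "traj h F a b u v w" and \<sigma>: "a \<le> \<sigma>" "\<sigma> \<le> b" and w: "w \<sigma> \<le> 0"
    and K: "0 \<le> K" "\<And>x. x \<in> {a..b} \<Longrightarrow> F (u x) \<le> K"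
    and H: "\<And>x. x \<in> {a..b} \<Longrightarrow> (H has_real_derivative h x) (at x within {a..b})"
    and E: "\<And>x. x \<in> {a..b} \<Longrightarrow> (E has_real_derivative D x) (at x within {a..b})"
    and D: "\<And>x. x \<in> {a..\<sigma>} \<Longrightarrow> A (K * (H \<sigma> - H x)) \<le> D x"
  shows "u \<sigma> - u a \<le> Q * (E \<sigma> - E a)"
proof -
  have "Q * E a - u a \<le> Q * E \<sigma> - u \<sigma>"
  proof (rule mono_within_Icc[where a = a and b = \<sigma> and f = "\<lambda>x. Q * E x - u x" and f' = "\<lambda>x. Q * D x - v x"])
    fix x assume x: "x \<in> {a..\<sigma>}"
    then have xb: "x \<in> {a..b}" using \<sigma> by auto
    have "((\<lambda>x. Q * E x - u x) has_real_derivative Q * D x - v x) (at x within {a..b})"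
      by (rule derivative_eq_intros E[OF xb] trajD(1)[OF T xb] refl)+ simp
    then show "((\<lambda>x. Q * E x - u x) has_real_derivative Q * D x - v x) (at x within {a..\<sigma>})"
      by (rule DERIV_subset) (use \<sigma> in auto)
    have Hm: "H x \<le> H \<sigma>"
      by (rule mono_within_Icc[OF H]) (use x \<sigma> trajD(3)[OF T] in auto)
    then have nn: "0 \<le> A (K * (H \<sigma> - H x))" using K A_nonneg by simp
    have "v x \<le> Q * A (K * (H \<sigma> - H x))"
    proof (cases "0 \<le> w x")
      case True
      have "w x \<le> w \<sigma> + K * (H \<sigma> - H x)"
        by (rule flux_bound[OF T]) (use x \<sigma> K H in auto)
      then have "A (w x) \<le> A (K * (H \<sigma> - H x))" using True w by (intro A_mono) auto
      then have "Q * A (w x) \<le> Q * A (K * (H \<sigma> - H x))" using Q_ge_1 by (intro mult_left_mono) auto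
      then show ?thesis using trajD(6)[OF T xb True] by linarith
    next
      case False
      then have "v x \<le> 0" using trajD(7)[OF T xb] A_nonneg[of "- w x"] by auto
      also have "0 \<le> Q * A (K * (H \<sigma> - H x))" using nn Q_ge_1 by simp
      finally show ?thesis .
    qed
    also have "\<dots> \<le> Q * D x" using D[OF x] Q_ge_1 by (intro mult_left_mono) auto
    finally show "0 \<le> Q * D x - v x" by simp
  qed (use \<sigma> in auto)
  then show ?thesis by (simp add: algebra_simps)
qed

text \<open>On the half of the interval that contains the maximum, the flux at \<open>x\<close> is at most
  \<open>K \<bar>H x\<bar>\<close>, where \<open>H\<close> is the primitive of \<open>h\<close> vanishing at the midpoint \<open>\<mu>\<close>.\<close>
lemma max_upper_estimate:
  assumes T: "traj h F a b u v w" and \<mu>: "a \<le> \<mu>" "\<mu> \<le> b"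
    and u: "u a = 0" "u b = 0"
    and \<sigma>: "\<sigma> \<in> {a..b}" "\<And>s. s \<in> {a..b} \<Longrightarrow> u s \<le> u \<sigma>"
    and K: "0 \<le> K" "\<And>x. x \<in> {a..b} \<Longrightarrow> F (u x) \<le> K"
    and H: "\<And>x. x \<in> {a..b} \<Longrightarrow> (H has_real_derivative h x) (at x within {a..b})" "H \<mu> = 0"
    and E: "\<And>x. x \<in> {a..b} \<Longrightarrow> (E has_real_derivative D x) (at x within {a..b})"
    and D: "\<And>x. x \<in> {a..b} \<Longrightarrow> A (K * \<bar>H x\<bar>) \<le> D x"
  shows "u \<sigma> \<le> Q * (E b - E a)"
proof -
  have Dnn: "0 \<le> D x" if "x \<in> {a..b}" for x
  proof -
    have "0 \<le> A (K * \<bar>H x\<bar>)" using K by (intro A_nonneg) simp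
    then show ?thesis using D[OF that] by linarith
  qed
  have Em: "E s \<le> E t" if "a \<le> s" "s \<le> t" "t \<le> b" for s t
    by (rule mono_within_Icc[OF E]) (use Dnn that in auto)
  have Hm: "H s \<le> H t" if "a \<le> s" "s \<le> t" "t \<le> b" for s t
    by (rule mono_within_Icc[OF H(1)]) (use trajD(3)[OF T] that in auto)
  show ?thesis
  proof (cases "a < \<sigma> \<and> \<sigma> < b")
    case False
    then have "u \<sigma> = 0" using \<sigma> u by force
    moreover have "0 \<le> Q * (E b - E a)" using Em[of a b] \<mu> Q_ge_1 by simp
    ultimately show ?thesis by simp
  next
    case int: True
    have w: "w \<sigma> = 0" using int \<sigma> by (intro flux_zero_at_max[OF T]) auto
    show ?thesis
    proof (cases "\<sigma> \<le> \<mu>")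
      case True
      have "u \<sigma> - u a \<le> Q * (E \<sigma> - E a)"
      proof (rule upper_half[OF T _ _ _ K H(1) E])
        fix x assume x: "x \<in> {a..\<sigma>}"
        \<comment> \<open>Monotonicity gives \<open>H x \<le> H \<sigma> \<le> H \<mu> = 0\<close>,
          so the difference is at most \<open>\<bar>H x\<bar>\<close>.\<close>
        have "A (K * (H \<sigma> - H x)) \<le> A (K * \<bar>H x\<bar>)"
          using Hm[of \<sigma> \<mu>] Hm[of x \<sigma>] x True int \<mu> H(2) K
          by (intro A_mono mult_left_mono mult_nonneg_nonneg) auto
        also have "\<dots> \<le> D x" using x int by (intro D) auto
        finally show "A (K * (H \<sigma> - H x)) \<le> D x" .
      qed (use int w in auto)
      also have "\<dots> \<le> Q * (E b - E a)" using Em[of \<sigma> b] int Q_ge_1 by (intro mult_left_mono) auto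
      finally show ?thesis using u by simp
    next
      case False
      have "u (- (- \<sigma>)) - u (- (- b)) \<le> Q * (- E (- (- \<sigma>)) - (- E (- (- b))))"
      proof (rule upper_half[OF traj_reflect[OF T], where K = K and H = "\<lambda>t. - H (- t)"
            and D = "\<lambda>t. D (- t)" and E = "\<lambda>t. - E (- t)" and \<sigma> = "- \<sigma>"])
        fix x assume "x \<in> {- b..- a}"
        then have x: "- x \<in> {a..b}" by auto
        show "((\<lambda>t. - H (- t)) has_real_derivative h (- x)) (at x within {- b..- a})"
          using DERIV_minus[OF has_real_derivative_reflect[OF H(1)[OF x]]] by simp
        show "((\<lambda>t. - E (- t)) has_real_derivative D (- x)) (at x within {- b..- a})"
          using DERIV_minus[OF has_real_derivative_reflect[OF E[OF x]]] by simp
        show "F (u (- x)) \<le> K" using K x by auto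
      next
        fix x assume x: "x \<in> {- b..- \<sigma>}"
        have "A (K * (- H (- (- \<sigma>)) - (- H (- x)))) \<le> A (K * \<bar>H (- x)\<bar>)"
          using Hm[of \<mu> \<sigma>] Hm[of \<sigma> "- x"] x False int \<mu> H(2) K
          by (intro A_mono mult_left_mono mult_nonneg_nonneg) auto
        also have "\<dots> \<le> D (- x)" using x int by (intro D) auto
        finally show "A (K * (- H (- (- \<sigma>)) - (- H (- x)))) \<le> D (- x)" .
      qed (use int w K in auto)
      also have "\<dots> = Q * (E b - E \<sigma>)" by simp
      also have "\<dots> \<le> Q * (E b - E a)" using Em[of a \<sigma>] int Q_ge_1 by (intro mult_left_mono) auto
      finally show ?thesis using u by simp
    qed
  qed
qed

end

section \<open>The boundary value problem on compact subintervals\<close>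

lemma continuous_on_Icc_abs_bound:
  fixes f :: "real \<Rightarrow> real"
  assumes "continuous_on {a..b} f"
  obtains K where "0 \<le> K" "\<And>x. x \<in> {a..b} \<Longrightarrow> \<bar>f x\<bar> \<le> K"
proof -
  have "bounded (f ` {a..b})"
    by (rule compact_imp_bounded[OF compact_continuous_image[OF assms compact_Icc]])
  then obtain K where K: "\<And>y. y \<in> f ` {a..b} \<Longrightarrow> norm y \<le> K" unfolding bounded_iff by blast
  show ?thesis
  proof (rule that[of "max 0 K"])
    fix x assume "x \<in> {a..b}"
    then have "norm (f x) \<le> K" by (intro K) simp
    then show "\<bar>f x\<bar> \<le> max 0 K" by simp
  qed simp
qed

text \<open>Here \<open>g\<close> inverts \<phi>, \<open>k\<close> inverts \<psi>1 and \<psi> is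
  \<psi>2, so \<open>g_mult\<close> and \<open>phi_mult\<close> are the two halves of condition (A).
  The integrability of h enters only through E, a primitive of \<open>k \<bar>H t\<bar>\<close>
  continuous up to 0 and 1. On [x1, x2] the weight h is at least \<eta>, and [a0, b0] leaves margins
  around it, which makes constants uniform over the intervals containing [a0, b0].\<close>

locale quasilinear_bvp =
  fixes \<phi> g k \<psi> c d h H E :: "real \<Rightarrow> real"
    and c0 c1 d0 d1 a0 x1 x2 b0 \<eta> :: real
  assumes phi_mono: "strict_mono \<phi>" and phi_odd: "\<And>x. \<phi> (- x) = - \<phi> x"
    and phi_cont: "continuous_on UNIV \<phi>" and g_cont: "continuous_on UNIV g"
    and phi_g: "\<And>y. \<phi> (g y) = y" and g_phi: "\<And>x. g (\<phi> x) = x"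
    and k_nonneg: "\<And>y. 0 \<le> y \<Longrightarrow> 0 \<le> k y" and k_zero: "k 0 = 0"
    and k_cont: "continuous_on {0..} k" and k_mono: "\<And>x y. 0 \<le> x \<Longrightarrow> x \<le> y \<Longrightarrow> k x \<le> k y"
    and g_mult: "\<And>x y. 0 \<le> x \<Longrightarrow> 0 \<le> y \<Longrightarrow> g (x * y) \<le> g x * k y"
    and phi_mult: "\<And>x y. 0 \<le> x \<Longrightarrow> 0 \<le> y \<Longrightarrow> \<phi> (x * y) \<le> \<phi> x * \<psi> y"
    and c_cont: "continuous_on {0..1} c" and d_cont: "continuous_on {0..1} d"
    and c_bounds: "0 < c0" "\<And>t. t \<in> {0..1} \<Longrightarrow> c0 \<le> c t \<and> c t \<le> c1"
    and d_bounds: "0 < d0" "\<And>t. t \<in> {0..1} \<Longrightarrow> d0 \<le> d t \<and> d t \<le> d1"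
    and h_cont: "continuous_on {0<..<1} h" and h_nonneg: "\<And>t. t \<in> {0<..<1} \<Longrightarrow> 0 \<le> h t"
    and h_pos: "0 < a0" "a0 < x1" "x1 < x2" "x2 < b0" "b0 < 1" "0 < \<eta>"
      "\<And>t. t \<in> {x1..x2} \<Longrightarrow> \<eta> \<le> h t"
    and H: "\<And>t. t \<in> {0<..<1} \<Longrightarrow> (H has_real_derivative h t) (at t)" "H (1/2) = 0"
    and E: "continuous_on {0..1} E"
      "\<And>t. t \<in> {0<..<1} \<Longrightarrow> (E has_real_derivative k \<bar>H t\<bar>) (at t)"
begin

section \<open>Order and sign properties of \<phi> and its inverse\<close>

lemma g_mono: "x \<le> y \<Longrightarrow> g x \<le> g y"
  by (metis phi_g phi_mono strict_mono_less_eq)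

lemma g_strict: "x < y \<Longrightarrow> g x < g y"
  by (metis phi_g phi_mono strict_mono_less)

lemma g_odd: "g (- x) = - g x"
  by (metis phi_g g_phi phi_odd)

lemma phi_zero: "\<phi> 0 = 0"
  using phi_odd[of 0] by simp

lemma g_zero: "g 0 = 0"
  using g_phi[of 0] phi_zero by simp

lemma phi_le: "\<phi> x \<le> \<phi> y \<longleftrightarrow> x \<le> y"
  using phi_mono by (simp add: strict_mono_less_eq)

lemma phi_pos: "0 < x \<Longrightarrow> 0 < \<phi> x"
  by (metis phi_zero phi_mono strict_mono_less)

lemma phi_nonneg: "0 \<le> x \<Longrightarrow> 0 \<le> \<phi> x"
  by (metis phi_zero phi_le)

lemma g_nonneg: "0 \<le> x \<Longrightarrow> 0 \<le> g x"
  using g_mono[of 0 x] g_zero by simp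

lemma c_pos: "t \<in> {0..1} \<Longrightarrow> 0 < c t" and d_pos: "t \<in> {0..1} \<Longrightarrow> 0 < d t"
  using c_bounds d_bounds by (meson less_le_trans)+

lemma c1_pos: "0 < c1" "c0 \<le> c1" and d1_pos: "0 < d1" "d0 \<le> d1"
  using c_bounds(2)[of 0] c_bounds(1) d_bounds(2)[of 0] d_bounds(1) by auto

text \<open>\<open>G t\<close> recovers the velocity from the flux. A is that velocity with c and d
  replaced by their upper bounds, hence a lower bound at nonnegative flux. Q is the price of the
  reverse inequality: \<open>k (d1 / d0)\<close> comes from \<open>g_mult\<close> applied to w / d0
  = (w / d1) (d1 / d0).\<close>

definition A :: "real \<Rightarrow> real" where "A y = g (y / d1) / c1"

definition Q :: real where "Q = c1 / c0 * max 1 (k (d1 / d0))"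

definition G :: "real \<Rightarrow> real \<Rightarrow> real" where "G t w = g (w / d t) / c t"

sublocale comparison A Q
proof
  show "A x \<le> A y" if "0 \<le> x" "x \<le> y" for x y
    using that c1_pos d1_pos by (auto simp: A_def intro!: divide_right_mono g_mono)
  show "A 0 = 0" by (simp add: A_def g_zero)
  show "0 < A x" if "0 < x" for x
    using that c1_pos d1_pos g_strict[of 0 "x / d1"] by (simp add: A_def g_zero)
  have "1 * 1 \<le> c1 / c0 * max 1 (k (d1 / d0))"
    using c1_pos c_bounds(1) by (intro mult_mono) auto
  then show "1 \<le> Q" by (simp add: Q_def)
qed

lemma A_le_iff: "A y \<le> z \<longleftrightarrow> y \<le> d1 * \<phi> (c1 * z)"
proof -
  have "A y \<le> z \<longleftrightarrow> g (y / d1) \<le> c1 * z"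
    using c1_pos by (simp add: A_def pos_divide_le_eq mult.commute)
  also have "\<dots> \<longleftrightarrow> y / d1 \<le> \<phi> (c1 * z)" by (metis phi_le phi_g)
  also have "\<dots> \<longleftrightarrow> y \<le> d1 * \<phi> (c1 * z)" using d1_pos by (simp add: pos_divide_le_eq mult.commute)
  finally show ?thesis .
qed

lemma A_mult: "0 \<le> x \<Longrightarrow> 0 \<le> y \<Longrightarrow> A (x * y) \<le> A x * k y"
  using g_mult[of "x / d1" y] c1_pos d1_pos by (simp add: A_def divide_right_mono)

lemma G_odd: "G t (- w) = - G t w"
  by (simp add: G_def g_odd)

lemma comparable_G:
  assumes t: "t \<in> {0..1}"
  shows "comparable A Q (G t w) w"
proof -
  have *: "A w \<le> G t w \<and> G t w \<le> Q * A w" if w: "0 \<le> w" for w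
  proof
    note b = c_bounds(2)[OF t] d_bounds(2)[OF t] c_pos[OF t] d_pos[OF t]
    have "g (w / d1) / c1 \<le> g (w / d t) / c t"
      using w b by (intro frac_le g_mono g_nonneg divide_left_mono mult_pos_pos) auto
    then show "A w \<le> G t w" by (simp add: A_def G_def)
    have "g (w / d t) / c t \<le> g (w / d0) / c0"
      using w b c_bounds(1) d_bounds(1)
      by (intro frac_le g_mono g_nonneg divide_left_mono mult_pos_pos) auto
    also have "g (w / d0) / c0 = g ((w / d1) * (d1 / d0)) / c0" using d1_pos by simp
    also have "\<dots> \<le> (g (w / d1) * k (d1 / d0)) / c0"
      using w d1_pos d_bounds(1) c_bounds(1) by (intro divide_right_mono g_mult) auto
    also have "\<dots> \<le> (g (w / d1) * max 1 (k (d1 / d0))) / c0"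
      using w d1_pos c_bounds(1) by (intro divide_right_mono mult_left_mono g_nonneg) auto
    also have "\<dots> = Q * A w" using c1_pos by (simp add: A_def Q_def)
    finally show "G t w \<le> Q * A w" by (simp add: G_def)
  qed
  show ?thesis using *[of w] *[of "- w"] by (auto simp: comparable_def G_odd)
qed

lemma continuous_on_G: "continuous_on ({0..1} \<times> UNIV) (\<lambda>(t, w). G t w)"
  unfolding G_def case_prod_unfold
proof (intro continuous_intros)
  have f: "continuous_on ({0..1} \<times> UNIV) (fst :: real \<times> real \<Rightarrow> real)"
    "continuous_on ({0..1} \<times> UNIV) (snd :: real \<times> real \<Rightarrow> real)"
    by (auto intro: continuous_intros)
  have d: "continuous_on ({0..1} \<times> UNIV) (\<lambda>x :: real \<times> real. d (fst x))"
    by (rule continuous_on_compose2[OF d_cont f(1)]) auto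
  show "continuous_on ({0..1} \<times> UNIV) (\<lambda>x :: real \<times> real. c (fst x))"
    by (rule continuous_on_compose2[OF c_cont f(1)]) auto
  have "continuous_on ({0..1} \<times> UNIV) (\<lambda>x :: real \<times> real. snd x / d (fst x))"
    by (rule continuous_on_divide[OF f(2) d]) (use d_pos in fastforce)
  then show "continuous_on ({0..1} \<times> UNIV) (\<lambda>x :: real \<times> real. g (snd x / d (fst x)))"
    by (rule continuous_on_compose2[OF g_cont]) auto
  show "\<forall>x\<in>{0..1} \<times> (UNIV :: real set). c (fst x) \<noteq> 0" using c_pos by fastforce
qed

lemma continuous_on_G_comp:
  assumes "S \<subseteq> {0..1}" "continuous_on S w"
  shows "continuous_on S (\<lambda>t. G t (w t))"
proof -
  have "continuous_on S (\<lambda>t. (\<lambda>(t, w). G t w) (t, w t))"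
    using assms by (intro continuous_on_compose2[OF continuous_on_G] continuous_intros) auto
  then show ?thesis by simp
qed

abbreviation sol where
  "sol F a b u w \<equiv> traj h F a b u (\<lambda>t. G t (w t)) w"

lemma H_within: "0 < a \<Longrightarrow> b < 1 \<Longrightarrow> x \<in> {a..b} \<Longrightarrow> (H has_real_derivative h x) (at x within {a..b})"
  by (rule has_field_derivative_at_within[OF H(1)]) auto

lemma H_mono: "0 < s \<Longrightarrow> s \<le> t \<Longrightarrow> t < 1 \<Longrightarrow> H s \<le> H t"
  by (rule mono_within_Icc[OF H_within[of s t]]) (auto intro: h_nonneg)

section \<open>Shooting for the system of u and w\<close>

lemma u_upper:
  assumes T: "sol F a b u w" and u: "u a = 0" "0 \<le> w a" and ab: "b - a \<le> 1" and t: "t \<in> {a..b}"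
  shows "u t \<le> Q * A (w a)"
proof -
  obtain \<xi> where \<xi>: "\<xi> \<in> {a..t}" "u t - u a = G \<xi> (w \<xi>) * (t - a)"
    by (rule mvt_within_Icc[OF trajD(1)[OF T], of a t]) (use t in auto)
  have pos: "0 \<le> Q * A (w a)" using A_nonneg u Q_ge_1 by simp
  have "G \<xi> (w \<xi>) \<le> Q * A (w a)"
  proof (cases "0 \<le> w \<xi>")
    case True
    have "w \<xi> \<le> w a" using flux_antimono[OF T] \<xi> t by auto
    then have "Q * A (w \<xi>) \<le> Q * A (w a)" using True Q_ge_1 by (intro mult_left_mono A_mono) auto
    then show ?thesis using trajD(6)[OF T, of \<xi>] True \<xi> t by auto
  next
    case False
    then show ?thesis using trajD(7)[OF T, of \<xi>] A_nonneg[of "- w \<xi>"] \<xi> t pos by auto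
  qed
  then have "G \<xi> (w \<xi>) * (t - a) \<le> Q * A (w a) * (t - a)" using t by (intro mult_right_mono) auto
  also have "\<dots> \<le> Q * A (w a) * 1" using t ab pos by (intro mult_left_mono) auto
  finally show ?thesis using \<xi> u by simp
qed

text \<open>The vector field is truncated to make it bounded; the a priori bounds \<open>u \<le> B\<close> and
  \<open>-m \<le> w \<le> q\<close> show that its solutions do not see the truncation.\<close>
lemma truncated_solution:
  assumes ab: "0 < a" "a < b" "b < 1"
    and F: "continuous_on UNIV F" "\<And>x. 0 \<le> F x" "\<And>x. x \<le> 0 \<Longrightarrow> F x = F 0"
    and K: "\<And>x. x \<in> {0..B} \<Longrightarrow> F x \<le> K" and B: "B = Q * A q" and m: "m = K * (H b - H a)"
    and X: "X = (\<lambda>t x. (G t (max (- m) (min (snd x) q)), - (h t * F (max 0 (min (fst x) B)))))"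
    and \<tau>: "0 \<le> \<tau>" "\<tau> \<le> q" and x: "ivp_solution X a b (0, \<tau>) x"
  shows "sol F a b (\<lambda>t. fst (x t)) (\<lambda>t. snd (x t))" "x a = (0, \<tau>)"
proof -
  have hc: "continuous_on {a..b} h" using ab by (intro continuous_on_subset[OF h_cont]) auto
  have xc: "continuous_on {a..b} x" and xi: "\<And>t. t \<in> {a..b} \<Longrightarrow> x t = (0, \<tau>) + integral {a..t} (\<lambda>s. X s (x s))"
    using x by (auto simp: ivp_solution_def)
  show xa: "x a = (0, \<tau>)" using xi[of a] ab by simp
  have Bn: "0 \<le> B" unfolding B using A_nonneg[of q] \<tau> Q_ge_1 by simp
  have Fc: "continuous_on {a..b} (\<lambda>t. F (max 0 (min (fst (x t)) B)))"
    by (intro continuous_on_compose2[OF F(1)] continuous_intros xc) auto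
  have Xc: "continuous_on {a..b} (\<lambda>s. X s (x s))"
    unfolding X using ab
    by (intro continuous_intros hc Fc continuous_on_G_comp xc) auto
  have xd: "(x has_vector_derivative X t (x t)) (at t within {a..b})" if t: "t \<in> {a..b}" for t
  proof -
    have "((\<lambda>t. (0, \<tau>) + integral {a..t} (\<lambda>s. X s (x s))) has_vector_derivative 0 + X t (x t))
        (at t within {a..b})"
      by (intro has_vector_derivative_add has_vector_derivative_const
          integral_has_vector_derivative Xc t)
    then show ?thesis
      using has_vector_derivative_transform[OF t xi] by simp
  qed
  let ?u = "\<lambda>t. fst (x t)" and ?w = "\<lambda>t. snd (x t)" and ?F = "\<lambda>y. F (max 0 (min y B))"
  have u': "(?u has_real_derivative G t (max (- m) (min (?w t) q))) (at t within {a..b})"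
    if t: "t \<in> {a..b}" for t
    using bounded_linear.has_vector_derivative[OF bounded_linear_fst xd[OF t]]
    by (simp add: X has_real_derivative_iff_has_vector_derivative)
  have w': "(?w has_real_derivative - (h t * ?F (?u t))) (at t within {a..b})"
    if t: "t \<in> {a..b}" for t
    using bounded_linear.has_vector_derivative[OF bounded_linear_snd xd[OF t]]
    by (simp add: X has_real_derivative_iff_has_vector_derivative)
  have hn: "0 \<le> h t" if "t \<in> {a..b}" for t using that ab by (intro h_nonneg) auto
  have w1: "?w t \<le> q" if t: "t \<in> {a..b}" for t
  proof -
    have "- ?w a \<le> - ?w t"
      by (rule mono_within_Icc[where a = a and b = b and f = "\<lambda>t. - ?w t" and f' = "\<lambda>t. h t * ?F (?u t)"])
        (use DERIV_minus[OF w'] t hn F in auto)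
    then show ?thesis using xa \<tau> by simp
  qed
  have w2: "- m \<le> ?w t" if t: "t \<in> {a..b}" for t
  proof -
    have K0: "0 \<le> K" using K[of 0] F(2)[of 0] Bn by (auto intro: order_trans)
    have "?w a + K * H a \<le> ?w t + K * H t"
    proof (rule mono_within_Icc[where a = a and b = b and f = "\<lambda>t. ?w t + K * H t"
          and f' = "\<lambda>t. h t * (K - ?F (?u t))"])
      fix s assume s: "s \<in> {a..b}"
      show "((\<lambda>t. ?w t + K * H t) has_real_derivative h s * (K - ?F (?u s))) (at s within {a..b})"
        by (rule derivative_eq_intros w'[OF s] H_within[OF ab(1,3) s] refl)+ (simp add: algebra_simps)
      show "0 \<le> h s * (K - ?F (?u s))" using hn[OF s] K[of "max 0 (min (?u s) B)"] Bn by simp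
    qed (use t in auto)
    then have "\<tau> - K * (H t - H a) \<le> ?w t" using xa by (simp add: algebra_simps)
    moreover have "K * (H t - H a) \<le> K * (H b - H a)"
      using H_mono[of t b] t ab K0 by (intro mult_left_mono) auto
    ultimately show ?thesis using \<tau> m by linarith
  qed
  \<comment> \<open>The flux bounds already remove the truncation of the velocity, so
    \<open>u_upper\<close> applies with F still truncated and yields u \<le> B; only then can the
    truncation of F go. Below 0 it has no effect, F being constant there.\<close>
  have T1: "sol ?F a b ?u ?w"
    unfolding traj_def
    using u' w' w1 w2 hn F(2) ab by (auto simp: min_absorb1 max_absorb2 intro!: comparable_G)
  have uB: "?u t \<le> B" if t: "t \<in> {a..b}" for t
  proof -
    have "?u t \<le> Q * A (?w a)" using u_upper[OF T1 _ _ _ t] xa \<tau> ab by auto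
    also have "\<dots> \<le> B" unfolding B using xa \<tau> Q_ge_1 by (auto intro!: mult_left_mono A_mono)
    finally show ?thesis .
  qed
  have "?F (?u t) = F (?u t)" if t: "t \<in> {a..b}" for t
    using uB[OF t] F(3)[of "?u t"] by (cases "?u t \<le> 0") (auto simp: min_absorb1 max_absorb2 max_def)
  then show "sol F a b ?u ?w" using T1 by (simp add: traj_def)
qed

text \<open>The sign s covers both orientations: small initial flux undershoots in case (a) and
  overshoots in case (b).\<close>

lemma bvp_by_shooting:
  assumes Iab: "0 < a" "a < b" "b < 1"
    and F: "continuous_on UNIV F" "\<And>x. 0 \<le> F x" "\<And>x. x \<le> 0 \<Longrightarrow> F x = F 0"
    and pq: "0 < p" "p \<le> q"
    and neg: "\<And>u w. sol F a b u w \<Longrightarrow> u a = 0 \<Longrightarrow> w a = p \<Longrightarrow> s * u b < 0"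
    and pos: "\<And>u w. sol F a b u w \<Longrightarrow> u a = 0 \<Longrightarrow> w a = q \<Longrightarrow> 0 < s * u b"
  obtains u w where "sol F a b u w" "u a = 0" "u b = 0" "0 < w a"
proof -
  define B where "B = Q * A q"
  have Bn: "0 \<le> B" unfolding B_def using A_nonneg[of q] pq Q_ge_1 by simp
  have "continuous_on {0..B} F" by (rule continuous_on_subset[OF F(1)]) simp
  then obtain K where K: "\<And>x. x \<in> {0..B} \<Longrightarrow> F x \<le> K"
    using continuous_on_Icc_abs_bound[of 0 B F] by (metis abs_le_D1)
  define m where "m = K * (H b - H a)"
  define X where "X = (\<lambda>t x. (G t (max (- m) (min (snd x) q)), - (h t * F (max 0 (min (fst x) B)))))"
  have hc: "continuous_on {a..b} h" using Iab by (intro continuous_on_subset[OF h_cont]) auto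
  obtain hm where hm: "\<And>t. t \<in> {a..b} \<Longrightarrow> h t \<le> hm"
    using continuous_on_Icc_abs_bound[OF hc] by (metis abs_le_D1)
  define V where "V = Q * A (max m q)"
  have m0: "0 \<le> m"
    unfolding m_def using K[of 0] F(2)[of 0] Bn H_mono[of a b] Iab
    by (intro mult_nonneg_nonneg) (auto intro: order_trans)
  interpret bounded_field X a b "V + hm * K"
  proof
    show "a \<le> b" using Iab by simp
    have "continuous_on ({a..b} \<times> UNIV) (\<lambda>z :: real \<times> real \<times> real. (\<lambda>(t, w). G t w)
        (fst z, max (- m) (min (snd (snd z)) q)))"
      using Iab by (intro continuous_on_compose2[OF continuous_on_G] continuous_intros) auto
    moreover have "continuous_on ({a..b} \<times> UNIV) (\<lambda>z :: real \<times> real \<times> real. h (fst z))"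
      by (intro continuous_on_compose2[OF hc] continuous_intros) auto
    moreover have "continuous_on ({a..b} \<times> UNIV)
        (\<lambda>z :: real \<times> real \<times> real. F (max 0 (min (fst (snd z)) B)))"
      by (intro continuous_on_compose2[OF F(1)] continuous_intros) auto
    ultimately show "continuous_on ({a..b} \<times> UNIV) (\<lambda>(t, x). X t x)"
      unfolding X_def case_prod_unfold by (intro continuous_intros) simp_all
    fix t and x :: "real \<times> real" assume t: "t \<in> {a..b}"
    define w where "w = max (- m) (min (snd x) q)"
    have "\<bar>G t w\<bar> \<le> Q * A \<bar>w\<bar>"
      using comparable_G[of t w] t Iab A_nonneg[of "w"] A_nonneg[of "- w"]
      by (cases "0 \<le> w") (auto simp: comparable_def)
    also have "\<dots> \<le> V" unfolding V_def
      using m0 pq Q_ge_1 by (intro mult_left_mono A_mono) (auto simp: w_def)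
    finally have 1: "\<bar>G t w\<bar> \<le> V" .
    define y where "y = max 0 (min (fst x) B)"
    have "0 \<le> h t" using t Iab by (intro h_nonneg) auto
    then have 2: "\<bar>- (h t * F y)\<bar> \<le> hm * K"
      using hm[OF t] F(2)[of y] K[of y] Bn by (auto simp: y_def abs_mult intro!: mult_mono)
    have "norm (X t x) \<le> \<bar>G t w\<bar> + \<bar>- (h t * F y)\<bar>"
      unfolding X_def w_def y_def using norm_Pair_le by (metis real_norm_def)
    then show "norm (X t x) \<le> V + hm * K" using 1 2 by linarith
  qed
  have S: "sol F a b (\<lambda>t. fst (x t)) (\<lambda>t. snd (x t))" "x a = (0, \<tau>)"
    if "0 \<le> \<tau>" "\<tau> \<le> q" "ivp_solution X a b (0, \<tau>) x" for \<tau> x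
    using truncated_solution[of a b F B K q m X \<tau> x] Iab F K B_def m_def X_def that by blast+
  obtain \<tau> x where \<tau>: "\<tau> \<in> {p..q}" "ivp_solution X a b (0, \<tau>) x" "s * fst (x b) = 0"
  proof (rule shooting[of p q "\<lambda>\<tau>. (0, \<tau>)" "\<lambda>x. s * fst x"])
    show "s * fst (x b) < 0" if "ivp_solution X a b (0, p) x" for x
      using neg[OF S(1)[OF _ _ that]] S(2)[OF _ _ that] pq by simp
    show "0 < s * fst (x b)" if "ivp_solution X a b (0, q) x" for x
      using pos[OF S(1)[OF _ _ that]] S(2)[OF _ _ that] pq by simp
  qed (use pq in \<open>auto intro!: continuous_intros\<close>)
  have T: "sol F a b (\<lambda>t. fst (x t)) (\<lambda>t. snd (x t))" "x a = (0, \<tau>)"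
    using S[OF _ _ \<tau>(2)] \<tau>(1) pq by auto
  show ?thesis
  proof (cases "s = 0")
    \<comment> \<open>Impossible: compactness with a constant initial value provides a solution with
      initial flux p, for which \<open>neg\<close> would read 0 < 0.\<close>
    case True
    obtain x where "ivp_solution X a b (0, p) x"
      using delay_sol_compactness[OF tendsto_const strict_mono_id] by metis
    from neg[OF S(1)[OF _ _ this]] S(2)[OF _ _ this] True pq show ?thesis by simp
  next
    case False
    then show ?thesis using that[OF T(1)] T(2) \<tau> pq by simp
  qed
qed

end

section \<open>Exhaustion of the unit interval\<close>

text \<open>Phrased through increments over compact subintervals, since the integral of f up to an
  endpoint of the open interval may diverge, as it may for h.\<close>

lemma antiderivative_Ioo:
  fixes f F :: "real \<Rightarrow> real"
  assumes f: "continuous_on {\<alpha><..<\<beta>} f"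
    and F: "\<And>s t. \<alpha> < s \<Longrightarrow> s \<le> t \<Longrightarrow> t < \<beta> \<Longrightarrow> F t - F s = integral {s..t} f"
    and t: "t \<in> {\<alpha><..<\<beta>}"
  shows "(F has_real_derivative f t) (at t)"
proof -
  define p q where "p = (\<alpha> + t) / 2" and "q = (t + \<beta>) / 2"
  have pq: "\<alpha> < p" "p < t" "t < q" "q < \<beta>" using t by (auto simp: p_def q_def field_simps)
  have "continuous_on {p..q} f" by (rule continuous_on_subset[OF f]) (use pq in auto)
  then have "((\<lambda>x. F p + integral {p..x} f) has_real_derivative 0 + f t) (at t within {p..q})"
    using pq by (intro DERIV_add DERIV_const integral_has_real_derivative) auto
  then have "((\<lambda>x. F p + integral {p..x} f) has_real_derivative f t) (at t)"
    using pq by (simp add: at_within_Icc_at)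
  then show ?thesis
  proof (rule has_field_derivative_transform_within_open[of _ _ _ "{p<..<q}"])
    fix x assume "x \<in> {p<..<q}"
    then show "F p + integral {p..x} f = F x" using F[of p x] pq by auto
  qed (use pq in auto)
qed

context quasilinear_bvp
begin

lemma continuous_on_H: "continuous_on {0<..<1} H"
  using H(1) by (meson DERIV_isCont continuous_at_imp_continuous_on)

lemma E_mono:
  assumes "0 \<le> s" "s \<le> t" "t \<le> 1"
  shows "E s \<le> E t"
proof (rule DERIV_nonneg_imp_increasing_open[OF assms(2)])
  show "continuous_on {s..t} E" by (rule continuous_on_subset[OF E(1)]) (use assms in auto)
  fix x assume "s < x" "x < t"
  then show "\<exists>y. DERIV E x :> y \<and> y \<ge> 0" using E(2)[of x] k_nonneg[of "\<bar>H x\<bar>"] assms by auto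
qed

lemma sol_continuous:
  assumes "sol F a b u w"
  shows "continuous_on {a..b} u" "continuous_on {a..b} w"
  using trajD(1,2)[OF assms] by (meson DERIV_continuous continuous_on_eq_continuous_within)+

text \<open>With u confined to [0, R] the flux at 1/2 cannot be large: being monotone, it would keep
  the speed at least \<open>A \<bar>w (1/2)\<bar>\<close> over a whole quarter of the unit interval,
  to the left or to the right according to its sign. The 4 is the reciprocal of that length.\<close>

lemma flux_mid_bound:
  assumes T: "sol F a b u w" and ab: "a \<le> 1/4" "3/4 \<le> b"
    and R: "\<And>t. t \<in> {a..b} \<Longrightarrow> 0 \<le> u t \<and> u t \<le> R"
  shows "\<bar>w (1/2)\<bar> \<le> d1 * \<phi> (c1 * (4 * R))"
proof -
  have "A \<bar>w (1/2)\<bar> \<le> 4 * R"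
  proof (cases "0 \<le> w (1/2)")
    case True
    obtain \<xi> where \<xi>: "\<xi> \<in> {1/4..1/2}" "u (1/2) - u (1/4) = G \<xi> (w \<xi>) * (1/2 - 1/4)"
      by (rule mvt_within_Icc[OF trajD(1)[OF T], of "1/4" "1/2"]) (use ab in auto)
    have "w (1/2) \<le> w \<xi>" using flux_antimono[OF T, of \<xi> "1/2"] \<xi> ab by auto
    then have "A (w (1/2)) \<le> G \<xi> (w \<xi>)"
      using trajD(5)[OF T, of \<xi>] A_mono[of "w (1/2)" "w \<xi>"] True \<xi> ab by auto
    then show ?thesis using \<xi> R[of "1/2"] R[of "1/4"] True ab by auto
  next
    case False
    obtain \<xi> where \<xi>: "\<xi> \<in> {1/2..3/4}" "u (3/4) - u (1/2) = G \<xi> (w \<xi>) * (3/4 - 1/2)"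
      by (rule mvt_within_Icc[OF trajD(1)[OF T], of "1/2" "3/4"]) (use ab in auto)
    have "w \<xi> \<le> w (1/2)" using flux_antimono[OF T, of "1/2" \<xi>] \<xi> ab by auto
    then have "A (- w (1/2)) \<le> - G \<xi> (w \<xi>)"
      using trajD(7)[OF T, of \<xi>] A_mono[of "- w (1/2)" "- w \<xi>"] False \<xi> ab by auto
    then show ?thesis using \<xi> R[of "1/2"] R[of "3/4"] False ab by auto
  qed
  then show ?thesis by (simp add: A_le_iff)
qed

lemma flux_growth:
  assumes T: "sol F a b u w" and ab: "0 < a" "a \<le> 1/2" "1/2 \<le> b" "b < 1" and s: "s \<in> {a..b}"
    and K: "\<And>t. t \<in> {a..b} \<Longrightarrow> F (u t) \<le> K"
  shows "\<bar>w s\<bar> \<le> \<bar>w (1/2)\<bar> + K * \<bar>H s\<bar>"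
proof (cases "s \<le> 1/2")
  case True
  have "w s \<le> w (1/2) + K * (H (1/2) - H s)"
    by (rule flux_bound[OF T _ _ _ K H_within]) (use ab s True in auto)
  moreover have "w (1/2) \<le> w s" by (rule flux_antimono[OF T]) (use ab s True in auto)
  moreover have "H s \<le> H (1/2)" by (rule H_mono) (use ab s True in auto)
  ultimately show ?thesis using H(2) by auto
next
  case False
  have "w (1/2) \<le> w s + K * (H s - H (1/2))"
    by (rule flux_bound[OF T _ _ _ K H_within]) (use ab s False in auto)
  moreover have "w s \<le> w (1/2)" by (rule flux_antimono[OF T]) (use ab s False in auto)
  moreover have "H (1/2) \<le> H s" by (rule H_mono) (use ab s False in auto)
  ultimately show ?thesis using H(2) by auto
qed

text \<open>Condition (A) separates the constants from y. For y = \<open>\<bar>H s\<bar>\<close> the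
  right side is a multiple of the derivative of \<open>k 1 * s + E s\<close>, a function continuous
  on all of [0, 1].\<close>

lemma A_growth:
  assumes "0 \<le> W" "0 \<le> K" "0 \<le> y"
  shows "A (W + K * y) \<le> A (2 * max W K) * (k 1 + k y)"
proof -
  have "W * 1 \<le> max W K * max 1 y" "K * y \<le> max W K * max 1 y"
    using assms by (intro mult_mono; simp)+
  then have "W + K * y \<le> 2 * max W K * max 1 y" by linarith
  then have "A (W + K * y) \<le> A (2 * max W K * max 1 y)"
    using assms by (intro A_mono) auto
  also have "\<dots> \<le> A (2 * max W K) * k (max 1 y)" using assms by (intro A_mult) auto
  also have "\<dots> \<le> A (2 * max W K) * (k 1 + k y)"
    using assms k_nonneg[of 1] k_nonneg[of y]
    by (intro mult_left_mono A_nonneg) (auto simp: max_def)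
  finally show ?thesis .
qed

text \<open>Both u and - u are dominated in slope by \<open>C * (k 1 * t + E t)\<close>, which is
  continuous on [0, 1] and does not see [a, b]; with C uniform this gives equicontinuity up to the
  boundary.\<close>

lemma modulus:
  assumes T: "sol F a b u w" and ab: "0 < a" "b < 1" and C: "0 \<le> C"
    and G: "\<And>s. s \<in> {a..b} \<Longrightarrow> \<bar>G s (w s)\<bar> \<le> C * (k 1 + k \<bar>H s\<bar>)"
    and st: "a \<le> s" "s \<le> t" "t \<le> b"
  shows "\<bar>u t - u s\<bar> \<le> C * (k 1 * t + E t) - C * (k 1 * s + E s)"
proof -
  have D: "((\<lambda>x. C * (k 1 * x + E x)) has_real_derivative C * (k 1 + k \<bar>H x\<bar>)) (at x within {a..b})"
    if "x \<in> {a..b}" for x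
    by (rule derivative_eq_intros has_field_derivative_at_within[OF E(2)] refl)+ (use that ab in auto)
  have "C * (k 1 * s + E s) - u s \<le> C * (k 1 * t + E t) - u t"
  proof (rule mono_within_Icc[where a = a and b = b and f = "\<lambda>t. C * (k 1 * t + E t) - u t"
        and f' = "\<lambda>s. C * (k 1 + k \<bar>H s\<bar>) - G s (w s)"])
    fix x assume x: "x \<in> {a..b}"
    show "0 \<le> C * (k 1 + k \<bar>H x\<bar>) - G x (w x)" using G[OF x] by linarith
  qed (use st in \<open>auto intro!: DERIV_diff D trajD(1)[OF T]\<close>)
  moreover have "C * (k 1 * s + E s) + u s \<le> C * (k 1 * t + E t) + u t"
  proof (rule mono_within_Icc[where a = a and b = b and f = "\<lambda>t. C * (k 1 * t + E t) + u t"
        and f' = "\<lambda>s. C * (k 1 + k \<bar>H s\<bar>) + G s (w s)"])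
    fix x assume x: "x \<in> {a..b}"
    show "0 \<le> C * (k 1 + k \<bar>H x\<bar>) + G x (w x)" using G[OF x] by linarith
  qed (use st in \<open>auto intro!: DERIV_add D trajD(1)[OF T]\<close>)
  ultimately show ?thesis by linarith
qed

text \<open>Only the u are controlled uniformly up to 0 and 1; the fluxes may be unbounded there.
  They converge pointwise nevertheless: at 1/2 along a subsequence, elsewhere because their
  increments are integrals that converge by domination. The lower bound \<delta> keeps the limit
  from being trivial.\<close>

lemma limit_solution:
  fixes a b \<sigma> :: "nat \<Rightarrow> real" and u w Fn :: "nat \<Rightarrow> real \<Rightarrow> real"
  assumes a: "\<And>n. 0 < a n" "\<And>n. a n \<le> 1/4" "a \<longlonglongrightarrow> 0"
    and b: "\<And>n. 3/4 \<le> b n" "\<And>n. b n < 1" "b \<longlonglongrightarrow> 1"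
    and T: "\<And>n. sol (Fn n) (a n) (b n) (u n) (w n)"
    and ua: "\<And>n. u n (a n) = 0" and ub: "\<And>n. u n (b n) = 0"
    and \<sigma>: "\<And>n. \<sigma> n \<in> {a n..b n}" "\<And>n s. s \<in> {a n..b n} \<Longrightarrow> u n s \<le> u n (\<sigma> n)"
    and \<delta>: "0 < \<delta>" "\<And>n. \<delta> \<le> u n (\<sigma> n)" and R: "\<And>n. u n (\<sigma> n) \<le> R"
    and K: "\<And>n x. x \<in> {0..R} \<Longrightarrow> Fn n x \<le> K"
    and F: "continuous_on {0..R} F" and lim: "uniform_limit {0..R} Fn F sequentially"
  obtains v z where "continuous_on {0..1} v" "v 0 = 0" "v 1 = 0"
    "\<And>t. t \<in> {0<..<1} \<Longrightarrow> (v has_real_derivative G t (z t)) (at t)"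
    "\<And>t. t \<in> {0<..<1} \<Longrightarrow> (z has_real_derivative - (h t * F (v t))) (at t)"
    "\<And>t. t \<in> {0<..<1} \<Longrightarrow> 0 < v t" "\<And>t. t \<in> {0..1} \<Longrightarrow> v t \<in> {0..R}"
    "\<exists>t\<in>{0..1}. \<delta> \<le> v t"
proof -
  have len: "b n - a n \<le> 1" "a n \<le> b n" "a n \<le> 1/2" "1/2 \<le> b n" for n using a(1,2)[of n] b(1,2)[of n] by auto
  have low: "\<delta> * min (t - a n) (b n - t) / (Q + 1) \<le> u n t" if t: "t \<in> {a n..b n}" for n t
  proof -
    have "\<delta> * min (t - a n) (b n - t) / (Q + 1) \<le> u n (\<sigma> n) * min (t - a n) (b n - t) / (Q + 1)"
      using Q_ge_1 \<delta> t by (intro divide_right_mono mult_right_mono) auto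
    also have "\<dots> \<le> u n t"
      using lower_bound[OF T t \<sigma>(1)] len ua ub \<delta>(1) \<delta>(2)[of n] by auto
    finally show ?thesis .
  qed
  have uR: "0 \<le> u n t \<and> u n t \<le> R" if t: "t \<in> {a n..b n}" for n t
  proof
    have "0 \<le> \<delta> * min (t - a n) (b n - t) / (Q + 1)" using t \<delta> Q_ge_1 by simp
    then show "0 \<le> u n t" using low[OF t] by linarith
    show "u n t \<le> R" using \<sigma>(2)[OF t] R[of n] by linarith
  qed
  have R0: "0 < R" using \<delta>(1) \<delta>(2)[of 0] R[of 0] by linarith
  have FK: "0 \<le> Fn n (u n t)" "Fn n (u n t) \<le> K" if t: "t \<in> {a n..b n}" for n t
    using trajD(4)[OF T t] K uR[OF t] by auto
  have K0: "0 \<le> K" using FK[of "\<sigma> 0" 0] \<sigma>(1)[of 0] by linarith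
  define W where "W = d1 * \<phi> (c1 * (4 * R))"
  have mid: "\<bar>w n (1/2)\<bar> \<le> W" for n
    unfolding W_def by (rule flux_mid_bound[OF T]) (use a b uR in auto)
  have W0: "0 \<le> W" using mid[of 0] by linarith
  have wg: "\<bar>w n s\<bar> \<le> W + K * \<bar>H s\<bar>" if s: "s \<in> {a n..b n}" for n s
    using flux_growth[OF T a(1) len(3) len(4) b(2) s FK(2)] mid[of n] by force
  define C where "C = Q * A (2 * max W K)"
  have C0: "0 \<le> C" unfolding C_def using W0 Q_ge_1 by (intro mult_nonneg_nonneg A_nonneg) auto
  have Gg: "\<bar>G s (w n s)\<bar> \<le> C * (k 1 + k \<bar>H s\<bar>)" if s: "s \<in> {a n..b n}" for n s
  proof -
    have "\<bar>G s (w n s)\<bar> \<le> Q * A \<bar>w n s\<bar>" using velocity_abs_bound[OF T s] .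
    also have "\<dots> \<le> Q * A (W + K * \<bar>H s\<bar>)" using wg[OF s] Q_ge_1 by (intro mult_left_mono A_mono) auto
    also have "\<dots> \<le> Q * (A (2 * max W K) * (k 1 + k \<bar>H s\<bar>))"
      using W0 K0 Q_ge_1 by (intro mult_left_mono A_growth) auto
    finally show ?thesis by (simp add: C_def mult.assoc)
  qed
  define \<Gamma> where "\<Gamma> = (\<lambda>t. C * (k 1 * t + E t))"
  have \<Gamma>_mono: "\<Gamma> s \<le> \<Gamma> t" if "0 \<le> s" "s \<le> t" "t \<le> 1" for s t
    unfolding \<Gamma>_def using that C0 k_nonneg[of 1] E_mono by (intro mult_left_mono add_mono) auto
  have \<Gamma>_cont: "continuous_on {0..1} \<Gamma>" unfolding \<Gamma>_def by (intro continuous_intros E(1))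
  \<comment> \<open>Clamping t to [a n, b n] extends u n to [0, 1] by its boundary value 0 without
    spoiling the modulus.\<close>
  define p where "p n t = max (a n) (min t (b n))" for n t
  have p: "p n t \<in> {a n..b n}" for n t using len[of n] by (auto simp: p_def)
  define U where "U n t = u n (p n t)" for n t
  have U_eq: "U n t = u n t" if "t \<in> {a n..b n}" for n t
    using that by (simp add: U_def p_def min_absorb1 max_absorb2)
  have Umod: "\<bar>U n t - U n s\<bar> \<le> \<bar>\<Gamma> t - \<Gamma> s\<bar>" if st: "s \<in> {0..1}" "t \<in> {0..1}" for n s t
  proof -
    have *: "\<bar>U n t - U n s\<bar> \<le> \<Gamma> t - \<Gamma> s" if st: "0 \<le> s" "s \<le> t" "t \<le> 1" for s t
    proof -
      have m: "\<bar>U n t - U n s\<bar> \<le> \<Gamma> (p n t) - \<Gamma> (p n s)"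
        unfolding U_def \<Gamma>_def
        by (rule modulus[OF T a(1) b(2) C0 Gg]) (use p[of n] st in \<open>auto simp: p_def\<close>)
      show ?thesis
      proof (cases "t < a n \<or> b n < s")
        case True
        then have "p n t = p n s" using st len[of n] by (auto simp: p_def)
        then show ?thesis using m \<Gamma>_mono[OF st] by simp
      next
        case False
        then have "p n t \<le> t" "s \<le> p n s" by (auto simp: p_def)
        then have "\<Gamma> (p n t) \<le> \<Gamma> t" "\<Gamma> s \<le> \<Gamma> (p n s)"
          using p[of n] a(1)[of n] b(2)[of n] st by (auto intro!: \<Gamma>_mono simp: p_def)
        then show ?thesis using m by linarith
      qed
    qed
    show ?thesis
      using *[of s t] *[of t s] st by (cases "s \<le> t") (auto simp: abs_minus_commute)
  qed
  obtain v r1 where v: "continuous_on {0..1} v" and r1: "strict_mono (r1 :: nat \<Rightarrow> nat)"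
    and conv: "\<And>e. 0 < e \<Longrightarrow> \<exists>N. \<forall>n t. n \<ge> N \<and> t \<in> {0..1} \<longrightarrow> norm (U (r1 n) t - v t) < e"
  proof (rule Arzela_Ascoli[of "{0..1}" U R])
    fix t e :: real assume t: "t \<in> {0..1}" and e: "0 < e"
    obtain d where d: "d > 0" "\<And>s. s \<in> {0..1} \<Longrightarrow> dist s t < d \<Longrightarrow> dist (\<Gamma> s) (\<Gamma> t) < e"
      using \<Gamma>_cont t e unfolding continuous_on_iff by meson
    show "\<exists>d>0. \<forall>n y. y \<in> {0..1} \<and> norm (t - y) < d \<longrightarrow> norm (U n t - U n y) < e"
    proof (intro exI[of _ d] conjI allI impI d(1))
      fix n y assume y: "y \<in> {0..1} \<and> norm (t - y) < d"
      then have "\<bar>\<Gamma> t - \<Gamma> y\<bar> < e" using d(2)[of y] by (simp add: dist_norm abs_minus_commute)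
      then show "norm (U n t - U n y) < e" using Umod[of y t n] y t by auto
    qed
  next
    show "norm (U n t) \<le> R" for n t using uR[OF p[of n t]] by (simp add: U_def)
  qed (use that in auto)
  \<comment> \<open>A second extraction makes the midpoint fluxes converge; their limit is the
    constant of integration for the limiting flux.\<close>
  have "\<forall>n. w (r1 n) (1/2) \<in> {-W..W}" using mid by (auto simp: abs_le_iff minus_le_iff)
  then obtain \<omega> r2 where \<omega>: "strict_mono (r2 :: nat \<Rightarrow> nat)" "((\<lambda>n. w (r1 n) (1/2)) \<circ> r2) \<longlonglongrightarrow> \<omega>"
    using compact_Icc[of "-W" W] unfolding compact_def by meson
  define r where "r = r1 \<circ> r2"
  have r: "strict_mono r" unfolding r_def by (rule strict_mono_o[OF r1 \<omega>(1)])
  have wmid: "(\<lambda>n. w (r n) (1/2)) \<longlonglongrightarrow> \<omega>" using \<omega>(2) by (simp add: r_def o_def)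
  have Uconv: "\<exists>N. \<forall>n\<ge>N. \<forall>t\<in>{0..1}. \<bar>U (r n) t - v t\<bar> < e" if e: "0 < e" for e
  proof -
    obtain N where N: "\<And>n t. n \<ge> N \<Longrightarrow> t \<in> {0..1} \<Longrightarrow> norm (U (r1 n) t - v t) < e"
      using conv[OF e] by meson
    have "\<bar>U (r n) t - v t\<bar> < e" if "n \<ge> N" "t \<in> {0..1}" for n t
      using N[of "r2 n" t] that seq_suble[OF \<omega>(1), of n] by (simp add: r_def)
    then show ?thesis by blast
  qed
  have Uptw: "(\<lambda>n. U (r n) t) \<longlonglongrightarrow> v t" if "t \<in> {0..1}" for t
    unfolding LIMSEQ_def dist_real_def using Uconv that by meson
  have ar: "(\<lambda>n. a (r n)) \<longlonglongrightarrow> 0" and br: "(\<lambda>n. b (r n)) \<longlonglongrightarrow> 1"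
    using LIMSEQ_subseq_LIMSEQ[OF a(3) r] LIMSEQ_subseq_LIMSEQ[OF b(3) r] by (simp_all add: o_def)
  have ev: "\<forall>\<^sub>F n in sequentially. {s..t} \<subseteq> {a (r n)..b (r n)}" if "0 < s" "t < 1" for s t
    using order_tendstoD(2)[OF ar that(1)] order_tendstoD(1)[OF br that(2)]
    by eventually_elim auto
  have uptw: "(\<lambda>n. u (r n) t) \<longlonglongrightarrow> v t" if "t \<in> {0<..<1}" for t
  proof (rule Lim_transform_eventually[OF Uptw])
    show "\<forall>\<^sub>F n in sequentially. U (r n) t = u (r n) t"
      using ev[of t t] that by (auto elim!: eventually_mono intro: U_eq)
  qed (use that in auto)
  have vR: "v t \<in> {0..R}" if "t \<in> {0..1}" for t
    using LIMSEQ_le_const[OF Uptw[OF that], of 0] LIMSEQ_le_const2[OF Uptw[OF that], of R] uR p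
    by (auto simp: U_def)
  have Fptw: "(\<lambda>n. Fn (r n) (u (r n) t)) \<longlonglongrightarrow> F (v t)" if t: "t \<in> {0<..<1}" for t
  proof -
    have ul: "uniform_limit {0..R} (\<lambda>n. Fn (r n)) F sequentially"
      using filterlim_compose[OF lim filterlim_subseq[OF r]] .
    have evR: "\<forall>\<^sub>F n in sequentially. u (r n) t \<in> {0..R}"
      using ev[of t t] t by (auto elim!: eventually_mono simp: uR)
    have "(\<lambda>n. Fn (r n) (u (r n) t) - F (u (r n) t)) \<longlonglongrightarrow> 0"
    proof (rule LIMSEQ_I)
      fix e :: real assume "0 < e"
      from uniform_limitD[OF ul this] evR
      have "\<forall>\<^sub>F n in sequentially. norm (Fn (r n) (u (r n) t) - F (u (r n) t) - 0) < e"
        by eventually_elim (auto simp: dist_norm)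
      then show "\<exists>N. \<forall>n\<ge>N. norm (Fn (r n) (u (r n) t) - F (u (r n) t) - 0) < e"
        by (simp add: eventually_sequentially)
    qed
    moreover have "(\<lambda>n. F (u (r n) t)) \<longlonglongrightarrow> F (v t)"
      using vR[of t] t evR by (intro continuous_on_tendsto_compose[OF F uptw[OF t]]) auto
    ultimately have "(\<lambda>n. Fn (r n) (u (r n) t) - F (u (r n) t) + F (u (r n) t)) \<longlonglongrightarrow> 0 + F (v t)"
      by (rule tendsto_add)
    then show ?thesis by simp
  qed
  \<comment> \<open>Only late members of the sequence are known to be solutions on [s, t], whereas
    dominated convergence wants every index; dropping N terms reconciles the two.\<close>
  have shift: "\<exists>N. \<forall>n. {s..t} \<subseteq> {a (r (n + N))..b (r (n + N))}" if "0 < s" "t < 1" for s t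
    using ev[OF that] unfolding eventually_sequentially by (meson le_add2)
  have wI: "(\<lambda>n. w (r n) t - w (r n) s) \<longlonglongrightarrow> integral {s..t} (\<lambda>x. - (h x * F (v x)))"
    if st: "0 < s" "s \<le> t" "t < 1" for s t
  proof -
    obtain N where N: "\<And>n. {s..t} \<subseteq> {a (r (n + N))..b (r (n + N))}" using shift[OF st(1,3)] by blast
    let ?f = "\<lambda>n x. - (h x * Fn (r (n + N)) (u (r (n + N)) x))"
    have int: "(?f n has_integral w (r (n + N)) t - w (r (n + N)) s) {s..t}" for n
    proof (rule fundamental_theorem_of_calculus[OF st(2)])
      fix x assume x: "x \<in> {s..t}"
      have "(w (r (n + N)) has_real_derivative ?f n x) (at x within {s..t})"
        by (rule DERIV_subset[OF trajD(2)[OF T]]) (use x N[of n] in auto)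
      then show "(w (r (n + N)) has_vector_derivative ?f n x) (at x within {s..t})"
        by (simp add: has_real_derivative_iff_has_vector_derivative)
    qed
    have "(\<lambda>n. integral {s..t} (?f n)) \<longlonglongrightarrow> integral {s..t} (\<lambda>x. - (h x * F (v x)))"
    proof (rule dominated_convergence(2)[where h = "\<lambda>x. h x * K"])
      show "?f n integrable_on {s..t}" for n using int by blast
      show "(\<lambda>x. h x * K) integrable_on {s..t}"
        by (intro integrable_continuous_real continuous_intros continuous_on_subset[OF h_cont])
          (use st in auto)
      show "norm (?f n x) \<le> h x * K" if x: "x \<in> {s..t}" for n x
      proof -
        have xr: "x \<in> {a (r (n + N))..b (r (n + N))}" using x N[of n] by blast
        have "0 \<le> h x" using h_nonneg[of x] x st by auto
        then show ?thesis using FK[OF xr] by (auto simp: abs_mult intro!: mult_left_mono)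
      qed
      show "(\<lambda>n. ?f n x) \<longlonglongrightarrow> - (h x * F (v x))" if x: "x \<in> {s..t}" for x
        using x st LIMSEQ_ignore_initial_segment[OF Fptw[of x], of N]
        by (intro tendsto_intros) auto
    qed
    then have "(\<lambda>n. w (r (n + N)) t - w (r (n + N)) s) \<longlonglongrightarrow> integral {s..t} (\<lambda>x. - (h x * F (v x)))"
      using integral_unique[OF int] by simp
    then show ?thesis by (rule LIMSEQ_offset)
  qed
  have "convergent (\<lambda>n. w (r n) t)" if t: "t \<in> {0<..<1}" for t
  proof (cases "t \<le> 1/2")
    case True
    from tendsto_diff[OF wmid wI[of t "1/2"]] True t show ?thesis
      by (auto simp: convergent_def)
  next
    case False
    from tendsto_add[OF wmid wI[of "1/2" t]] False t show ?thesis
      by (auto simp: convergent_def)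
  qed
  then obtain z where z: "\<And>t. t \<in> {0<..<1} \<Longrightarrow> (\<lambda>n. w (r n) t) \<longlonglongrightarrow> z t"
    unfolding convergent_def by metis
  have v_cont: "continuous_on {0<..<1} v" by (rule continuous_on_subset[OF v]) auto
  have z': "(z has_real_derivative - (h t * F (v t))) (at t)" if t: "t \<in> {0<..<1}" for t
  proof (rule antiderivative_Ioo[OF _ _ t])
    show "continuous_on {0<..<1} (\<lambda>x. - (h x * F (v x)))"
      by (intro continuous_intros h_cont continuous_on_compose2[OF F v_cont]) (use vR in auto)
    show "z t - z s = integral {s..t} (\<lambda>x. - (h x * F (v x)))" if "0 < s" "s \<le> t" "t < 1" for s t
      by (rule LIMSEQ_unique[OF tendsto_diff[OF z z] wI]) (use that in auto)
  qed
  have z_cont: "continuous_on {0<..<1} z"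
    using z' by (meson DERIV_isCont continuous_at_imp_continuous_on)
  have uI: "(\<lambda>n. u (r n) t - u (r n) s) \<longlonglongrightarrow> integral {s..t} (\<lambda>x. G x (z x))"
    if st: "0 < s" "s \<le> t" "t < 1" for s t
  proof -
    obtain N where N: "\<And>n. {s..t} \<subseteq> {a (r (n + N))..b (r (n + N))}" using shift[OF st(1,3)] by blast
    let ?f = "\<lambda>n x. G x (w (r (n + N)) x)"
    have int: "(?f n has_integral u (r (n + N)) t - u (r (n + N)) s) {s..t}" for n
    proof (rule fundamental_theorem_of_calculus[OF st(2)])
      fix x assume x: "x \<in> {s..t}"
      have "(u (r (n + N)) has_real_derivative ?f n x) (at x within {s..t})"
        by (rule DERIV_subset[OF trajD(1)[OF T]]) (use x N[of n] in auto)
      then show "(u (r (n + N)) has_vector_derivative ?f n x) (at x within {s..t})"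
        by (simp add: has_real_derivative_iff_has_vector_derivative)
    qed
    have "(\<lambda>n. integral {s..t} (?f n)) \<longlonglongrightarrow> integral {s..t} (\<lambda>x. G x (z x))"
    proof (rule dominated_convergence(2)[where h = "\<lambda>x. C * (k 1 + k \<bar>H x\<bar>)"])
      show "?f n integrable_on {s..t}" for n using int by blast
      have "continuous_on {s..t} (\<lambda>x. \<bar>H x\<bar>)"
        by (intro continuous_intros continuous_on_subset[OF continuous_on_H]) (use st in auto)
      then have "continuous_on {s..t} (\<lambda>x. k \<bar>H x\<bar>)"
        by (rule continuous_on_compose2[OF k_cont]) auto
      then show "(\<lambda>x. C * (k 1 + k \<bar>H x\<bar>)) integrable_on {s..t}"
        by (intro integrable_continuous_real continuous_intros)
      show "norm (?f n x) \<le> C * (k 1 + k \<bar>H x\<bar>)" if x: "x \<in> {s..t}" for n x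
        unfolding real_norm_def by (rule Gg) (use x N[of n] in blast)
      show "(\<lambda>n. ?f n x) \<longlonglongrightarrow> G x (z x)" if x: "x \<in> {s..t}" for x
      proof -
        have x01: "x \<in> {0<..<1}" using x st by auto
        then have "d x \<noteq> 0" "c x \<noteq> 0" using d_pos[of x] c_pos[of x] by auto
        moreover have "(\<lambda>n. w (r (n + N)) x) \<longlonglongrightarrow> z x"
          by (rule LIMSEQ_ignore_initial_segment[OF z[OF x01]])
        ultimately show ?thesis unfolding G_def
          by (intro tendsto_divide tendsto_const continuous_on_tendsto_compose[OF g_cont]) auto
      qed
    qed
    then have "(\<lambda>n. u (r (n + N)) t - u (r (n + N)) s) \<longlonglongrightarrow> integral {s..t} (\<lambda>x. G x (z x))"
      using integral_unique[OF int] by simp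
    then show ?thesis by (rule LIMSEQ_offset)
  qed
  have v': "(v has_real_derivative G t (z t)) (at t)" if t: "t \<in> {0<..<1}" for t
  proof (rule antiderivative_Ioo[OF _ _ t])
    show "continuous_on {0<..<1} (\<lambda>x. G x (z x))"
      by (rule continuous_on_G_comp[OF _ z_cont]) auto
    show "v t - v s = integral {s..t} (\<lambda>x. G x (z x))" if "0 < s" "s \<le> t" "t < 1" for s t
      by (rule LIMSEQ_unique[OF tendsto_diff[OF uptw uptw] uI]) (use that in auto)
  qed
  have vpos: "0 < v t" if t: "t \<in> {0<..<1}" for t
  proof -
    \<comment> \<open>The bound \<open>low\<close> survives the limit, with the shrinking margins
      replaced by the distances to 0 and 1.\<close>
    have "\<delta> * min (t - 0) (1 - t) / (Q + 1) \<le> v t"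
    proof (rule tendsto_le[OF _ uptw[OF t]])
      show "(\<lambda>n. \<delta> * min (t - a (r n)) (b (r n) - t) / (Q + 1)) \<longlonglongrightarrow> \<delta> * min (t - 0) (1 - t) / (Q + 1)"
        using Q_ge_1 by (intro tendsto_intros ar br) auto
      show "\<forall>\<^sub>F n in sequentially. \<delta> * min (t - a (r n)) (b (r n) - t) / (Q + 1) \<le> u (r n) t"
        using ev[of t t] t by (auto elim!: eventually_mono intro: low)
    qed simp
    moreover have "0 < \<delta> * min (t - 0) (1 - t) / (Q + 1)" using \<delta> t Q_ge_1 by simp
    ultimately show ?thesis by linarith
  qed
  obtain t1 where t1: "t1 \<in> {0..1}" "\<And>t. t \<in> {0..1} \<Longrightarrow> v t \<le> v t1"
    using continuous_attains_sup[OF compact_Icc _ v] by auto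
  \<comment> \<open>The points \<open>\<sigma> n\<close> need not converge; uniform closeness at a
    single late index suffices.\<close>
  have "\<delta> \<le> v t1"
  proof (rule field_le_epsilon)
    fix e :: real assume "0 < e"
    then obtain N where N: "\<And>t. t \<in> {0..1} \<Longrightarrow> \<bar>U (r N) t - v t\<bar> < e" using Uconv by blast
    have s: "\<sigma> (r N) \<in> {a (r N)..b (r N)}" by (rule \<sigma>)
    then have "\<sigma> (r N) \<in> {0..1}" using a(1)[of "r N"] b(2)[of "r N"] by auto
    then show "\<delta> \<le> v t1 + e"
      using N[of "\<sigma> (r N)"] t1(2)[of "\<sigma> (r N)"] U_eq[OF s] \<delta>(2)[of "r N"] by linarith
  qed
  moreover have "v 0 = 0"
  proof -
    have "p n 0 = a n" for n using a(1)[of n] len[of n] by (simp add: p_def)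
    then show ?thesis using Uptw[of 0] by (simp add: U_def ua LIMSEQ_const_iff)
  qed
  moreover have "v 1 = 0"
  proof -
    have "p n 1 = b n" for n using b(2)[of n] len[of n] by (simp add: p_def)
    then show ?thesis using Uptw[of 1] by (simp add: U_def ub LIMSEQ_const_iff)
  qed
  ultimately show ?thesis using that[of v z] v v' z' vpos vR t1(1) by blast
qed

end

section \<open>Small solutions\<close>

context quasilinear_bvp
begin

section \<open>Estimates and approximation scheme shared by both cases\<close>

lemma A_inverse: "A (d1 * \<phi> (c1 * e)) = e"
  using c1_pos d1_pos by (simp add: A_def g_phi)

lemma A_inverse_pos: "0 < e \<Longrightarrow> 0 < d1 * \<phi> (c1 * e)"
  using c1_pos d1_pos phi_pos by simp

lemma end_value_ge:
  assumes T: "sol F a b u w" and ab: "a \<le> b" and u: "u a = 0" and w: "0 \<le> w b"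
  shows "A (w b) * (b - a) \<le> u b"
proof -
  obtain \<xi> where \<xi>: "\<xi> \<in> {a..b}" "u b - u a = G \<xi> (w \<xi>) * (b - a)"
    by (rule mvt_within_Icc[OF trajD(1)[OF T], of a b]) (use ab in auto)
  have "w b \<le> w \<xi>" using flux_antimono[OF T] \<xi> by auto
  then have "A (w b) \<le> G \<xi> (w \<xi>)"
    using trajD(5)[OF T, of \<xi>] A_mono[of "w b" "w \<xi>"] w \<xi> by auto
  then have "A (w b) * (b - a) \<le> G \<xi> (w \<xi>) * (b - a)" using ab by (intro mult_right_mono) auto
  then show ?thesis using \<xi> u by simp
qed

lemma end_flux_ge:
  assumes T: "sol F a b u w" and ab: "0 < a" "a \<le> b" "b < 1"
    and K: "\<And>t. t \<in> {a..b} \<Longrightarrow> F (u t) \<le> K"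
  shows "w a - K * (H b - H a) \<le> w b"
proof -
  have "w a \<le> w b + K * (H b - H a)"
    by (rule flux_bound[OF T _ _ _ K H_within]) (use ab in auto)
  then show ?thesis by simp
qed

lemma exists_max:
  assumes T: "sol F a b u w" and ab: "a < b" and u: "u a = 0" and w: "0 < w a"
  obtains \<sigma> where "\<sigma> \<in> {a..b}" "\<And>s. s \<in> {a..b} \<Longrightarrow> u s \<le> u \<sigma>" "0 < u \<sigma>"
proof -
  obtain \<sigma> where \<sigma>: "\<sigma> \<in> {a..b}" "\<And>s. s \<in> {a..b} \<Longrightarrow> u s \<le> u \<sigma>"
    using continuous_attains_sup[of "{a..b}" u] sol_continuous[OF T] ab by auto
  have "0 < G a (w a)" using trajD(5)[OF T, of a] A_pos[OF w] ab w by auto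
  then obtain e where e: "0 < e" "\<And>y. 0 < y \<Longrightarrow> a + y \<in> {a..b} \<Longrightarrow> y < e \<Longrightarrow> u a < u (a + y)"
    using has_real_derivative_pos_inc_right[OF trajD(1)[OF T, of a]] ab by auto
  define y where "y = min (e / 2) (b - a)"
  have y: "0 < y" "a + y \<in> {a..b}" "y < e" using e ab by (auto simp: y_def)
  have "u a < u (a + y)" by (rule e(2)[OF y])
  also have "\<dots> \<le> u \<sigma>" by (rule \<sigma>(2)[OF y(2)])
  finally show ?thesis using \<sigma> u that by simp
qed

text \<open>By \<open>lower_bound\<close>, a solution is at least \<theta> times its maximum on
  [x1, x2], for every [a, b] in (0, 1) containing [a0, b0] and nonnegative end values.\<close>

definition \<theta> :: real where "\<theta> = min (x1 - a0) (b0 - x2) / (Q + 1)"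

text \<open>Found by solving the inequality of \<open>max_lower_estimate\<close> for F \<xi> and
  replacing the maximum by \<xi> / \<theta>; the factor \<psi> pays for taking the constant out of
  \<phi>.\<close>

definition \<kappa> :: real where
  "\<kappa> = d1 * \<psi> (c1 / ((x2 - x1) / 6 * \<theta>)) / (\<eta> * ((x2 - x1) / 6))"

lemma theta_pos: "0 < \<theta>"
  using h_pos Q_ge_1 by (simp add: \<theta>_def)

text \<open>Rules out every maximum M > 0 for which F exceeds \<kappa> \<phi> on [\<theta> M, M].
  The constants depend neither on [a, b] nor on F, hence not on the parameter \<lambda> that F
  contains.\<close>

lemma nonlinearity_upper:
  assumes T: "sol F a b u w" and F: "continuous_on UNIV F"
    and ab: "0 < a" "a \<le> a0" "b0 \<le> b" "b < 1" and u: "u a = 0" "0 \<le> u b"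
    and \<sigma>: "\<sigma> \<in> {a..b}" "\<And>s. s \<in> {a..b} \<Longrightarrow> u s \<le> u \<sigma>"
  obtains \<xi> where "u \<sigma> * \<theta> \<le> \<xi>" "\<xi> \<le> u \<sigma>" "F \<xi> \<le> \<kappa> * \<phi> \<xi>"
proof -
  define l where "l = (x2 - x1) / 6"
  have l: "0 < l" using h_pos by (simp add: l_def)
  obtain \<xi> where \<xi>: "u \<sigma> * \<theta> \<le> \<xi>" "\<xi> \<le> u \<sigma>" "l * A (\<eta> * F \<xi> * l) \<le> u \<sigma>"
    unfolding \<theta>_def l_def
    by (rule max_lower_estimate[OF T _ u \<sigma> F, of a0 x1 x2 b0 \<eta>]) (use ab h_pos in auto)
  have "0 \<le> u \<sigma>" using \<sigma>(2)[of a] \<sigma>(1) u by simp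
  then have \<xi>0: "0 \<le> \<xi>" using \<xi>(1) theta_pos by (meson mult_nonneg_nonneg less_imp_le order_trans)
  have "A (\<eta> * F \<xi> * l) \<le> u \<sigma> / l" using \<xi>(3) l by (simp add: pos_le_divide_eq mult.commute)
  then have "\<eta> * F \<xi> * l \<le> d1 * \<phi> (c1 * (u \<sigma> / l))" by (simp add: A_le_iff)
  also have "\<dots> \<le> d1 * \<phi> (\<xi> * (c1 / (l * \<theta>)))"
  proof -
    have "u \<sigma> \<le> \<xi> / \<theta>" using \<xi>(1) theta_pos by (simp add: pos_le_divide_eq)
    then have "c1 / l * u \<sigma> \<le> c1 / l * (\<xi> / \<theta>)" using c1_pos l by (intro mult_left_mono) auto
    then have "c1 * (u \<sigma> / l) \<le> \<xi> * (c1 / (l * \<theta>))" by (simp add: mult_ac)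
    then show ?thesis using d1_pos by (intro mult_left_mono) (auto simp: phi_le)
  qed
  also have "\<dots> \<le> d1 * (\<phi> \<xi> * \<psi> (c1 / (l * \<theta>)))"
    using d1_pos c1_pos l theta_pos \<xi>0 by (intro mult_left_mono phi_mult) auto
  finally have "F \<xi> * (\<eta> * l) \<le> d1 * \<psi> (c1 / (l * \<theta>)) * \<phi> \<xi>" by (simp add: mult_ac)
  then have "F \<xi> \<le> \<kappa> * \<phi> \<xi>"
    unfolding \<kappa>_def l_def[symmetric] using l h_pos by (simp add: pos_le_divide_eq)
  with \<xi> that show ?thesis by blast
qed

text \<open>\<open>A_mult\<close> splits \<open>A (K * \<bar>H x\<bar>)\<close> into a constant and
  the derivative of E, so the bound stays finite as [a, b] exhausts (0, 1).\<close>

lemma max_upper: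
  assumes T: "sol F a b u w" and ab: "0 < a" "a \<le> 1/2" "1/2 \<le> b" "b < 1"
    and u: "u a = 0" "u b = 0"
    and \<sigma>: "\<sigma> \<in> {a..b}" "\<And>s. s \<in> {a..b} \<Longrightarrow> u s \<le> u \<sigma>"
    and K: "0 \<le> K" "\<And>t. t \<in> {a..b} \<Longrightarrow> F (u t) \<le> K"
  shows "u \<sigma> \<le> Q * (A K * (E 1 - E 0))"
proof -
  have "u \<sigma> \<le> Q * (A K * E b - A K * E a)"
  proof (rule max_upper_estimate[OF T ab(2,3) u \<sigma> K, where H = H and D = "\<lambda>x. A K * k \<bar>H x\<bar>"])
    fix x assume x: "x \<in> {a..b}"
    show "(H has_real_derivative h x) (at x within {a..b})" by (rule H_within[OF ab(1,4) x])
    show "((\<lambda>x. A K * E x) has_real_derivative A K * k \<bar>H x\<bar>) (at x within {a..b})"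
      by (rule DERIV_cmult, rule has_field_derivative_at_within[OF E(2)]) (use x ab in auto)
    show "A (K * \<bar>H x\<bar>) \<le> A K * k \<bar>H x\<bar>" using K by (intro A_mult) auto
  qed (use H in auto)
  also have "\<dots> = Q * (A K * (E b - E a))" by (simp add: algebra_simps)
  also have "\<dots> \<le> Q * (A K * (E 1 - E 0))"
  proof (intro mult_left_mono)
    show "E b - E a \<le> E 1 - E 0" using E_mono[of b 1] E_mono[of 0 a] ab by auto
  qed (use A_nonneg K Q_ge_1 in auto)
  finally show ?thesis .
qed

lemma is_pos_solutionI:
  assumes f: "continuous_on {0..} f"
    and v: "continuous_on {0..1} v" "v 0 = 0" "v 1 = 0"
    and v': "\<And>t. t \<in> {0<..<1} \<Longrightarrow> (v has_real_derivative G t (z t)) (at t)"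
    and z': "\<And>t. t \<in> {0<..<1} \<Longrightarrow> (z has_real_derivative - (h t * (lam * f (v t)))) (at t)"
    and pos: "\<And>t. t \<in> {0<..<1} \<Longrightarrow> 0 < v t"
  shows "is_pos_solution \<phi> c d h f lam v"
  unfolding is_pos_solution_def is_solution_def
proof (intro conjI ballI exI pos v)
  have z_cont: "continuous_on {0<..<1} z"
    using z' by (meson DERIV_isCont continuous_at_imp_continuous_on)
  show "continuous_on {0<..<1} (\<lambda>t. G t (z t))"
    by (rule continuous_on_G_comp[OF _ z_cont]) auto
  have "continuous_on {0<..<1} v" by (rule continuous_on_subset[OF v(1)]) auto
  then have "continuous_on {0<..<1} (\<lambda>t. f (v t))"
    by (rule continuous_on_compose2[OF f]) (use pos in \<open>auto simp: less_imp_le\<close>)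
  then show "continuous_on {0<..<1} (\<lambda>t. - (h t * (lam * f (v t))))"
    by (intro continuous_intros h_cont)
  fix t :: real assume t: "t \<in> {0<..<1}"
  show "(v has_real_derivative G t (z t)) (at t)" by (rule v'[OF t])
  have eq: "z s = d s * \<phi> (c s * G s (z s))" if "s \<in> {0<..<1}" for s
    using c_pos[of s] d_pos[of s] that by (simp add: G_def phi_g)
  show "((\<lambda>s. d s * \<phi> (c s * G s (z s))) has_real_derivative - (h t * (lam * f (v t)))) (at t)"
    by (rule has_field_derivative_transform_within_open[OF z'[OF t] _ t]) (use eq in auto)
  show "- (h t * (lam * f (v t))) + lam * h t * f (v t) = 0" by simp
qed

text \<open>At most 1/4 for the sake of \<open>flux_mid_bound\<close> and at most a0 for the sake of
  \<open>nonlinearity_upper\<close>; \<open>hi\<close> is chosen likewise.\<close>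

definition lo :: "nat \<Rightarrow> real" where "lo n = min (1/4) a0 / real (Suc n)"

definition hi :: "nat \<Rightarrow> real" where "hi n = 1 - min (1/4) (1 - b0) / real (Suc n)"

lemma lo: "0 < lo n" "lo n \<le> 1/4" "lo n \<le> a0" "lo \<longlonglongrightarrow> 0"
proof -
  have "lo n \<le> min (1/4) a0 / 1" unfolding lo_def using h_pos by (intro divide_left_mono) auto
  then show "lo n \<le> 1/4" "lo n \<le> a0" by auto
  show "0 < lo n" using h_pos by (simp add: lo_def)
  have "(\<lambda>n. min (1/4) a0 * inverse (real (Suc n))) \<longlonglongrightarrow> min (1/4) a0 * 0"
    by (intro tendsto_intros LIMSEQ_inverse_real_of_nat)
  moreover have "lo = (\<lambda>n. min (1/4) a0 * inverse (real (Suc n)))"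
    by (rule ext) (simp only: lo_def divide_inverse)
  ultimately show "lo \<longlonglongrightarrow> 0" by simp
qed

lemma hi: "3/4 \<le> hi n" "hi n < 1" "b0 \<le> hi n" "hi \<longlonglongrightarrow> 1"
proof -
  have "min (1/4) (1 - b0) / real (Suc n) \<le> min (1/4) (1 - b0) / 1"
    using h_pos by (intro divide_left_mono) auto
  then show "3/4 \<le> hi n" "b0 \<le> hi n" by (auto simp: hi_def)
  show "hi n < 1" using h_pos by (simp add: hi_def)
  have "(\<lambda>n. 1 - min (1/4) (1 - b0) * inverse (real (Suc n))) \<longlonglongrightarrow> 1 - min (1/4) (1 - b0) * 0"
    by (intro tendsto_intros LIMSEQ_inverse_real_of_nat)
  moreover have "hi = (\<lambda>n. 1 - min (1/4) (1 - b0) * inverse (real (Suc n)))"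
    by (rule ext) (simp only: hi_def divide_inverse)
  ultimately show "hi \<longlonglongrightarrow> 1" by simp
qed

lemma pos_solution_by_approximation:
  assumes f: "continuous_on {0..} f" and \<delta>: "0 < \<delta>"
    and approx: "\<And>n. \<exists>u w \<sigma>. sol (Fn n) (lo n) (hi n) u w \<and> u (lo n) = 0 \<and> u (hi n) = 0 \<and>
        \<sigma> \<in> {lo n..hi n} \<and> (\<forall>s\<in>{lo n..hi n}. u s \<le> u \<sigma>) \<and> \<delta> \<le> u \<sigma> \<and> u \<sigma> \<le> R"
    and K: "\<And>n x. x \<in> {0..R} \<Longrightarrow> Fn n x \<le> K"
    and lim: "uniform_limit {0..R} Fn (\<lambda>x. lam * f x) sequentially"
  obtains v where "is_pos_solution \<phi> c d h f lam v" "\<delta> \<le> sup_norm v" "sup_norm v \<le> R"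
proof -
  define P where "P n u w \<sigma> \<longleftrightarrow> sol (Fn n) (lo n) (hi n) u w \<and> u (lo n) = 0 \<and> u (hi n) = 0 \<and>
        \<sigma> \<in> {lo n..hi n} \<and> (\<forall>s\<in>{lo n..hi n}. u s \<le> u \<sigma>) \<and> \<delta> \<le> u \<sigma> \<and> u \<sigma> \<le> R" for n u w \<sigma>
  have "\<forall>n. \<exists>u w \<sigma>. P n u w \<sigma>" unfolding P_def using approx by blast
  then obtain u w \<sigma> where P: "\<And>n. P n (u n) (w n) (\<sigma> n)" by metis
  then have T: "\<And>n. sol (Fn n) (lo n) (hi n) (u n) (w n)"
    and u: "\<And>n. u n (lo n) = 0" "\<And>n. u n (hi n) = 0"
    and \<sigma>: "\<And>n. \<sigma> n \<in> {lo n..hi n}" "\<And>n s. s \<in> {lo n..hi n} \<Longrightarrow> u n s \<le> u n (\<sigma> n)"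
      "\<And>n. \<delta> \<le> u n (\<sigma> n)" "\<And>n. u n (\<sigma> n) \<le> R"
    unfolding P_def by blast+
  have F: "continuous_on {0..R} (\<lambda>x. lam * f x)"
    by (intro continuous_intros continuous_on_subset[OF f]) auto
  obtain v z where v: "continuous_on {0..1} v" "v 0 = 0" "v 1 = 0"
    "\<And>t. t \<in> {0<..<1} \<Longrightarrow> (v has_real_derivative G t (z t)) (at t)"
    "\<And>t. t \<in> {0<..<1} \<Longrightarrow> (z has_real_derivative - (h t * (lam * f (v t)))) (at t)"
    "\<And>t. t \<in> {0<..<1} \<Longrightarrow> 0 < v t" and vR: "\<And>t. t \<in> {0..1} \<Longrightarrow> v t \<in> {0..R}"
    and ex: "\<exists>t\<in>{0..1}. \<delta> \<le> v t"
    using limit_solution[OF lo(1,2,4) hi(1,2,4) T u \<sigma>(1,2) \<delta> \<sigma>(3,4) K F lim] by metis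
  have b: "\<bar>v t\<bar> \<le> R" if "t \<in> {0..1}" for t using vR[OF that] by auto
  obtain t1 where t1: "t1 \<in> {0..1}" "\<delta> \<le> v t1" using ex by blast
  have "sup_norm v \<le> R" unfolding sup_norm_def using b by (intro cSUP_least) auto
  moreover have "\<delta> \<le> sup_norm v"
    unfolding sup_norm_def using t1 b by (intro cSUP_upper2[OF _ t1(1)] bdd_aboveI2[of _ _ R]) auto
  ultimately show ?thesis using that is_pos_solutionI[OF f v] by blast
qed

text \<open>With f frozen beyond r the nonlinearity is at most \<lambda> m, so large initial flux
  overshoots and, for small \<lambda>, solutions stay below r, where nothing was changed. Small
  initial flux undershoots, because a solution with nonnegative end value must reach the height
  \<delta>.\<close>

lemma small_solutions:
  assumes f: "continuous_on {0..} f" "\<forall>s\<ge>0. 0 \<le> f s"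
    and f0: "filterlim (\<lambda>s. f s / \<phi> s) at_top (at_right 0)" and r: "0 < r"
  obtains l where "0 < l" "\<And>lam. 0 < lam \<Longrightarrow> lam < l \<Longrightarrow>
    \<exists>v. is_pos_solution \<phi> c d h f lam v \<and> 0 < sup_norm v \<and> sup_norm v \<le> r"
proof -
  obtain m where m: "0 \<le> m" "\<And>x. x \<in> {0..r} \<Longrightarrow> f x \<le> m"
    using continuous_on_Icc_abs_bound[of 0 r f] continuous_on_subset[OF f(1)]
    by (metis abs_le_D1 atLeastAtMost_iff atLeast_iff subsetI)
  define D where "D = Q * (E 1 - E 0)"
  have D: "0 \<le> D" unfolding D_def using E_mono[of 0 1] Q_ge_1 by simp
  \<comment> \<open>Chosen so that \<open>D * A K \<le> D * e \<le> r\<close>, the threshold l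
    making \<open>A K \<le> e\<close> for K = \<lambda> m. The denominator m + 1 in l avoids
    division by 0.\<close>
  define e where "e = r / (D + 1)"
  have e: "0 < e" "D * e \<le> r" using r D by (auto simp: e_def field_simps)
  define l where "l = d1 * \<phi> (c1 * e) / (m + 1)"
  show ?thesis
  proof (rule that[of l])
    show "0 < l" unfolding l_def using A_inverse_pos[OF e(1)] m by simp
    fix lam assume lam: "0 < lam" "lam < l"
    define F where "F x = lam * f (max 0 (min x r))" for x
    define K where "K = lam * m"
    have K0: "0 \<le> K" using lam m by (simp add: K_def)
    have FK: "F x \<le> K" "0 \<le> F x" for x
      using m(2)[of "max 0 (min x r)"] f(2)[rule_format, of "max 0 (min x r)"] lam r
      by (auto simp: F_def K_def intro!: mult_left_mono)
    have F_cont: "continuous_on UNIV F" unfolding F_def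
      by (intro continuous_intros continuous_on_compose2[OF f(1)]) auto
    have F_neg: "F x = F 0" if "x \<le> 0" for x using that r by (simp add: F_def)
    have "K \<le> l * (m + 1)" using lam m by (auto simp: K_def intro!: mult_mono)
    also have "\<dots> = d1 * \<phi> (c1 * e)" using m by (simp add: l_def)
    finally have AK: "A K \<le> e" by (simp add: A_le_iff)
    have "\<forall>\<^sub>F s in at_right 0. \<kappa> / lam < f s / \<phi> s"
      using f0 by (simp add: filterlim_at_top_dense)
    then obtain \<delta>' where \<delta>': "0 < \<delta>'" "\<And>s. 0 < s \<Longrightarrow> s < \<delta>' \<Longrightarrow> \<kappa> / lam < f s / \<phi> s"
      by (auto simp: eventually_at_right_field)
    \<comment> \<open>It depends on \<lambda> but not on n, as the passage to the limit
      requires.\<close>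
    define \<delta> where "\<delta> = min \<delta>' r"
    have \<delta>: "0 < \<delta>" using \<delta>' r by (simp add: \<delta>_def)
    have large: "\<kappa> * \<phi> s < F s" if "0 < s" "s < \<delta>" for s
    proof -
      have "\<kappa> / lam < f s / \<phi> s" using \<delta>'(2) that by (simp add: \<delta>_def)
      then have "\<kappa> * \<phi> s < lam * f s" using lam phi_pos[OF that(1)] by (simp add: field_simps)
      then show ?thesis using that by (simp add: F_def \<delta>_def)
    qed
    have ge: "\<delta> \<le> u \<sigma>" if T: "sol F (lo n) (hi n) u w" and u: "u (lo n) = 0" "0 \<le> u (hi n)"
      and \<sigma>: "\<sigma> \<in> {lo n..hi n}" "\<And>s. s \<in> {lo n..hi n} \<Longrightarrow> u s \<le> u \<sigma>" "0 < u \<sigma>" for n u w \<sigma>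
    proof (rule ccontr)
      assume "\<not> \<delta> \<le> u \<sigma>"
      moreover obtain \<xi> where \<xi>: "u \<sigma> * \<theta> \<le> \<xi>" "\<xi> \<le> u \<sigma>" "F \<xi> \<le> \<kappa> * \<phi> \<xi>"
        by (rule nonlinearity_upper[OF T F_cont lo(1,3) hi(3,2) u \<sigma>(1,2)])
      moreover have "0 < u \<sigma> * \<theta>" using \<sigma> theta_pos by simp
      ultimately show False using large[of \<xi>] by linarith
    qed
    show "\<exists>v. is_pos_solution \<phi> c d h f lam v \<and> 0 < sup_norm v \<and> sup_norm v \<le> r"
    proof (rule pos_solution_by_approximation[OF f(1) \<delta>, of "\<lambda>n. F" r K lam])
      fix n
      \<comment> \<open>From flux p the solution cannot exceed \<open>Q * A p\<close>, which is
        \<delta> / 2 and hence too small for a nonnegative end value.\<close>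
      define p where "p = d1 * \<phi> (c1 * (\<delta> / (2 * Q)))"
      have p: "0 < p" unfolding p_def using \<delta> Q_ge_1 by (intro A_inverse_pos) simp
      have Ap: "Q * A p < \<delta>" unfolding p_def A_inverse using \<delta> Q_ge_1 by simp
      \<comment> \<open>The flux loses at most \<open>K * (H (hi n) - H (lo n))\<close> over the
        interval, so started at q it is still positive at the end.\<close>
      define q where "q = p + K * (H (hi n) - H (lo n)) + 1"
      have "0 \<le> H (hi n) - H (lo n)" using H_mono[of "lo n" "hi n"] lo(1,2)[of n] hi(1,2)[of n] by auto
      then have pq: "p \<le> q" using K0 by (simp add: q_def)
      have lh: "lo n < hi n" "hi n - lo n \<le> 1" "lo n \<le> 1/2" "1/2 \<le> hi n"
        using lo(1,2)[of n] hi(1,2)[of n] by auto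
      obtain u w where T: "sol F (lo n) (hi n) u w" "u (lo n) = 0" "u (hi n) = 0" "0 < w (lo n)"
      proof (rule bvp_by_shooting[OF lo(1) lh(1) hi(2) F_cont FK(2) F_neg p pq, where s = 1])
        fix u w assume T: "sol F (lo n) (hi n) u w" and u: "u (lo n) = 0"
        {
          assume w: "w (lo n) = p"
          show "1 * u (hi n) < 0"
          proof (rule ccontr)
            assume "\<not> 1 * u (hi n) < 0"
            then have uh: "0 \<le> u (hi n)" by simp
            obtain \<sigma> where \<sigma>: "\<sigma> \<in> {lo n..hi n}" "\<And>s. s \<in> {lo n..hi n} \<Longrightarrow> u s \<le> u \<sigma>" "0 < u \<sigma>"
              using exists_max[OF T lh(1) u] w p by metis
            have "\<delta> \<le> u \<sigma>" by (rule ge[OF T u uh \<sigma>])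
            moreover have "u \<sigma> \<le> Q * A p" using u_upper[OF T u _ lh(2) \<sigma>(1)] w p by simp
            ultimately show False using Ap by linarith
          qed
        next
          assume w: "w (lo n) = q"
          have "w (lo n) - K * (H (hi n) - H (lo n)) \<le> w (hi n)"
            by (rule end_flux_ge[OF T lo(1) _ hi(2) FK(1)]) (use lh in auto)
          then have w1: "0 < w (hi n)" using w p by (simp add: q_def)
          have "A (w (hi n)) * (hi n - lo n) \<le> u (hi n)"
            by (rule end_value_ge[OF T _ u]) (use lh w1 in auto)
          moreover have "0 < A (w (hi n)) * (hi n - lo n)" using A_pos[OF w1] lh by simp
          ultimately show "0 < 1 * u (hi n)" by simp
        }
      qed blast
      obtain \<sigma> where \<sigma>: "\<sigma> \<in> {lo n..hi n}" "\<And>s. s \<in> {lo n..hi n} \<Longrightarrow> u s \<le> u \<sigma>" "0 < u \<sigma>"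
        using exists_max[OF T(1) lh(1) T(2,4)] by metis
      have "u \<sigma> \<le> Q * (A K * (E 1 - E 0))"
        by (rule max_upper[OF T(1) lo(1) lh(3,4) hi(2) T(2,3) \<sigma>(1,2) K0 FK(1)])
      also have "\<dots> = D * A K" by (simp add: D_def)
      also have "\<dots> \<le> D * e" using AK D by (rule mult_left_mono)
      finally have "u \<sigma> \<le> r" using e by linarith
      moreover have "\<delta> \<le> u \<sigma>" using ge[OF T(1,2) _ \<sigma>] T(3) by simp
      ultimately show "\<exists>u w \<sigma>. sol F (lo n) (hi n) u w \<and> u (lo n) = 0 \<and> u (hi n) = 0 \<and>
        \<sigma> \<in> {lo n..hi n} \<and> (\<forall>s\<in>{lo n..hi n}. u s \<le> u \<sigma>) \<and> \<delta> \<le> u \<sigma> \<and> u \<sigma> \<le> r"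
        using T \<sigma> by blast
    next
      show "uniform_limit {0..r} (\<lambda>n. F) (\<lambda>x. lam * f x) sequentially"
        by (rule uniform_limitI) (auto simp: F_def)
    next
      fix v assume "is_pos_solution \<phi> c d h f lam v" "\<delta> \<le> sup_norm v" "sup_norm v \<le> r"
      with \<delta> show ?thesis by force
    qed (use FK in auto)
  qed
qed

end

section \<open>Large solutions\<close>

lemma small_near_zero:
  fixes f :: "real \<Rightarrow> real"
  assumes f: "continuous_on {0..} f" "f 0 = 0" and e: "0 < e"
  obtains d where "0 < d" "\<And>x. 0 \<le> x \<Longrightarrow> x < d \<Longrightarrow> f x < e"
proof -
  have "\<exists>d>0. \<forall>x\<in>{0..}. dist x 0 < d \<longrightarrow> dist (f x) (f 0) < e"
    using f(1) e unfolding continuous_on_iff by (meson atLeast_iff order.refl)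
  then obtain d where d: "0 < d" "\<forall>x\<in>{0..}. dist x 0 < d \<longrightarrow> dist (f x) (f 0) < e" by blast
  show ?thesis
  proof (rule that[OF d(1)])
    fix x :: real assume "0 \<le> x" "x < d"
    then have "dist (f x) (f 0) < e" using d(2) by (simp add: dist_real_def)
    then show "f x < e" using f(2) by (simp add: dist_real_def)
  qed
qed

context quasilinear_bvp
begin

lemma quotient_bounded:
  assumes f: "continuous_on {0..} f" and f0: "((\<lambda>s. f s / \<phi> s) \<longlongrightarrow> L) (at_right 0)"
  obtains C where "0 < C" "\<And>s. 0 < s \<Longrightarrow> s \<le> r \<Longrightarrow> f s \<le> C * \<phi> s"
proof -
  have "\<forall>\<^sub>F s in at_right 0. f s / \<phi> s < L + 1" by (rule order_tendstoD(2)[OF f0]) simp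
  then obtain e where e: "0 < e" "\<And>s. 0 < s \<Longrightarrow> s < e \<Longrightarrow> f s / \<phi> s < L + 1"
    by (auto simp: eventually_at_right_field)
  have "continuous_on {e..r} f" by (rule continuous_on_subset[OF f]) (use e in auto)
  then obtain m where m: "0 \<le> m" "\<And>x. x \<in> {e..r} \<Longrightarrow> \<bar>f x\<bar> \<le> m"
    using continuous_on_Icc_abs_bound by blast
  define C where "C = max 1 (max (L + 1) (m / \<phi> e))"
  have "f s \<le> C * \<phi> s" if s: "0 < s" "s \<le> r" for s
  proof (cases "s < e")
    case True
    have "f s < (L + 1) * \<phi> s" using e(2)[OF s(1) True] phi_pos[OF s(1)] by (simp add: pos_divide_less_eq)
    also have "\<dots> \<le> C * \<phi> s" using phi_pos[OF s(1)] by (intro mult_right_mono) (auto simp: C_def)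
    finally show ?thesis by simp
  next
    case False
    have "f s \<le> m" using m(2)[of s] s False by simp
    also have "m = m / \<phi> e * \<phi> e" using phi_pos[OF e(1)] by simp
    also have "\<dots> \<le> C * \<phi> s"
      using phi_pos[OF e(1)] m False by (intro mult_mono) (auto simp: C_def phi_le)
    finally show ?thesis .
  qed
  then show ?thesis by (intro that[of C]) (auto simp: C_def)
qed

lemma phi_tendsto_0: "(\<phi> \<longlongrightarrow> 0) (at_right 0)"
proof -
  have "(\<phi> \<longlongrightarrow> \<phi> 0) (at 0 within UNIV)" using phi_cont by (simp add: continuous_on_def)
  then show ?thesis using phi_zero by (auto intro: tendsto_within_subset)
qed

lemma zero_if_quotient_bounded:
  assumes f: "continuous_on {0..} f" "\<forall>s\<ge>0. 0 \<le> f s"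
    and C: "0 < r" "\<And>s. 0 < s \<Longrightarrow> s \<le> r \<Longrightarrow> f s \<le> C * \<phi> s"
  shows "f 0 = 0"
proof -
  have "(f \<longlongrightarrow> f 0) (at 0 within {0..})" using f(1) by (simp add: continuous_on_def)
  then have "(f \<longlongrightarrow> f 0) (at_right 0)" by (rule tendsto_within_subset) auto
  moreover have "((\<lambda>s. C * \<phi> s) \<longlongrightarrow> C * 0) (at_right 0)" by (intro tendsto_intros phi_tendsto_0)
  moreover have "\<forall>\<^sub>F s in at_right 0. f s \<le> C * \<phi> s"
    unfolding eventually_at_right_field using C by (intro exI[of _ r]) auto
  ultimately have "f 0 \<le> C * 0" using tendsto_le[of "at_right (0::real)" "\<lambda>s. C * \<phi> s" "C * 0" f "f 0"] by simp
  then show ?thesis using f(2)[rule_format, of 0] by simp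
qed

text \<open>Damping the nonlinearity near \<open>0\<close> makes shooting with a small initial flux overshoot.\<close>
definition damped :: "(real \<Rightarrow> real) \<Rightarrow> real \<Rightarrow> nat \<Rightarrow> real \<Rightarrow> real" where
  "damped f lam n x = lam * (f (max 0 x) * min 1 (real (Suc n) * max 0 x))"

lemma damped:
  assumes f: "continuous_on {0..} f" "\<forall>s\<ge>0. 0 \<le> f s" and lam: "0 < lam"
  shows "continuous_on UNIV (damped f lam n)" "0 \<le> damped f lam n x"
    "x \<le> 0 \<Longrightarrow> damped f lam n x = 0" "0 \<le> x \<Longrightarrow> damped f lam n x \<le> lam * f x"
    "0 \<le> x \<Longrightarrow> damped f lam n x \<le> lam * (f x * (real (Suc n) * x))"
    "1 / real (Suc n) \<le> x \<Longrightarrow> damped f lam n x = lam * f x"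
proof -
  show "continuous_on UNIV (damped f lam n)" unfolding damped_def
    by (intro continuous_intros continuous_on_compose2[OF f(1)]) auto
  show "0 \<le> damped f lam n x" "x \<le> 0 \<Longrightarrow> damped f lam n x = 0"
    using f(2)[rule_format, of "max 0 x"] lam by (auto simp: damped_def)
  show "damped f lam n x \<le> lam * f x" "damped f lam n x \<le> lam * (f x * (real (Suc n) * x))" if x: "0 \<le> x"
  proof -
    have "f x * min 1 (real (Suc n) * x) \<le> f x * 1"
      "f x * min 1 (real (Suc n) * x) \<le> f x * (real (Suc n) * x)"
      using f(2)[rule_format, OF x] by (intro mult_left_mono; simp)+
    then show "damped f lam n x \<le> lam * f x" "damped f lam n x \<le> lam * (f x * (real (Suc n) * x))"
      using lam x by (auto simp: damped_def simp del: of_nat_Suc intro!: mult_left_mono)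
  qed
  show "damped f lam n x = lam * f x" if x: "1 / real (Suc n) \<le> x"
  proof -
    have "0 < 1 / real (Suc n)" by simp
    then have "0 < x" using x by linarith
    moreover have "1 \<le> real (Suc n) * x" using x by (simp add: pos_divide_le_eq mult.commute del: of_nat_Suc)
    ultimately show ?thesis by (simp add: damped_def del: of_nat_Suc)
  qed
qed

text \<open>The damping acts only below 1 / (n + 1), where f is itself small because f vanishes at
  0.\<close>

lemma damped_uniform_limit:
  assumes f: "continuous_on {0..} f" "\<forall>s\<ge>0. 0 \<le> f s" and lam: "0 < lam" and f0: "f 0 = 0"
  shows "uniform_limit {0..R} (damped f lam) (\<lambda>x. lam * f x) sequentially"
proof (rule uniform_limitI)
  fix e :: real assume e: "0 < e"
  obtain d where d: "0 < d" "\<And>x. 0 \<le> x \<Longrightarrow> x < d \<Longrightarrow> f x < e / lam"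
    using small_near_zero[OF f(1) f0, of "e / lam"] e lam by auto
  obtain N where N: "inverse (real (Suc N)) < d" using reals_Archimedean[OF d(1)] by blast
  have "dist (damped f lam n x) (lam * f x) < e" if n: "N \<le> n" and x: "0 \<le> x" for n x
  proof (cases "1 / real (Suc n) \<le> x")
    case True
    then show ?thesis using damped(6)[OF f lam True] e by simp
  next
    case False
    have "1 / real (Suc n) \<le> inverse (real (Suc N))" using n by (simp add: field_simps)
    then have "f x < e / lam" using False N x by (intro d(2)) auto
    then have "lam * f x < e" using lam by (simp add: pos_less_divide_eq mult.commute)
    then show ?thesis
      using damped(2)[OF f lam, of n x] damped(4)[OF f lam x, of n] by (simp add: dist_real_def)
  qed
  then show "\<forall>\<^sub>F n in sequentially. \<forall>x\<in>{0..R}. dist (damped f lam n x) (lam * f x) < e"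
    unfolding eventually_sequentially by (intro exI[of _ N]) auto
qed

text \<open>Small initial flux overshoots thanks to the damping; large initial flux undershoots,
  because a solution with nonnegative end value is bounded by R. The solutions found reach r:
  otherwise f \<le> C \<phi> along them, and for small \<lambda> \<open>max_upper\<close> would make
  the maximum smaller than itself.\<close>

lemma large_solutions:
  assumes f: "continuous_on {0..} f" "\<forall>s\<ge>0. 0 \<le> f s"
    and f0: "((\<lambda>s. f s / \<phi> s) \<longlongrightarrow> L) (at_right 0)"
    and finf: "filterlim (\<lambda>s. f s / \<phi> s) at_top at_top" and r: "0 < r"
  obtains l where "0 < l" "\<And>lam. 0 < lam \<Longrightarrow> lam < l \<Longrightarrow>
    \<exists>v. is_pos_solution \<phi> c d h f lam v \<and> r \<le> sup_norm v"
proof -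
  \<comment> \<open>The range up to r serves the lower bound \<open>ge\<close>; the range up to 1
    serves shooting with small flux, where the solution stays below
    \<open>e1 \<le> 1\<close>.\<close>
  obtain C where C: "0 < C" "\<And>s. 0 < s \<Longrightarrow> s \<le> max r 1 \<Longrightarrow> f s \<le> C * \<phi> s"
    using quotient_bounded[OF f(1) f0, of "max r 1"] by blast
  have fz: "f 0 = 0" by (rule zero_if_quotient_bounded[OF f _ C(2)]) simp_all
  define D where "D = Q * (E 1 - E 0) / c1"
  have D: "0 \<le> D" unfolding D_def using E_mono[of 0 1] Q_ge_1 c1_pos by simp
  obtain e where e: "0 < e" "\<And>x. 0 \<le> x \<Longrightarrow> x < e \<Longrightarrow> k x < 1 / (D + 1)"
    using small_near_zero[OF k_cont k_zero, of "1 / (D + 1)"] D by auto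
  \<comment> \<open>For \<lambda> < l the argument \<lambda> C / d1 lies below e, which yields
    \<open>D * k (lam * C / d1) < 1\<close>.\<close>
  define l where "l = e * d1 / C"
  show ?thesis
  proof (rule that[of l])
    show "0 < l" unfolding l_def using e d1_pos C by simp
    fix lam assume lam: "0 < lam" "lam < l"
    define F where "F = damped f lam"
    note F = damped[OF f lam(1), folded F_def]
    have Fneg: "F n x = F n 0" if "x \<le> 0" for n x using F(3)[OF that, of n] F(3)[of 0 n] by simp
    have "lam * C / d1 < e" using lam C d1_pos by (simp add: l_def field_simps)
    then have "D * k (lam * C / d1) \<le> D * (1 / (D + 1))"
      using D lam C d1_pos e(2)[of "lam * C / d1"] by (intro mult_left_mono) auto
    also have "\<dots> < 1" using D by simp
    finally have Dk: "D * k (lam * C / d1) < 1" .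
    have ge: "r \<le> u \<sigma>" if T: "sol (F n) (lo n) (hi n) u w" and u: "u (lo n) = 0" "u (hi n) = 0"
      and \<sigma>: "\<sigma> \<in> {lo n..hi n}" "\<And>s. s \<in> {lo n..hi n} \<Longrightarrow> u s \<le> u \<sigma>" "0 < u \<sigma>" for n u w \<sigma>
    proof (rule ccontr)
      assume less: "\<not> r \<le> u \<sigma>"
      define K where "K = lam * C * \<phi> (u \<sigma>)"
      have K0: "0 \<le> K" unfolding K_def using lam C \<sigma> by (simp add: phi_nonneg)
      have FK: "F n (u t) \<le> K" if t: "t \<in> {lo n..hi n}" for t
      proof (cases "0 < u t")
        case True
        have "F n (u t) \<le> lam * f (u t)" using True by (intro F(4)) simp
        also have "\<dots> \<le> lam * (C * \<phi> (u t))"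
          using \<sigma>(2)[OF t] less True lam by (intro mult_left_mono C(2)) auto
        also have "\<dots> \<le> lam * (C * \<phi> (u \<sigma>))"
          using \<sigma>(2)[OF t] lam C by (intro mult_left_mono) (auto simp: phi_le)
        finally show ?thesis by (simp add: K_def)
      next
        case False
        then show ?thesis using F(3)[of "u t" n] K0 by simp
      qed
      have "u \<sigma> \<le> Q * (A K * (E 1 - E 0))"
        by (rule max_upper[OF T lo(1) _ _ hi(2) u \<sigma>(1,2) K0 FK])
          (use lo(2)[of n] hi(1)[of n] in auto)
      also have "\<dots> = D * g (\<phi> (u \<sigma>) * (lam * C / d1))"
        by (simp add: A_def D_def K_def mult_ac)
      also have "\<dots> \<le> D * (g (\<phi> (u \<sigma>)) * k (lam * C / d1))"
        using D lam C d1_pos \<sigma> by (intro mult_left_mono g_mult phi_nonneg) auto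
      also have "\<dots> = u \<sigma> * (D * k (lam * C / d1))" by (simp add: g_phi)
      also have "\<dots> < u \<sigma> * 1" using Dk \<sigma>(3) by (rule mult_strict_left_mono)
      finally show False by simp
    qed
    have "\<forall>\<^sub>F s in at_top. \<kappa> / lam < f s / \<phi> s"
      using finf by (simp add: filterlim_at_top_dense)
    then obtain R0 where R0: "\<And>s. R0 \<le> s \<Longrightarrow> \<kappa> / lam < f s / \<phi> s"
      by (auto simp: eventually_at_top_linorder)
    \<comment> \<open>Division by \<theta> pushes \<xi> above both R0 and 1; from 1 on the damping
      is inactive for every n.\<close>
    define R where "R = max 1 R0 / \<theta>"
    have R: "0 < R" unfolding R_def using theta_pos by simp
    have le: "u \<sigma> \<le> R" if T: "sol (F n) (lo n) (hi n) u w" and u: "u (lo n) = 0" "0 \<le> u (hi n)"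
      and \<sigma>: "\<sigma> \<in> {lo n..hi n}" "\<And>s. s \<in> {lo n..hi n} \<Longrightarrow> u s \<le> u \<sigma>" for n u w \<sigma>
    proof (rule ccontr)
      assume "\<not> u \<sigma> \<le> R"
      then have gt: "max 1 R0 < u \<sigma> * \<theta>"
        unfolding R_def not_le pos_divide_less_eq[OF theta_pos] .
      obtain \<xi> where \<xi>: "u \<sigma> * \<theta> \<le> \<xi>" "\<xi> \<le> u \<sigma>" "F n \<xi> \<le> \<kappa> * \<phi> \<xi>"
        by (rule nonlinearity_upper[OF T F(1) lo(1,3) hi(3,2) u \<sigma>])
      have x: "1 \<le> \<xi>" "R0 \<le> \<xi>" using gt \<xi>(1) by auto
      have "1 / real (Suc n) \<le> 1" by simp
      then have "F n \<xi> = lam * f \<xi>" using x by (intro F(6)) linarith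
      moreover have "\<kappa> * \<phi> \<xi> < lam * f \<xi>"
        using R0[OF x(2)] lam phi_pos[of \<xi>] x(1) by (simp add: field_simps)
      ultimately show False using \<xi>(3) by simp
    qed
    have "continuous_on {0..R} f" by (rule continuous_on_subset[OF f(1)]) auto
    then obtain m where m: "0 \<le> m" "\<And>x. x \<in> {0..R} \<Longrightarrow> \<bar>f x\<bar> \<le> m"
      using continuous_on_Icc_abs_bound by blast
    define K where "K = lam * m"
    have K0: "0 \<le> K" unfolding K_def using lam m by simp
    have FK: "F n x \<le> K" if "x \<le> R" for n x
    proof (cases "0 \<le> x")
      case True
      have "F n x \<le> lam * f x" by (rule F(4)[OF True])
      also have "\<dots> \<le> K" unfolding K_def using m(2)[of x] True that lam by (intro mult_left_mono) auto
      finally show ?thesis .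
    next
      case False
      then show ?thesis using F(3)[of x n] K0 by simp
    qed
    show "\<exists>v. is_pos_solution \<phi> c d h f lam v \<and> r \<le> sup_norm v"
    proof (rule pos_solution_by_approximation[OF f(1) r, of F R K lam])
      fix n
      have lh: "lo n < hi n" "hi n - lo n \<le> 1" "lo n \<le> 1/2" "1/2 \<le> hi n"
        using lo(1,2)[of n] hi(1,2)[of n] by auto
      define H1 where "H1 = H (hi n) - H (lo n)"
      have H1: "0 \<le> H1" unfolding H1_def using H_mono[of "lo n" "hi n"] lo(1)[of n] hi(2)[of n] lh by auto
      \<comment> \<open>Started at the flux p with \<open>Q * A p = e1\<close>, the solution loses
        at most \<open>p * (M * e1)\<close> of flux. The factor e1 is the gain from damping; without
        it the bound on the relative loss would not shrink with p, while \<open>H1\<close> may be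
        unbounded in n.\<close>
      define M where "M = lam * C * real (Suc n) * \<psi> (Q / c1) / d1 * H1"
      define e1 where "e1 = min 1 (1 / (2 * (\<bar>M\<bar> + 1)))"
      have e1: "0 < e1" "e1 \<le> 1" "M * e1 < 1"
      proof -
        show "0 < e1" "e1 \<le> 1" by (auto simp: e1_def)
        have "M * e1 \<le> \<bar>M\<bar> * (1 / (2 * (\<bar>M\<bar> + 1)))"
          using \<open>0 < e1\<close> by (intro mult_mono) (auto simp: e1_def)
        also have "\<dots> < 1" by (simp add: pos_divide_less_eq)
        finally show "M * e1 < 1" .
      qed
      define p where "p = d1 * \<phi> (c1 * (e1 / Q))"
      have p: "0 < p" unfolding p_def using e1 Q_ge_1 by (intro A_inverse_pos) simp
      have Ap: "Q * A p = e1" unfolding p_def A_inverse using Q_ge_1 by simp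
      \<comment> \<open>A velocity of at least y over the whole interval carries u past R,
        contradicting \<open>le\<close>; q leaves the flux needed for this velocity even after the
        largest possible loss.\<close>
      define y where "y = R / (hi n - lo n) + 1"
      have y: "0 < y" using R lh by (simp add: y_def add_pos_pos)
      have yR: "R < y * (hi n - lo n)" using lh unfolding y_def distrib_right by simp
      define q where "q = p + K * H1 + d1 * \<phi> (c1 * y)"
      have pq: "p \<le> q" using K0 H1 A_inverse_pos[OF y] by (simp add: q_def)
      obtain u w where T: "sol (F n) (lo n) (hi n) u w" "u (lo n) = 0" "u (hi n) = 0" "0 < w (lo n)"
      proof (rule bvp_by_shooting[OF lo(1) lh(1) hi(2) F(1,2) Fneg p pq, where s = "- 1"])
        fix u w assume T: "sol (F n) (lo n) (hi n) u w" and u: "u (lo n) = 0"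
        {
          assume w: "w (lo n) = p"
          have ue: "u t \<le> e1" if "t \<in> {lo n..hi n}" for t
            using u_upper[OF T u _ lh(2) that] w p Ap by simp
          have pe: "\<phi> e1 \<le> p / d1 * \<psi> (Q / c1)"
          proof -
            have "e1 = g (p / d1) * (Q / c1)" using Ap by (simp add: A_def mult.commute)
            then have "\<phi> e1 \<le> \<phi> (g (p / d1)) * \<psi> (Q / c1)"
              using phi_mult[of "g (p / d1)" "Q / c1"] g_nonneg[of "p / d1"] p d1_pos c1_pos Q_ge_1 by simp
            then show ?thesis by (simp add: phi_g)
          qed
          define K' where "K' = lam * (C * \<phi> e1 * (real (Suc n) * e1))"
          have K'0: "0 \<le> K'" unfolding K'_def using lam C e1 phi_pos[OF e1(1)] by simp
          have "F n (u t) \<le> K'" if t: "t \<in> {lo n..hi n}" for t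
          proof (cases "0 < u t")
            case True
            have "f (u t) \<le> C * \<phi> (u t)" using ue[OF t] True e1 by (intro C(2)) auto
            also have "\<dots> \<le> C * \<phi> e1" using ue[OF t] C by (intro mult_left_mono) (auto simp: phi_le)
            finally have "f (u t) * (real (Suc n) * u t) \<le> C * \<phi> e1 * (real (Suc n) * e1)"
              using ue[OF t] True C e1 phi_pos[OF e1(1)] by (intro mult_mono) auto
            then have "lam * (f (u t) * (real (Suc n) * u t)) \<le> K'"
              unfolding K'_def using lam by (intro mult_left_mono) auto
            then show ?thesis using F(5)[of "u t" n] True by linarith
          next
            case False
            then show ?thesis using F(3)[of "u t" n] K'0 by simp
          qed
          then have "w (lo n) - K' * H1 \<le> w (hi n)"
            unfolding H1_def by (intro end_flux_ge[OF T lo(1) _ hi(2)]) (use lh in auto)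
          moreover have "K' * H1 < p"
          proof -
            have "K' * H1 = lam * C * real (Suc n) * e1 * H1 * \<phi> e1" by (simp add: K'_def mult_ac)
            also have "\<dots> \<le> lam * C * real (Suc n) * e1 * H1 * (p / d1 * \<psi> (Q / c1))"
              using lam C e1 H1 by (intro mult_left_mono pe) auto
            also have "\<dots> = p * (M * e1)" by (simp add: M_def mult_ac)
            also have "\<dots> < p * 1" using e1(3) p by (rule mult_strict_left_mono)
            finally show ?thesis by simp
          qed
          ultimately have w1: "0 < w (hi n)" using w by linarith
          have "A (w (hi n)) * (hi n - lo n) \<le> u (hi n)"
            by (rule end_value_ge[OF T _ u]) (use lh w1 in auto)
          moreover have "0 < A (w (hi n)) * (hi n - lo n)" using A_pos[OF w1] lh by simp
          ultimately show "- 1 * u (hi n) < 0" by simp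
        next
          assume w: "w (lo n) = q"
          show "0 < - 1 * u (hi n)"
          proof (rule ccontr)
            assume "\<not> 0 < - 1 * u (hi n)"
            then have uh: "0 \<le> u (hi n)" by simp
            have wq: "0 < w (lo n)" using w p pq by simp
            obtain \<sigma> where \<sigma>: "\<sigma> \<in> {lo n..hi n}" "\<And>s. s \<in> {lo n..hi n} \<Longrightarrow> u s \<le> u \<sigma>"
              using exists_max[OF T lh(1) u wq] by metis
            have uR: "u t \<le> R" if "t \<in> {lo n..hi n}" for t
              using le[OF T u uh \<sigma>] \<sigma>(2)[OF that] by linarith
            have "w (lo n) - K * H1 \<le> w (hi n)"
              unfolding H1_def by (rule end_flux_ge[OF T lo(1) _ hi(2) FK[OF uR]]) (use lh in auto)
            then have w1: "d1 * \<phi> (c1 * y) \<le> w (hi n)" using w p by (simp add: q_def)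
            then have wp: "0 \<le> w (hi n)" using A_inverse_pos[OF y] by linarith
            have "y \<le> A (w (hi n))"
              using A_mono[OF _ w1] A_inverse_pos[OF y] by (simp add: A_inverse)
            then have "y * (hi n - lo n) \<le> A (w (hi n)) * (hi n - lo n)"
              using lh by (intro mult_right_mono) auto
            also have "\<dots> \<le> u (hi n)" by (rule end_value_ge[OF T _ u wp]) (use lh in auto)
            finally show False using uR[of "hi n"] yR lh by auto
          qed
        }
      qed blast
      obtain \<sigma> where \<sigma>: "\<sigma> \<in> {lo n..hi n}" "\<And>s. s \<in> {lo n..hi n} \<Longrightarrow> u s \<le> u \<sigma>" "0 < u \<sigma>"
        using exists_max[OF T(1) lh(1) T(2,4)] by metis
      have "u \<sigma> \<le> R" using le[OF T(1,2) _ \<sigma>(1,2)] T(3) by simp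
      moreover have "r \<le> u \<sigma>" by (rule ge[OF T(1,2,3) \<sigma>])
      ultimately show "\<exists>u w \<sigma>. sol (F n) (lo n) (hi n) u w \<and> u (lo n) = 0 \<and> u (hi n) = 0 \<and>
        \<sigma> \<in> {lo n..hi n} \<and> (\<forall>s\<in>{lo n..hi n}. u s \<le> u \<sigma>) \<and> r \<le> u \<sigma> \<and> u \<sigma> \<le> R"
        using T \<sigma> by blast
    next
      show "uniform_limit {0..R} F (\<lambda>x. lam * f x) sequentially"
        unfolding F_def by (rule damped_uniform_limit[OF f lam(1) fz])
    next
      fix v assume "is_pos_solution \<phi> c d h f lam v" "r \<le> sup_norm v" "sup_norm v \<le> R"
      then show ?thesis by blast
    qed (use FK in auto)
  qed
qed

end

section \<open>The main theorem\<close>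

lemma inv_nonneg_homeo:
  assumes "incr_homeo_nonneg \<psi>"
  shows "\<And>y. 0 \<le> y \<Longrightarrow> 0 \<le> inv_nonneg \<psi> y" "\<And>y. 0 \<le> y \<Longrightarrow> \<psi> (inv_nonneg \<psi> y) = y"
    "inv_nonneg \<psi> 0 = 0" "continuous_on {0..} (inv_nonneg \<psi>)"
    "\<And>x y. 0 \<le> x \<Longrightarrow> x \<le> y \<Longrightarrow> inv_nonneg \<psi> x \<le> inv_nonneg \<psi> y"
proof -
  obtain g where mono: "strict_mono_on {0..} \<psi>" and hom: "homeomorphism {0..} {0..} \<psi> g"
    using assms by (auto simp: incr_homeo_nonneg_def)
  have im: "\<psi> ` {0..} = {0..}" and g: "continuous_on {0..} g"
    and gp: "\<And>x. 0 \<le> x \<Longrightarrow> g (\<psi> x) = x"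
    using hom by (auto simp: homeomorphism_def)
  have inj: "inj_on \<psi> {0..}" by (rule strict_mono_on_imp_inj_on[OF mono])
  show nn: "0 \<le> inv_nonneg \<psi> y" and inv: "\<psi> (inv_nonneg \<psi> y) = y" if "0 \<le> y" for y
    using inv_into_into[of y \<psi> "{0..}"] f_inv_into_f[of y \<psi> "{0..}"] that im
    by (auto simp: inv_nonneg_def)
  have eq: "inv_nonneg \<psi> y = g y" if "0 \<le> y" for y
    using gp[OF nn[OF that]] inv[OF that] by simp
  show "continuous_on {0..} (inv_nonneg \<psi>)"
    using g by (rule continuous_on_cong[THEN iffD1, rotated 2]) (auto simp: eq)
  show mono': "inv_nonneg \<psi> x \<le> inv_nonneg \<psi> y" if "0 \<le> x" "x \<le> y" for x y
  proof (rule ccontr)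
    assume "\<not> ?thesis"
    then have "\<psi> (inv_nonneg \<psi> y) < \<psi> (inv_nonneg \<psi> x)"
      using nn that by (intro strict_mono_onD[OF mono]) auto
    then show False using inv[of x] inv[of y] that by simp
  qed
  have "0 \<le> \<psi> 0" using im by auto
  then have "inv_nonneg \<psi> 0 \<le> inv_nonneg \<psi> (\<psi> 0)" by (intro mono') auto
  also have "\<dots> = 0" using inj by (simp add: inv_nonneg_def)
  finally show "inv_nonneg \<psi> 0 = 0" using nn[of 0] by simp
qed

text \<open>The sign makes one function a primitive of h across 1/2, while its absolute value
  reproduces both inner integrals of the integrability condition.\<close>

lemma signed_primitive:
  assumes h: "continuous_on {0<..<1} h" "\<forall>t\<in>{0<..<1}. 0 \<le> h t"
  obtains H :: "real \<Rightarrow> real" where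
    "\<And>t. t \<in> {0<..<1} \<Longrightarrow> (H has_real_derivative h t) (at t)"
    "\<And>t. 0 < t \<Longrightarrow> t \<le> 1/2 \<Longrightarrow> \<bar>H t\<bar> = integral {t..1/2} h"
    "\<And>t. 1/2 \<le> t \<Longrightarrow> t < 1 \<Longrightarrow> \<bar>H t\<bar> = integral {1/2..t} h"
proof -
  define H where "H t = (if t \<le> 1/2 then - integral {t..1/2} h else integral {1/2..t} h)" for t
  have int: "h integrable_on {s..t}" if "0 < s" "t < 1" for s t
    using that by (intro integrable_continuous_real continuous_on_subset[OF h(1)]) auto
  have nn: "0 \<le> integral {s..t} h" if "0 < s" "t < 1" for s t
    using h(2) that by (intro integral_nonneg int) auto
  note combine = Henstock_Kurzweil_Integration.integral_combine[OF _ _ int]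
  show ?thesis
  proof (rule that[of H])
    show "(H has_real_derivative h t) (at t)" if t: "t \<in> {0<..<1}" for t
    proof (rule antiderivative_Ioo[OF h(1) _ t])
      fix s t :: real assume st: "0 < s" "s \<le> t" "t < 1"
      consider "t \<le> 1/2" | "s \<le> 1/2" "1/2 < t" | "1/2 < s" by linarith
      then show "H t - H s = integral {s..t} h"
      proof cases
        case 1
        then show ?thesis using combine[of s t "1/2"] st by (simp add: H_def)
      next
        case 2
        then show ?thesis using combine[of s "1/2" t] st by (simp add: H_def)
      next
        case 3
        then show ?thesis using combine[of "1/2" s t] st by (simp add: H_def)
      qed
    qed
    show "\<bar>H t\<bar> = integral {t..1/2} h" if "0 < t" "t \<le> 1/2" for t
      using that nn[of t "1/2"] by (simp add: H_def)
    show "\<bar>H t\<bar> = integral {1/2..t} h" if "1/2 \<le> t" "t < 1" for t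
    proof (cases "t = 1/2")
      case True
      show ?thesis unfolding True by (simp add: H_def)
    next
      case False
      then show ?thesis using that nn[of "1/2" t] by (simp add: H_def)
    qed
  qed
qed

text \<open>The function may be unbounded near 0 and 1, but its extension by zero is integrable, and
  an indefinite integral is continuous up to the ends.\<close>

lemma primitive_from_nn_integral:
  fixes f :: "real \<Rightarrow> real"
  assumes f: "continuous_on {0<..<1} f" "\<And>t. t \<in> {0<..<1} \<Longrightarrow> 0 \<le> f t"
    and fin: "(\<integral>\<^sup>+ t. indicator {0<..<1} t * ennreal (f t) \<partial>lborel) < \<infinity>"
  obtains E where "continuous_on {0..1} E"
    "\<And>t. t \<in> {0<..<1} \<Longrightarrow> (E has_real_derivative f t) (at t)"
proof -
  define f' where "f' t = indicator {0<..<1} t *\<^sub>R f t" for t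
  have eq: "f' t = f t" if "t \<in> {0<..<1}" for t using that by (simp add: f'_def)
  have m: "f' \<in> borel_measurable borel"
    unfolding f'_def by (rule borel_measurable_continuous_on_indicator[OF _ f(1)]) simp
  have nn: "0 \<le> f' t" for t using f(2)[of t] by (simp add: f'_def indicator_def)
  have "(\<integral>\<^sup>+ t. ennreal (f' t) \<partial>lborel) = (\<integral>\<^sup>+ t. indicator {0<..<1} t * ennreal (f t) \<partial>lborel)"
    by (intro nn_integral_cong) (auto simp: f'_def indicator_def)
  with fin have "(\<integral>\<^sup>+ t. ennreal (f' t) \<partial>lborel) < \<infinity>" by simp
  then obtain r where r: "0 \<le> r" "(\<integral>\<^sup>+ t. ennreal (f' t) \<partial>lborel) = ennreal r"
    by (cases "\<integral>\<^sup>+ t. ennreal (f' t) \<partial>lborel") auto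
  have "(f' has_integral r) UNIV"
    by (rule nn_integral_has_integral[OF m _ r(2,1)]) (use nn in auto)
  then have int: "f' integrable_on {s..t}" for s t
    using integrable_on_subcbox[of f' UNIV s t] by (auto simp: integrable_on_def)
  show ?thesis
  proof (rule that[of "\<lambda>t. integral {0..t} f'"])
    show "continuous_on {0..1} (\<lambda>t. integral {0..t} f')"
      by (rule indefinite_integral_continuous_1[OF int])
    fix t :: real assume t: "t \<in> {0<..<1}"
    show "((\<lambda>t. integral {0..t} f') has_real_derivative f t) (at t)"
    proof (rule antiderivative_Ioo[OF f(1) _ t])
      fix s t :: real assume st: "0 < s" "s \<le> t" "t < 1"
      have "integral {0..t} f' - integral {0..s} f' = integral {s..t} f'"
        using Henstock_Kurzweil_Integration.integral_combine[OF _ _ int, of 0 s t] st by simp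
      also have "\<dots> = integral {s..t} f" using st by (intro integral_cong eq) auto
      finally show "integral {0..t} f' - integral {0..s} f' = integral {s..t} f" .
    qed
  qed
qed

lemma setting_is_quasilinear_bvp:
  fixes \<phi> \<psi>1 \<psi>2 c d h :: "real \<Rightarrow> real"
  assumes phi: "odd_incr_homeo \<phi>" and A: "cond_A \<phi> \<psi>1 \<psi>2"
    and c: "continuous_on {0..1} c" "\<forall>t\<in>{0..1}. c t > 0"
    and d: "continuous_on {0..1} d" "\<forall>t\<in>{0..1}. d t > 0"
    and h: "continuous_on {0<..<1} h" "\<forall>t\<in>{0<..<1}. h t \<ge> 0" "\<exists>t\<in>{0<..<1}. h t \<noteq> 0"
    and hint: "h_integrability \<psi>1 h"
  obtains g k H E c0 c1 d0 d1 a0 x1 x2 b0 \<eta> where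
    "quasilinear_bvp \<phi> g k \<psi>2 c d h H E c0 c1 d0 d1 a0 x1 x2 b0 \<eta>"
proof -
  obtain g where mono: "strict_mono \<phi>" and hom: "homeomorphism UNIV UNIV \<phi> g"
    and odd: "\<And>x. \<phi> (- x) = - \<phi> x"
    using phi by (auto simp: odd_incr_homeo_def)
  have g: "\<And>y. \<phi> (g y) = y" "\<And>x. g (\<phi> x) = x" "continuous_on UNIV \<phi>" "continuous_on UNIV g"
    using hom by (auto simp: homeomorphism_def)
  have A': "incr_homeo_nonneg \<psi>1"
    "\<And>x y. 0 \<le> x \<Longrightarrow> 0 \<le> y \<Longrightarrow> \<phi> x * \<psi>1 y \<le> \<phi> (x * y)"
    "\<And>x y. 0 \<le> x \<Longrightarrow> 0 \<le> y \<Longrightarrow> \<phi> (x * y) \<le> \<phi> x * \<psi>2 y"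
    using A by (auto simp: cond_A_def)
  define k where "k = inv_nonneg \<psi>1"
  note k = inv_nonneg_homeo[OF A'(1), folded k_def]
  have le: "\<phi> x \<le> \<phi> y \<longleftrightarrow> x \<le> y" for x y using mono by (simp add: strict_mono_less_eq)
  have "\<phi> 0 = 0" using odd[of 0] by simp
  then have g0: "0 \<le> g x" if "0 \<le> x" for x using le[of 0 "g x"] g(1)[of x] that by simp
  have gk: "g (x * y) \<le> g x * k y" if "0 \<le> x" "0 \<le> y" for x y
    using A'(2)[OF g0[OF that(1)] k(1)[OF that(2)]] le[of "g (x * y)" "g x * k y"]
    by (simp add: g k(2)[OF that(2)])
  obtain c0 c1 where cb: "0 < c0" "\<And>t. t \<in> {0..1} \<Longrightarrow> c0 \<le> c t \<and> c t \<le> c1"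
    using continuous_attains_inf[OF compact_Icc _ c(1)] continuous_attains_sup[OF compact_Icc _ c(1)] c(2)
    by (metis atLeastAtMost_iff empty_iff order.refl zero_le_one)
  obtain d0 d1 where db: "0 < d0" "\<And>t. t \<in> {0..1} \<Longrightarrow> d0 \<le> d t \<and> d t \<le> d1"
    using continuous_attains_inf[OF compact_Icc _ d(1)] continuous_attains_sup[OF compact_Icc _ d(1)] d(2)
    by (metis atLeastAtMost_iff empty_iff order.refl zero_le_one)
  obtain t0 where t0: "t0 \<in> {0<..<1}" "0 < h t0" using h(2,3) by (metis order_le_less)
  have "isCont h t0" using h(1) t0(1) by (simp add: continuous_on_eq_continuous_at)
  then obtain e where e: "0 < e" "\<And>x. dist x t0 < e \<Longrightarrow> dist (h x) (h t0) < h t0 / 2"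
    unfolding continuous_at_eps_delta by (meson half_gt_zero t0(2))
  \<comment> \<open>Halving keeps the interval around t0 strictly inside (0, 1), which leaves room
    for a0 and b0.\<close>
  define \<epsilon> where "\<epsilon> = min e (min t0 (1 - t0)) / 2"
  have \<epsilon>: "0 < \<epsilon>" "\<epsilon> < e" "\<epsilon> < t0" "\<epsilon> < 1 - t0" using e t0(1) by (auto simp: \<epsilon>_def min_def)
  have hb: "h t0 / 2 \<le> h t" if "t \<in> {t0 - \<epsilon>..t0 + \<epsilon>}" for t
  proof -
    have "dist t t0 < e" using that \<epsilon> by (auto simp: dist_real_def)
    from e(2)[OF this] show ?thesis unfolding dist_real_def by linarith
  qed
  obtain H where H: "\<And>t. t \<in> {0<..<1} \<Longrightarrow> (H has_real_derivative h t) (at t)"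
    "\<And>t. 0 < t \<Longrightarrow> t \<le> 1/2 \<Longrightarrow> \<bar>H t\<bar> = integral {t..1/2} h"
    "\<And>t. 1/2 \<le> t \<Longrightarrow> t < 1 \<Longrightarrow> \<bar>H t\<bar> = integral {1/2..t} h"
    using signed_primitive[OF h(1,2)] by blast
  have H_mid: "H (1/2) = 0" using H(2)[of "1/2"] by simp
  have "continuous_on {0<..<1} H"
    using H(1) by (meson DERIV_isCont continuous_at_imp_continuous_on)
  then have kH: "continuous_on {0<..<1} (\<lambda>t. k \<bar>H t\<bar>)"
    by (intro continuous_on_compose2[OF k(4)] continuous_intros) auto
  \<comment> \<open>Stated as an inequality, since the point 1/2 is counted in both halves.\<close>
  have "(\<integral>\<^sup>+ t. indicator {0<..<1} t * ennreal (k \<bar>H t\<bar>) \<partial>lborel)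
      \<le> (\<integral>\<^sup>+ t. indicator {0<..1/2} t * ennreal (k \<bar>H t\<bar>) + indicator {1/2..<1} t * ennreal (k \<bar>H t\<bar>) \<partial>lborel)"
    by (intro nn_integral_mono) (auto simp: indicator_def)
  also have "\<dots> = (\<integral>\<^sup>+ t. indicator {0<..1/2} t * ennreal (k \<bar>H t\<bar>) \<partial>lborel)
      + (\<integral>\<^sup>+ t. indicator {1/2..<1} t * ennreal (k \<bar>H t\<bar>) \<partial>lborel)"
  proof (rule nn_integral_add)
    have *: "(\<lambda>t. indicator S t * ennreal (k \<bar>H t\<bar>)) \<in> borel_measurable lborel"
      if S: "S \<in> sets borel" "S \<subseteq> {0<..<1}" for S
    proof -
      have "(\<lambda>t. indicator S t *\<^sub>R k \<bar>H t\<bar>) \<in> borel_measurable borel"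
        by (rule borel_measurable_continuous_on_indicator[OF S(1) continuous_on_subset[OF kH S(2)]])
      then have "(\<lambda>t. ennreal (indicator S t *\<^sub>R k \<bar>H t\<bar>)) \<in> borel_measurable lborel" by simp
      then show ?thesis by (rule measurable_cong[THEN iffD1, rotated]) (auto simp: indicator_def)
    qed
    show "(\<lambda>t. indicator {0<..1/2} t * ennreal (k \<bar>H t\<bar>)) \<in> borel_measurable lborel"
      "(\<lambda>t. indicator {1/2..<1} t * ennreal (k \<bar>H t\<bar>)) \<in> borel_measurable lborel"
      by (rule *; auto)+
  qed
  also have "\<dots> = (\<integral>\<^sup>+ s. indicator {0<..1/2} s * ennreal (inv_nonneg \<psi>1 (integral {s..1/2} h)) \<partial>lborel)
      + (\<integral>\<^sup>+ s. indicator {1/2..<1} s * ennreal (inv_nonneg \<psi>1 (integral {1/2..s} h)) \<partial>lborel)"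
    by (intro arg_cong2[where f = "(+)"] nn_integral_cong) (auto simp: indicator_def k_def H(2,3))
  also have "\<dots> < \<infinity>" using hint by (simp add: h_integrability_def)
  finally obtain E where E: "continuous_on {0..1} E"
    "\<And>t. t \<in> {0<..<1} \<Longrightarrow> (E has_real_derivative k \<bar>H t\<bar>) (at t)"
    using primitive_from_nn_integral[OF kH] k(1) by (metis abs_ge_zero)
  have "quasilinear_bvp \<phi> g k \<psi>2 c d h H E c0 c1 d0 d1 ((t0 - \<epsilon>) / 2) (t0 - \<epsilon>) (t0 + \<epsilon>)
      ((t0 + \<epsilon> + 1) / 2) (h t0 / 2)"
    by unfold_locales (use mono odd g k gk A'(3) c(1) d(1) cb db h(1,2) hb \<epsilon> t0(2) H H_mid E in auto)
  then show ?thesis by (rule that)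
qed

text \<open>The thresholds for the individual n come without any monotonicity or lower bound, so
  each x receives the largest index, up to a cap, that admits a witness.\<close>

lemma diagonal_selection:
  fixes P :: "nat \<Rightarrow> real \<Rightarrow> 'a \<Rightarrow> bool"
  assumes "\<And>n. \<exists>l>0. \<forall>x. 0 < x \<longrightarrow> x < l \<longrightarrow> (\<exists>u. P n x u)"
  obtains l U N where "0 < l" "\<And>x. 0 < x \<Longrightarrow> x < l \<Longrightarrow> P (N x) x (U x)"
    "filterlim N at_top (at_right 0)"
proof -
  obtain l where l: "\<And>n. 0 < l n" "\<And>n x. 0 < x \<Longrightarrow> x < l n \<Longrightarrow> \<exists>u. P n x u"
    using assms by metis
  \<comment> \<open>The cap 1 / x makes the set finite, so that its maximum exists, and recedes to
    infinity as x tends to 0. For 0 < x < l 0 the set contains 0.\<close>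
  define S where "S x = {n. n \<le> nat \<lfloor>1 / x\<rfloor> \<and> (\<exists>u. P n x u)}" for x
  define N where "N x = Max (S x)" for x
  have fin: "finite (S x)" for x by (simp add: S_def)
  have "N x \<in> S x" if "0 < x" "x < l 0" for x
    unfolding N_def using l(2)[OF that] by (intro Max_in fin) (auto simp: S_def)
  then have "\<exists>u. P (N x) x u" if "0 < x" "x < l 0" for x using that by (auto simp: S_def)
  then obtain U where U: "\<And>x. 0 < x \<Longrightarrow> x < l 0 \<Longrightarrow> P (N x) x (U x)" by metis
  have "filterlim N at_top (at_right 0)"
    unfolding filterlim_at_top
  proof
    fix Z :: nat
    have "Z \<le> N x" if x: "0 < x" "x < min (l Z) (1 / (real Z + 1))" for x
    proof -
      have "real Z \<le> 1 / x" using x by (simp add: field_simps)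
      then have "Z \<in> S x" using l(2)[of x Z] x by (auto simp: S_def le_nat_floor)
      then show ?thesis unfolding N_def by (intro Max_ge fin)
    qed
    then show "\<forall>\<^sub>F x in at_right 0. Z \<le> N x"
      unfolding eventually_at_right_field using l(1)[of Z]
      by (intro exI[of _ "min (l Z) (1 / (real Z + 1))"]) auto
  qed
  with l(1) U that show ?thesis by blast
qed

theorem theorem3p7:
  fixes \<phi> \<psi>1 \<psi>2 c d f h :: "real \<Rightarrow> real"
  assumes phi: "odd_incr_homeo \<phi>"
    and A: "cond_A \<phi> \<psi>1 \<psi>2"
    and c: "continuous_on {0..1} c" "\<forall>t\<in>{0..1}. c t > 0"
    and d: "continuous_on {0..1} d" "\<forall>t\<in>{0..1}. d t > 0"
    and f: "continuous_on {0..} f" "\<forall>s\<ge>0. f s \<ge> 0" "\<forall>s>0. f s > 0"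
    and h: "continuous_on {0<..<1} h" "\<forall>t\<in>{0<..<1}. h t \<ge> 0" "\<exists>t\<in>{0<..<1}. h t \<noteq> 0"
    and hint: "h_integrability \<psi>1 h"
    and gam: "0 \<le> alpha_h h" "alpha_h h < gamma1_h h" "gamma1_h h < gamma2_h h"
      "gamma2_h h < beta_h h" "beta_h h \<le> 1"
  shows
   "((filterlim (\<lambda>s. f s / \<phi> s) at_top (at_right 0) \<and>
      (\<exists>L>0. ((\<lambda>s. f s / \<phi> s) \<longlongrightarrow> L) at_top)) \<longrightarrow>
     (\<exists>lam_s>0. \<exists>m_s::ereal. m_s > 0 \<and> (\<exists>U :: real \<Rightarrow> real \<Rightarrow> real.
        (\<forall>lam\<in>{0<..<lam_s}. is_pos_solution \<phi> c d h f lam (U lam) \<and>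
            0 < sup_norm (U lam) \<and> ereal (sup_norm (U lam)) < m_s) \<and>
        ((\<lambda>lam. sup_norm (U lam)) \<longlongrightarrow> 0) (at_right 0) \<and>
        (m_s < \<infinity> \<longrightarrow> (\<exists>u. is_pos_solution \<phi> c d h f lam_s u)))))
  \<and>
    (((\<exists>L>0. ((\<lambda>s. f s / \<phi> s) \<longlongrightarrow> L) (at_right 0)) \<and>
      filterlim (\<lambda>s. f s / \<phi> s) at_top at_top) \<longrightarrow>
     (\<exists>lam_s>0. \<exists>m_s::real. m_s \<ge> 0 \<and> (\<exists>U :: real \<Rightarrow> real \<Rightarrow> real.
        (\<forall>lam\<in>{0<..<lam_s}. is_pos_solution \<phi> c d h f lam (U lam) \<and>
            m_s < sup_norm (U lam)) \<and>
        filterlim (\<lambda>lam. sup_norm (U lam)) at_top (at_right 0) \<and>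
        (m_s > 0 \<longrightarrow> (\<exists>u. is_pos_solution \<phi> c d h f lam_s u)))))"
proof -
  obtain g k H E c0 c1 d0 d1 a0 x1 x2 b0 \<eta>
    where "quasilinear_bvp \<phi> g k \<psi>2 c d h H E c0 c1 d0 d1 a0 x1 x2 b0 \<eta>"
    by (rule setting_is_quasilinear_bvp[OF phi A c d h hint])
  then interpret quasilinear_bvp \<phi> g k \<psi>2 c d h H E c0 c1 d0 d1 a0 x1 x2 b0 \<eta> .
  have ev: "\<forall>\<^sub>F x in at_right 0. 0 < x \<and> x < l" if "0 < l" for l :: real
    using that by (auto simp: eventually_at_right_field intro!: exI[of _ l])
  show ?thesis
  proof (intro conjI impI; elim conjE exE)
    assume f0: "filterlim (\<lambda>s. f s / \<phi> s) at_top (at_right 0)"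
    define P where "P n lam u \<longleftrightarrow> is_pos_solution \<phi> c d h f lam u \<and> 0 < sup_norm u \<and>
      sup_norm u \<le> inverse (real (Suc n))" for n lam u
    have "\<exists>l>0. \<forall>lam. 0 < lam \<longrightarrow> lam < l \<longrightarrow> (\<exists>u. P n lam u)" for n
      unfolding P_def using small_solutions[OF f(1,2) f0, of "inverse (real (Suc n))"]
      by (metis inverse_positive_iff_positive of_nat_0_less_iff zero_less_Suc)
    then obtain l U N where l: "0 < l" "\<And>x. 0 < x \<Longrightarrow> x < l \<Longrightarrow> P (N x) x (U x)"
      "filterlim N at_top (at_right 0)"
      using diagonal_selection[of P] by metis
    have lim: "((\<lambda>lam. sup_norm (U lam)) \<longlongrightarrow> 0) (at_right 0)"
    proof (rule tendsto_sandwich[OF _ _ tendsto_const])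
      show "((\<lambda>lam. inverse (real (Suc (N lam)))) \<longlongrightarrow> 0) (at_right 0)"
        by (rule filterlim_compose[OF LIMSEQ_inverse_real_of_nat l(3)])
      show "\<forall>\<^sub>F lam in at_right 0. 0 \<le> sup_norm (U lam)"
        "\<forall>\<^sub>F lam in at_right 0. sup_norm (U lam) \<le> inverse (real (Suc (N lam)))"
        using ev[OF l(1)] by (eventually_elim, use l(2) in \<open>force simp: P_def\<close>)+
    qed
    show "\<exists>lam_s>0. \<exists>m_s::ereal. m_s > 0 \<and> (\<exists>U :: real \<Rightarrow> real \<Rightarrow> real.
        (\<forall>lam\<in>{0<..<lam_s}. is_pos_solution \<phi> c d h f lam (U lam) \<and>
            0 < sup_norm (U lam) \<and> ereal (sup_norm (U lam)) < m_s) \<and>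
        ((\<lambda>lam. sup_norm (U lam)) \<longlongrightarrow> 0) (at_right 0) \<and>
        (m_s < \<infinity> \<longrightarrow> (\<exists>u. is_pos_solution \<phi> c d h f lam_s u)))"
      using l(1,2) lim by (intro exI[of _ l] exI[of _ "\<infinity>::ereal"] exI[of _ U] conjI) (auto simp: P_def)
  next
    fix L :: real
    assume f0: "((\<lambda>s. f s / \<phi> s) \<longlongrightarrow> L) (at_right 0)"
      and finf: "filterlim (\<lambda>s. f s / \<phi> s) at_top at_top"
    \<comment> \<open>\<open>Suc n\<close> makes the bound positive already at n = 0, as
      \<open>large_solutions\<close> and the strict inequality against 0 demand.\<close>
    define P where "P n lam u \<longleftrightarrow> is_pos_solution \<phi> c d h f lam u \<and> real (Suc n) \<le> sup_norm u"
      for n lam u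
    have "\<exists>l>0. \<forall>lam. 0 < lam \<longrightarrow> lam < l \<longrightarrow> (\<exists>u. P n lam u)" for n
      unfolding P_def using large_solutions[OF f(1,2) f0 finf, of "real (Suc n)"]
      by (metis of_nat_0_less_iff zero_less_Suc)
    then obtain l U N where l: "0 < l" "\<And>x. 0 < x \<Longrightarrow> x < l \<Longrightarrow> P (N x) x (U x)"
      "filterlim N at_top (at_right 0)"
      using diagonal_selection[of P] by metis
    have lim: "filterlim (\<lambda>lam. sup_norm (U lam)) at_top (at_right 0)"
    proof (rule filterlim_at_top_mono[OF filterlim_compose[OF filterlim_real_sequentially l(3)]])
      show "\<forall>\<^sub>F lam in at_right 0. real (N lam) \<le> sup_norm (U lam)"
        using ev[OF l(1)] by eventually_elim (use l(2) in \<open>force simp: P_def\<close>)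
    qed
    show "\<exists>lam_s>0. \<exists>m_s::real. m_s \<ge> 0 \<and> (\<exists>U :: real \<Rightarrow> real \<Rightarrow> real.
        (\<forall>lam\<in>{0<..<lam_s}. is_pos_solution \<phi> c d h f lam (U lam) \<and>
            m_s < sup_norm (U lam)) \<and>
        filterlim (\<lambda>lam. sup_norm (U lam)) at_top (at_right 0) \<and>
        (m_s > 0 \<longrightarrow> (\<exists>u. is_pos_solution \<phi> c d h f lam_s u)))"
      using l(1,2) lim by (intro exI[of _ l] exI[of _ "0::real"] exI[of _ U] conjI) (force simp: P_def)+
  qed
qed

end
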